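(* Let $M$ be the standard torus of revolution with parameters $a,r$ satisfying $r<a<3r$. Then there exist closed embedded unduloid type curves in $M$ which are stable.
   Context: The standard torus with parameters $a>r>0$ is $\mathbb{S}^1\times[-\pi r,\pi r]$ with the metric $dt^2+f(t)^2d\theta^2$, $f(t)=a+r\cos(t/r)$, $\theta\in\mathbb{S}^1=\mathbb{R}/2\pi\mathbb{Z}$, with $\mathbb{S}^1\times\{\pi r\}$ and $\mathbb{S}^1\times\{-\pi r\}$ identified; it is obtained by rotating a circle of radius $r$ whose center is at distance $a$ from the axis. Its Gauss curvature is $K(t)=-f''(t)/f(t)$. For a curve $\gamma(s)=(\theta(s),t(s))$ parametrized by arc length, $\sigma$ is the oriented angle from $\partial_t$ to $d\gamma/ds$, and geodesic curvature is computed with respect to $N=\frac{\cos\sigma}{f(t)}\partial_\theta-\sin\sigma\,\partial_t$. A curve of constant geodesic curvature whose $t$-coordinate has a strict maximum at $s_0$ (with $\sin\sigma(s_0)=1$), with next critical point $s_1>s_0$ of $t$, is an unduloid type curve if $\sin\sigma(s_1)=1$ (it is then a nonconstant periodic graph over $\theta$). A closed curve $C$ with constant geodesic curvature $h$ is stable if it is a second order local minimum of length under variations keeping the enclosed area fixed, i.e. $I(u)=-\int_C u\{u''+(K+h^2)u\}\,ds\geq 0$ for all $u:C\to\mathbb{R}$ with $\int_C u\,ds=0$ (derivatives with respect to arc length). *)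

theory Defs
  imports "HOL-Analysis.Analysis"
begin

(* Points of the torus and tangent vectors are given by their coordinates (theta, t), in that order.
   The torus is the quotient of the (theta, t)-plane by the translations by 2 pi in theta and by
   2 pi r in t; a curve in it is given by a lift (theta, t) : R -> R^2, which always exists. *)

definition same_point :: "real \<Rightarrow> real \<times> real \<Rightarrow> real \<times> real \<Rightarrow> bool" where
  "same_point r p q \<longleftrightarrow>
     (\<exists>m n :: int. fst q = fst p + 2 * pi * of_int m \<and> snd q = snd p + 2 * pi * r * of_int n)"

definition warp :: "real \<Rightarrow> real \<Rightarrow> real \<Rightarrow> real" where
  "warp a r t = a + r * cos (t / r)"

definition metric :: "real \<Rightarrow> real \<Rightarrow> real \<times> real \<Rightarrow> real \<times> real \<Rightarrow> real \<times> real \<Rightarrow> real" where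
  "metric a r p v w = (warp a r (snd p))\<^sup>2 * (fst v * fst w) + snd v * snd w"

definition gauss_curvature :: "real \<Rightarrow> real \<Rightarrow> real \<Rightarrow> real" where
  "gauss_curvature a r t = - deriv (deriv (warp a r)) t / warp a r t"

definition smooth :: "(real \<Rightarrow> real) \<Rightarrow> bool" where
  "smooth g \<longleftrightarrow> (\<forall>n s. ((deriv ^^ n) g) differentiable (at s))"

definition arc_length_curve ::
    "real \<Rightarrow> real \<Rightarrow> (real \<Rightarrow> real) \<Rightarrow> (real \<Rightarrow> real) \<Rightarrow> bool" where
  "arc_length_curve a r \<theta> t \<longleftrightarrow> smooth \<theta> \<and> smooth t \<and>
     (\<forall>s. metric a r (\<theta> s, t s) (deriv \<theta> s, deriv t s) (deriv \<theta> s, deriv t s) = 1)"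

(* The velocity is cos(sigma) d_t + sin(sigma) d_theta / f; the orientation is the one in which
   (d_t, d_theta / f) is a positive orthonormal frame, so that the normal N below is the velocity
   rotated by + pi/2. *)
definition tangent_angle ::
    "real \<Rightarrow> real \<Rightarrow> (real \<Rightarrow> real) \<Rightarrow> (real \<Rightarrow> real) \<Rightarrow> (real \<Rightarrow> real) \<Rightarrow> bool" where
  "tangent_angle a r \<theta> t \<sigma> \<longleftrightarrow> continuous_on UNIV \<sigma> \<and>
     (\<forall>s. deriv t s = cos (\<sigma> s) \<and> warp a r (t s) * deriv \<theta> s = sin (\<sigma> s))"

definition normal :: "real \<Rightarrow> real \<Rightarrow> (real \<Rightarrow> real) \<Rightarrow> (real \<Rightarrow> real) \<Rightarrow> real \<Rightarrow> real \<times> real" where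
  "normal a r t \<sigma> s = (cos (\<sigma> s) / warp a r (t s), - sin (\<sigma> s))"

(* Covariant derivative of the velocity along the curve, for the Levi-Civita connection of
   dt^2 + f(t)^2 dtheta^2.  The nonzero Christoffel symbols are
   Gamma^theta_{theta t} = Gamma^theta_{t theta} = f'/f and Gamma^t_{theta theta} = - f f'. *)
definition acceleration ::
    "real \<Rightarrow> real \<Rightarrow> (real \<Rightarrow> real) \<Rightarrow> (real \<Rightarrow> real) \<Rightarrow> real \<Rightarrow> real \<times> real" where
  "acceleration a r \<theta> t s =
     (deriv (deriv \<theta>) s
        + 2 * (deriv (warp a r) (t s) / warp a r (t s)) * deriv t s * deriv \<theta> s,
      deriv (deriv t) s - warp a r (t s) * deriv (warp a r) (t s) * (deriv \<theta> s)\<^sup>2)"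

definition geodesic_curvature ::
    "real \<Rightarrow> real \<Rightarrow> (real \<Rightarrow> real) \<Rightarrow> (real \<Rightarrow> real) \<Rightarrow> (real \<Rightarrow> real) \<Rightarrow> real \<Rightarrow> real" where
  "geodesic_curvature a r \<theta> t \<sigma> s =
     metric a r (\<theta> s, t s) (acceleration a r \<theta> t s) (normal a r t \<sigma> s)"

definition cgc_curve ::
    "real \<Rightarrow> real \<Rightarrow> (real \<Rightarrow> real) \<Rightarrow> (real \<Rightarrow> real) \<Rightarrow> (real \<Rightarrow> real) \<Rightarrow> real \<Rightarrow> bool" where
  "cgc_curve a r \<theta> t \<sigma> h \<longleftrightarrow>
     arc_length_curve a r \<theta> t \<and> tangent_angle a r \<theta> t \<sigma> \<and>
     (\<forall>s. geodesic_curvature a r \<theta> t \<sigma> s = h)"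

(* The maximum is a local one: along such a curve t is periodic, so it attains the same maximum
   infinitely often. *)
definition unduloid_type ::
    "real \<Rightarrow> real \<Rightarrow> (real \<Rightarrow> real) \<Rightarrow> (real \<Rightarrow> real) \<Rightarrow> (real \<Rightarrow> real) \<Rightarrow> real \<Rightarrow> bool" where
  "unduloid_type a r \<theta> t \<sigma> h \<longleftrightarrow> cgc_curve a r \<theta> t \<sigma> h \<and>
     (\<exists>s0 s1. (\<forall>\<^sub>F s in at s0. t s < t s0) \<and> sin (\<sigma> s0) = 1 \<and>
        s0 < s1 \<and> deriv t s1 = 0 \<and> (\<forall>s\<in>{s0<..<s1}. deriv t s \<noteq> 0) \<and>
        sin (\<sigma> s1) = 1)"

definition closed_curve :: "real \<Rightarrow> (real \<Rightarrow> real) \<Rightarrow> (real \<Rightarrow> real) \<Rightarrow> real \<Rightarrow> bool" where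
  "closed_curve r \<theta> t L \<longleftrightarrow>
     0 < L \<and> (\<forall>s. same_point r (\<theta> s, t s) (\<theta> (s + L), t (s + L)))"

(* Injectivity of the induced map R / L Z -> torus; for a closed arc length curve this is
   embeddedness, and it makes L the length. *)
definition embedded_curve :: "real \<Rightarrow> (real \<Rightarrow> real) \<Rightarrow> (real \<Rightarrow> real) \<Rightarrow> real \<Rightarrow> bool" where
  "embedded_curve r \<theta> t L \<longleftrightarrow>
     (\<forall>s s'. same_point r (\<theta> s, t s) (\<theta> s', t s') \<longrightarrow> (\<exists>k :: int. s' = s + of_int k * L))"

(* Functions on the closed curve are L-periodic functions of arc length; they are taken of class C^2. *)
definition test_function :: "real \<Rightarrow> (real \<Rightarrow> real) \<Rightarrow> bool" where
  "test_function L u \<longleftrightarrow>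
     (\<forall>s. u (s + L) = u s) \<and>
     (\<forall>s. u differentiable (at s)) \<and> (\<forall>s. deriv u differentiable (at s)) \<and>
     continuous_on UNIV (deriv (deriv u))"

definition index_form ::
    "real \<Rightarrow> real \<Rightarrow> (real \<Rightarrow> real) \<Rightarrow> real \<Rightarrow> real \<Rightarrow> (real \<Rightarrow> real) \<Rightarrow> real" where
  "index_form a r t h L u =
     - integral {0..L} (\<lambda>s. u s * (deriv (deriv u) s + (gauss_curvature a r (t s) + h\<^sup>2) * u s))"

definition stable_curve :: "real \<Rightarrow> real \<Rightarrow> (real \<Rightarrow> real) \<Rightarrow> real \<Rightarrow> real \<Rightarrow> bool" where
  "stable_curve a r t h L \<longleftrightarrow>
     (\<forall>u. test_function L u \<and> integral {0..L} u = 0 \<longrightarrow> index_form a r t h L u \<ge> 0)"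

end

theory Submission
  imports Defs
begin

text \<open>
  Write \<open>b = a / r\<close>. The unduloids bifurcate from the parallel \<open>t = r \<pi> / 2\<close>. Along a curve of constant
  geodesic curvature \<open>f sin \<sigma> + h F(t)\<close> is constant (where \<open>F' = f\<close>), so \<open>t = r (m + e cos \<phi>)\<close> reduces
  the curve to a scalar equation \<open>\<phi>' = \<omega>(\<phi>)\<close> with \<open>\<omega> > 0\<close> periodic. For \<open>e = 0\<close> the period in \<open>\<theta>\<close> is
  \<open>2 \<pi> / sqrt (1 + b cos m)\<close>; hence for each small \<open>e\<close> some \<open>m\<close> near \<open>\<pi> / 2\<close> makes it equal to \<open>2 \<pi>\<close>.

  Rotations give the Jacobi field \<open>f \<omega> sin \<phi>\<close>. Dividing a variation by \<open>f \<omega>\<close> turns the index form into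
  \<open>\<integral> P (z'\<^sup>2 - z\<^sup>2) - (cos \<phi>) p' z\<^sup>2 d\<phi>\<close>, with \<open>P = f\<^sup>2 \<omega>\<^sup>3 = p (cos \<phi>)\<close>, on functions with \<open>\<integral> f z d\<phi> = 0\<close>.
  On odd functions it is nonnegative by a Picone identity with \<open>sin \<phi>\<close>. On even functions only the
  direction \<open>cos \<phi>\<close> is critical, and to second order in \<open>e\<close> the form there is a
  positive multiple of \<open>e\<^sup>2 (9 - b\<^sup>2)\<close>, which is where \<open>a < 3 r\<close> enters.
\<close>

section \<open>The index form in the angular variable\<close>

text \<open>On the limiting parallel the form is the integral of \<open>z'^2 - z^2\<close>, whose
  kernel is spanned by \<open>cos\<close> and \<open>sin\<close>; closeness to the parallel
  therefore decides nothing in these two directions. Rotations settle \<open>sin\<close> for every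
  \<open>e\<close>. For \<open>cos\<close> the form must be known up to \<open>o(e^2)\<close>, while
  \<open>m\<close> comes from an intermediate value argument and has no expansion in
  \<open>e\<close>. The way out is that the coefficient of \<open>e^2\<close> involves only
  \<open>P'/P\<close>, \<open>P''/P\<close> and \<open>f'/f\<close> near \<open>y = 0\<close>, so
  that their limits at \<open>(m, e, y) = (pi/2, 0, 0)\<close> suffice. To make these limits
  available, \<open>f^2 * (1 - sin^2 \<sigma>)\<close> is divided by \<open>e^2 - y^2\<close>
  through integral formulas that remain continuous at the turning points and as \<open>e\<close>
  tends to 0. Writing \<open>f1\<close>, \<open>p1\<close>, \<open>p2\<close> for the limits of
  \<open>f'/f\<close>, \<open>P'/P\<close>, \<open>P''/P\<close>, one finds
  \<open>f1 * p1 - p2/2 - f1^2/4 = (9 - b^2)/24\<close>.\<close>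

lemma FTC_real:
  fixes G g :: "real \<Rightarrow> real"
  assumes "a \<le> b" and "\<And>x. a \<le> x \<Longrightarrow> x \<le> b \<Longrightarrow> (G has_real_derivative g x) (at x)"
  shows "(g has_integral G b - G a) {a..b}"
  by (rule fundamental_theorem_of_calculus)
    (use assms in \<open>auto simp: has_real_derivative_iff_has_vector_derivative[symmetric]
       intro: has_field_derivative_at_within\<close>)

lemma exists_antiderivative:
  fixes g :: "real \<Rightarrow> real"
  assumes g: "continuous_on UNIV g"
  shows "\<exists>G. G 0 = 0 \<and> (\<forall>x. (G has_real_derivative g x) (at x))"
proof -
  \<comment> \<open>One of the two intervals is empty or a single point, so this is the integral
    from 0 to \<open>x\<close> with its sign.\<close>
  define G where "G x = integral {0..x} g - integral {x..0} g" for x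
  have G_eq: "G x = integral {-B..x} g - integral {-B..0} g" if "-B \<le> x" "0 \<le> B" for B x
  proof -
    have int: "g integrable_on {u..v}" for u v
      by (rule integrable_continuous_real) (use g continuous_on_subset in blast)
    show ?thesis
    proof (cases "0 \<le> x")
      case True
      then have "integral {x..0} g = 0" by (cases "x = 0") auto
      moreover have "integral {-B..0} g + integral {0..x} g = integral {-B..x} g"
        by (rule Henstock_Kurzweil_Integration.integral_combine) (use that True int in auto)
      ultimately show ?thesis by (simp add: G_def)
    next
      case False
      moreover have "integral {-B..x} g + integral {x..0} g = integral {-B..0} g"
        by (rule Henstock_Kurzweil_Integration.integral_combine) (use that False int in auto)
      ultimately show ?thesis by (simp add: G_def)
    qed
  qed
  have "(G has_real_derivative g x) (at x)" for x
  proof -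
    define B where "B = \<bar>x\<bar> + 1"
    have "((\<lambda>x. integral {-B..x} g) has_real_derivative g x) (at x within {-B..B})"
      by (rule integral_has_real_derivative) (use g continuous_on_subset B_def in auto)
    then have "((\<lambda>x. integral {-B..x} g) has_real_derivative g x) (at x)"
      by (subst (asm) at_within_interior) (auto simp: B_def)
    then have "((\<lambda>x. integral {-B..x} g - integral {-B..0} g) has_real_derivative g x) (at x)"
      by (auto intro!: derivative_eq_intros)
    then show ?thesis
    proof (rule has_field_derivative_transform_within_open[where S = "{-B<..}"])
      show "integral {-B..y} g - integral {-B..0} g = G y" if "y \<in> {-B<..}" for y
        using G_eq[of B y] that by (simp add: B_def)
    qed (auto simp: B_def)
  qed
  moreover have "G 0 = 0" by (simp add: G_def)
  ultimately show ?thesis by blast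
qed

lemma integrable_on_continuous_UNIV:
  fixes g :: "real \<Rightarrow> real"
  shows "continuous_on UNIV g \<Longrightarrow> g integrable_on {a..b}"
  by (rule integrable_continuous_real) (auto intro: continuous_on_subset)

lemma continuous_on_if_has_real_derivative:
  fixes g :: "real \<Rightarrow> real"
  assumes "\<And>x. (g has_real_derivative g' x) (at x)"
  shows "continuous_on UNIV g"
  using assms by (auto intro!: continuous_at_imp_continuous_on DERIV_isCont)

section \<open>Poincare inequalities on intervals of length \<open>pi/2\<close>\<close>

text \<open>A solution of the Riccati equation \<open>\<psi>' = 9/4 + \<psi>^2\<close> on the closed
  interval turns \<open>w^2 - 9/4 * W^2\<close>, up to the derivative of
  \<open>\<psi> * W^2\<close>, into the square \<open>(w + \<psi> * W)^2\<close>. The optimal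
  constant is 4, but its solution has poles at both ends.\<close>

lemma poincare_dirichlet:
  fixes W w :: "real \<Rightarrow> real"
  assumes W: "\<And>x. (W has_real_derivative w x) (at x)" and w: "continuous_on UNIV w"
    and ends: "W c = 0" "W (c + pi/2) = 0"
  shows "9/4 * integral {c..c + pi/2} (\<lambda>x. (W x)\<^sup>2) \<le> integral {c..c + pi/2} (\<lambda>x. (w x)\<^sup>2)"
proof -
  let ?d = "c + pi/2"
  note cW = continuous_on_if_has_real_derivative[OF W]
  \<comment> \<open>The argument of \<open>tan\<close> stays within \<open>3 * pi/8\<close> of 0 on
    the interval, so \<open>\<psi>\<close> is finite up to the ends.\<close>
  define \<psi> where "\<psi> x = 3/2 * tan (3/2 * (x - c - pi/4))" for x
  define G' where "G' x = (9/4 + (\<psi> x)\<^sup>2) * (W x)\<^sup>2 + 2 * \<psi> x * W x * w x" for x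
  have D: "((\<lambda>x. \<psi> x * (W x)\<^sup>2) has_real_derivative G' x) (at x)" if x: "c \<le> x" "x \<le> ?d" for x
  proof -
    have cos: "cos (3/2 * (x - c - pi/4)) > 0"
    proof (rule cos_gt_zero_pi)
      have "- (q/2) < 3/2 * (x - c - q/4) \<and> 3/2 * (x - c - q/4) < q/2"
        if "0 < q" "c \<le> x" "x \<le> c + q/2" for q :: real
        using that by (simp add: field_simps)
      from this[OF pi_gt_zero] x
      show "- (pi/2) < 3/2 * (x - c - pi/4)" "3/2 * (x - c - pi/4) < pi/2" by auto
    qed
    have "(tan has_real_derivative 1 + (tan (3/2 * (x - c - pi/4)))\<^sup>2) (at (3/2 * (x - c - pi/4)))"
      using DERIV_tan[of "3/2 * (x - c - pi/4)"] cos tan_sec[of "3/2 * (x - c - pi/4)"]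
      by (simp add: power_inverse)
    moreover have "((\<lambda>x. 3/2 * (x - c - pi/4)) has_real_derivative 3/2) (at x)"
      by (auto intro!: derivative_eq_intros)
    ultimately have "((\<lambda>x. 3/2 * tan (3/2 * (x - c - pi/4))) has_real_derivative
        3/2 * ((1 + (tan (3/2 * (x - c - pi/4)))\<^sup>2) * (3/2))) (at x)"
      by (intro DERIV_cmult DERIV_chain2)
    then have "(\<psi> has_real_derivative 9/4 + (\<psi> x)\<^sup>2) (at x)"
      unfolding \<psi>_def by (rule DERIV_cong) (simp add: power2_eq_square algebra_simps)
    note * = DERIV_mult[OF this DERIV_power[OF W[of x], of 2]]
    show ?thesis
      by (rule DERIV_cong[OF *]) (simp add: G'_def algebra_simps)
  qed
  have "(G' has_integral \<psi> ?d * (W ?d)\<^sup>2 - \<psi> c * (W c)\<^sup>2) {c..?d}"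
    by (rule FTC_real) (use D in auto)
  then have G: "(G' has_integral 0) {c..?d}"
    by (simp add: ends)
  have H: "((\<lambda>x. (w x)\<^sup>2 - 9/4 * (W x)\<^sup>2 + G' x) has_integral
      integral {c..?d} (\<lambda>x. (w x)\<^sup>2) - 9/4 * integral {c..?d} (\<lambda>x. (W x)\<^sup>2) + 0) {c..?d}"
    by (intro has_integral_add has_integral_diff has_integral_mult_right G integrable_integral
        integrable_on_continuous_UNIV continuous_intros w cW)
  have sq: "(w x)\<^sup>2 - 9/4 * (W x)\<^sup>2 + G' x = (w x + \<psi> x * W x)\<^sup>2" for x
    by (simp add: G'_def power2_eq_square algebra_simps)
  have "0 \<le> integral {c..?d} (\<lambda>x. (w x)\<^sup>2) - 9/4 * integral {c..?d} (\<lambda>x. (W x)\<^sup>2) + 0"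
    by (rule has_integral_nonneg[OF H]) (simp only: sq zero_le_power2)
  then show ?thesis by simp
qed

text \<open>The antiderivative \<open>W\<close> of \<open>w\<close> that vanishes at the left end
  vanishes at the right end too, and the Dirichlet inequality applies to it. The square
  \<open>(w' + 9/4 * W)^2\<close> carries the constant over from \<open>W\<close> to
  \<open>w\<close>, because \<open>W * w'\<close> and \<open>- w^2\<close> have the same
  integral.\<close>

lemma poincare_mean_zero:
  fixes w w' :: "real \<Rightarrow> real"
  assumes w: "\<And>x. (w has_real_derivative w' x) (at x)" and w': "continuous_on UNIV w'"
    and mean: "integral {c..c + pi/2} w = 0"
  shows "9/4 * integral {c..c + pi/2} (\<lambda>x. (w x)\<^sup>2) \<le> integral {c..c + pi/2} (\<lambda>x. (w' x)\<^sup>2)"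
proof -
  let ?d = "c + pi/2"
  note cw = continuous_on_if_has_real_derivative[OF w]
  from exists_antiderivative[OF cw] obtain W0 where W0: "\<And>x. (W0 has_real_derivative w x) (at x)"
    by blast
  define W where "W x = W0 x - W0 c" for x
  have W: "(W has_real_derivative w x) (at x)" for x
    unfolding W_def using W0[of x] by (auto intro!: derivative_eq_intros)
  note cW = continuous_on_if_has_real_derivative[OF W]
  have "(w has_integral W ?d - W c) {c..?d}" by (rule FTC_real) (use W in auto)
  then have ends: "W c = 0" "W ?d = 0" using mean by (auto simp: W_def dest: integral_unique)
  have "((\<lambda>x. W x * w x) has_real_derivative (w x)\<^sup>2 + W x * w' x) (at x)" for x
    by (rule DERIV_cong[OF DERIV_mult[OF W w]]) (simp add: power2_eq_square)
  then have "((\<lambda>x. (w x)\<^sup>2 + W x * w' x) has_integral W ?d * w ?d - W c * w c) {c..?d}"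
    by (intro FTC_real) auto
  then have G: "((\<lambda>x. (w x)\<^sup>2 + W x * w' x) has_integral 0) {c..?d}" using ends by simp
  have H: "((\<lambda>x. (w' x)\<^sup>2 - 9/2 * (w x)\<^sup>2 + 81/16 * (W x)\<^sup>2 + 9/2 * ((w x)\<^sup>2 + W x * w' x)) has_integral
      integral {c..?d} (\<lambda>x. (w' x)\<^sup>2) - 9/2 * integral {c..?d} (\<lambda>x. (w x)\<^sup>2)
      + 81/16 * integral {c..?d} (\<lambda>x. (W x)\<^sup>2) + 9/2 * 0) {c..?d}"
    by (intro has_integral_add has_integral_diff has_integral_mult_right G integrable_integral
        integrable_on_continuous_UNIV continuous_intros w' cw cW)
  have sq: "(w' x)\<^sup>2 - 9/2 * (w x)\<^sup>2 + 81/16 * (W x)\<^sup>2 + 9/2 * ((w x)\<^sup>2 + W x * w' x)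
      = (w' x + 9/4 * W x)\<^sup>2" for x
    by (simp add: power2_eq_square algebra_simps)
  have "0 \<le> integral {c..?d} (\<lambda>x. (w' x)\<^sup>2) - 9/2 * integral {c..?d} (\<lambda>x. (w x)\<^sup>2)
      + 81/16 * integral {c..?d} (\<lambda>x. (W x)\<^sup>2) + 9/2 * 0"
    by (rule has_integral_nonneg[OF H]) (simp only: sq zero_le_power2)
  with poincare_dirichlet[OF W cw ends] show ?thesis by simp
qed

section \<open>The form on odd functions\<close>

text \<open>On the open interval the integrand minus the derivative of
  \<open>p * cos * z^2 / sin\<close> equals \<open>p * (z' - z * cos / sin)^2\<close>: this is
  Picone's identity for \<open>sin\<close>, which solves the Euler equation of the form whatever
  \<open>p\<close> is. The end conditions are those of an odd \<open>2 * pi\<close>-periodic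
  function.\<close>

lemma index_odd_nonneg:
  fixes p p' z z' :: "real \<Rightarrow> real"
  assumes p: "\<And>x. \<bar>x\<bar> \<le> 1 \<Longrightarrow> (p has_real_derivative p' x) (at x)"
    and p': "continuous_on {-1..1} p'" and pos: "\<And>x. \<bar>x\<bar> \<le> 1 \<Longrightarrow> 0 \<le> p x"
    and z: "\<And>x. (z has_real_derivative z' x) (at x)" and z': "continuous_on UNIV z'"
    and ends: "z 0 = 0" "z pi = 0"
  shows "0 \<le> integral {0..pi} (\<lambda>x. p (cos x) * ((z' x)\<^sup>2 - (z x)\<^sup>2) - cos x * p' (cos x) * (z x)\<^sup>2)"
proof -
  note cz = continuous_on_if_has_real_derivative[OF z]
  have "continuous_on {-1..1} p"
    by (rule continuous_at_imp_continuous_on) (use p DERIV_isCont in force)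
  then have cp: "continuous_on UNIV (\<lambda>x. p (cos x))"
    by (rule continuous_on_compose2) (auto intro!: continuous_intros)
  have cp': "continuous_on UNIV (\<lambda>x. p' (cos x))"
    by (rule continuous_on_compose2[OF p']) (auto intro!: continuous_intros)
  define g where "g x = p (cos x) * ((z' x)\<^sup>2 - (z x)\<^sup>2) - cos x * p' (cos x) * (z x)\<^sup>2" for x
  have cg: "continuous_on UNIV g"
    unfolding g_def by (intro continuous_intros cp cp' cz z')
  from exists_antiderivative[OF cg] obtain H where H: "\<And>x. (H has_real_derivative g x) (at x)"
    by blast
  \<comment> \<open>With this bracketing one factor tends to 0 and the other has a finite limit at
    each end, so \<open>G\<close> is continuous on the closed interval and vanishes at both
    ends.\<close>
  define G where "G x = p (cos x) * cos x * (z x * (z x / sin x))" for x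
  have lim: "((\<lambda>x. z x * (z x / sin x)) \<longlongrightarrow> 0) (at a)" if a: "a = 0 \<or> a = pi" for a
  proof -
    have za: "z a = 0" using ends a by auto
    have sa: "sin a = 0" "cos a \<noteq> 0" using a by auto
    have "((\<lambda>x. (z x - z a) / (x - a)) \<longlongrightarrow> z' a) (at a)"
      using z[of a] by (simp add: has_field_derivative_iff)
    moreover have "((\<lambda>x. (sin x - sin a) / (x - a)) \<longlongrightarrow> cos a) (at a)"
      using DERIV_sin[of a] by (simp add: has_field_derivative_iff)
    ultimately have "((\<lambda>x. ((z x - z a) / (x - a)) / ((sin x - sin a) / (x - a))) \<longlongrightarrow> z' a / cos a) (at a)"
      by (rule tendsto_divide) (use sa in auto)
    moreover have "\<forall>\<^sub>F x in at a. ((z x - z a) / (x - a)) / ((sin x - sin a) / (x - a)) = z x / sin x"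
      using za sa by (auto simp: eventually_at_filter)
    ultimately have "((\<lambda>x. z x / sin x) \<longlongrightarrow> z' a / cos a) (at a)"
      by (rule Lim_transform_eventually)
    moreover have "(z \<longlongrightarrow> z a) (at a)" using DERIV_isCont[OF z[of a]] by (simp add: isCont_def)
    ultimately show ?thesis using tendsto_mult[of z "z a" "at a" "\<lambda>x. z x / sin x" "z' a / cos a"] za
      by simp
  qed
  have contG: "isCont G a" if "a \<in> {0..pi}" for a
  proof -
    have c: "isCont (\<lambda>x. p (cos x)) a" "isCont z a"
      using cp cz by (auto simp: continuous_on_eq_continuous_at)
    have "isCont (\<lambda>x. z x * (z x / sin x)) a"
    proof (cases "a = 0 \<or> a = pi")
      case True
      with lim[OF True] ends show ?thesis by (auto simp: isCont_def)
    next
      case False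
      then have "sin a > 0" using that by (auto intro!: sin_gt_zero)
      then have "sin a \<noteq> 0" by simp
      with c show ?thesis by (intro continuous_intros)
    qed
    from isCont_mult[OF isCont_mult[OF c(1) isCont_cos] this] show ?thesis
      unfolding G_def .
  qed
  have "H 0 - G 0 \<le> H pi - G pi"
  proof (rule DERIV_nonneg_imp_increasing_open[of 0 pi "\<lambda>x. H x - G x"])
    show "\<exists>y. ((\<lambda>x. H x - G x) has_real_derivative y) (at x) \<and> 0 \<le> y" if "0 < x" "x < pi" for x
    proof (intro exI conjI)
      have s: "sin x > 0" using that by (rule sin_gt_zero)
      have D: "((\<lambda>x. p (cos x)) has_real_derivative p' (cos x) * - sin x) (at x)"
        using DERIV_chain2[OF p[of "cos x"] DERIV_cos[of x]] by simp
      show "((\<lambda>x. H x - G x) has_real_derivative p (cos x) * (z' x - z x * cos x / sin x)\<^sup>2) (at x)"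
      proof (rule DERIV_cong)
        show "((\<lambda>x. H x - G x) has_real_derivative g x - ((p' (cos x) * - sin x * cos x + - sin x * p (cos x))
            * (z x * (z x / sin x)) + (z' x * (z x / sin x) + (z' x * sin x - z x * cos x) / (sin x * sin x) * z x)
            * (p (cos x) * cos x))) (at x)"
          unfolding G_def by (intro DERIV_diff H DERIV_mult D DERIV_cos z DERIV_divide DERIV_sin) (use s in simp)
        \<comment> \<open>Substituting \<open>z = \<zeta> * sin\<close> clears the denominators and
          leaves a polynomial identity.\<close>
        define \<zeta> where "\<zeta> = z x / sin x"
        have \<zeta>: "z x / sin x = \<zeta>" "z x = \<zeta> * sin x" using s by (auto simp: \<zeta>_def)
        have "(z' x * sin x - z x * cos x) / (sin x * sin x) * z x = (z' x - \<zeta> * cos x) * \<zeta>"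
          using s by (simp add: \<zeta>(2) field_simps)
        then show "g x - ((p' (cos x) * - sin x * cos x + - sin x * p (cos x))
            * (z x * (z x / sin x)) + (z' x * (z x / sin x) + (z' x * sin x - z x * cos x) / (sin x * sin x) * z x)
            * (p (cos x) * cos x)) = p (cos x) * (z' x - z x * cos x / sin x)\<^sup>2"
          unfolding g_def \<zeta>(1) times_divide_eq_left[symmetric]
          by (simp only: \<zeta>) (simp add: algebra_simps power2_eq_square)
      qed
      show "0 \<le> p (cos x) * (z' x - z x * cos x / sin x)\<^sup>2" using pos by simp
    qed
    show "continuous_on {0..pi} (\<lambda>x. H x - G x)"
      by (intro continuous_at_imp_continuous_on ballI continuous_diff contG DERIV_isCont[OF H])
  qed simp
  moreover have "G 0 = 0" "G pi = 0" by (auto simp: G_def ends)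
  moreover have "(g has_integral H pi - H 0) {0..pi}" by (rule FTC_real) (use H in auto)
  ultimately show ?thesis by (simp add: g_def[symmetric] integral_unique)
qed

lemma integral_squared_le:
  fixes q :: "real \<Rightarrow> real"
  assumes q: "continuous_on UNIV q" and "a < b"
  shows "(integral {a..b} q)\<^sup>2 \<le> (b - a) * integral {a..b} (\<lambda>x. (q x)\<^sup>2)"
proof -
  define \<mu> where "\<mu> = integral {a..b} q / (b - a)"
  have H: "((\<lambda>x. (q x)\<^sup>2 - 2 * \<mu> * q x + \<mu>\<^sup>2) has_integral
      integral {a..b} (\<lambda>x. (q x)\<^sup>2) - 2 * \<mu> * integral {a..b} q + (b - a) * \<mu>\<^sup>2) {a..b}"
    using has_integral_const_real[of "\<mu>\<^sup>2" a b] \<open>a < b\<close>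
    by (intro has_integral_add has_integral_diff has_integral_mult_right integrable_integral
        integrable_on_continuous_UNIV continuous_intros q) auto
  have sq: "(q x)\<^sup>2 - 2 * \<mu> * q x + \<mu>\<^sup>2 = (q x - \<mu>)\<^sup>2" for x
    by (simp add: power2_eq_square algebra_simps)
  have "0 \<le> integral {a..b} (\<lambda>x. (q x)\<^sup>2) - 2 * \<mu> * integral {a..b} q + (b - a) * \<mu>\<^sup>2"
    by (rule has_integral_nonneg[OF H]) (simp only: sq zero_le_power2)
  then have "0 \<le> (b - a) * (integral {a..b} (\<lambda>x. (q x)\<^sup>2) - 2 * \<mu> * integral {a..b} q + (b - a) * \<mu>\<^sup>2)"
    using \<open>a < b\<close> by simp
  also have "\<dots> = (b - a) * integral {a..b} (\<lambda>x. (q x)\<^sup>2) - 2 * ((b - a) * \<mu>) * integral {a..b} q + ((b - a) * \<mu>)\<^sup>2"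
    by (simp add: power2_eq_square algebra_simps)
  also have "(b - a) * \<mu> = integral {a..b} q" using \<open>a < b\<close> by (simp add: \<mu>_def)
  finally show ?thesis by (simp add: power2_eq_square)
qed

text \<open>On each half, \<open>w\<close> minus its mean satisfies the inequality with 9/4. The
  left mean is 0. The right one is small, since \<open>w\<close> and \<open>(1 - F) * w\<close> have
  the same integral over \<open>{0..pi}\<close>; by Cauchy-Schwarz its removal costs at most 2/25 of
  the integral of \<open>w^2\<close>, and \<open>9/4 * (1 - 2/25) > 2\<close>.\<close>

lemma poincare_half_mean_zero:
  fixes w w' F :: "real \<Rightarrow> real"
  assumes w: "\<And>x. (w has_real_derivative w' x) (at x)" and w': "continuous_on UNIV w'"
    and F: "continuous_on UNIV F" and F1: "\<And>x. \<bar>F x - 1\<bar> \<le> 1/5"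
    and left: "integral {0..pi/2} w = 0" and mean: "integral {0..pi} (\<lambda>x. F x * w x) = 0"
  shows "2 * integral {0..pi} (\<lambda>x. (w x)\<^sup>2) \<le> integral {0..pi} (\<lambda>x. (w' x)\<^sup>2)"
proof -
  note cw = continuous_on_if_has_real_derivative[OF w]
  note int = integrable_on_continuous_UNIV
  have split: "integral {0..pi} g = integral {0..pi/2} g + integral {pi/2..pi} g"
    if "continuous_on UNIV g" for g :: "real \<Rightarrow> real"
    by (rule Henstock_Kurzweil_Integration.integral_combine[symmetric]) (use int[OF that] in auto)
  have pi2: "pi/2 + pi/2 = pi" by simp
  define X where "X = integral {pi/2..pi} w"
  define \<mu> where "\<mu> = X / (pi/2)"
  have "9/4 * integral {0..0 + pi/2} (\<lambda>x. (w x)\<^sup>2) \<le> integral {0..0 + pi/2} (\<lambda>x. (w' x)\<^sup>2)"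
    by (rule poincare_mean_zero[OF w w']) (use left in simp)
  then have L: "9/4 * integral {0..pi/2} (\<lambda>x. (w x)\<^sup>2) \<le> integral {0..pi/2} (\<lambda>x. (w' x)\<^sup>2)" by simp
  have \<mu>int: "((\<lambda>x. \<mu>) has_integral X) {pi/2..pi}"
    using has_integral_const_real[of \<mu> "pi/2" pi] by (simp add: \<mu>_def)
  have "((\<lambda>x. w x - \<mu>) has_integral X - X) {pi/2..pi}"
    unfolding X_def by (intro has_integral_diff integrable_integral int cw \<mu>int[unfolded X_def])
  then have m0: "integral {pi/2..pi/2 + pi/2} (\<lambda>x. w x - \<mu>) = 0"
    unfolding pi2 by (simp add: integral_unique)
  have "((\<lambda>x. w x - \<mu>) has_real_derivative w' x) (at x)" for x
    using DERIV_diff[OF w[of x] DERIV_const] by simp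
  from poincare_mean_zero[OF this w' m0]
  have R: "9/4 * integral {pi/2..pi} (\<lambda>x. (w x - \<mu>)\<^sup>2) \<le> integral {pi/2..pi} (\<lambda>x. (w' x)\<^sup>2)"
    unfolding pi2 by simp
  have "((\<lambda>x. (w x)\<^sup>2 - 2 * \<mu> * w x + \<mu> * \<mu>) has_integral
      integral {pi/2..pi} (\<lambda>x. (w x)\<^sup>2) - 2 * \<mu> * X + \<mu> * X) {pi/2..pi}"
    unfolding X_def
    by (intro has_integral_add has_integral_diff has_integral_mult_right integrable_integral
        int continuous_intros cw \<mu>int[unfolded X_def])
  moreover have "(w x)\<^sup>2 - 2 * \<mu> * w x + \<mu> * \<mu> = (w x - \<mu>)\<^sup>2" for x
    by (simp add: power2_eq_square algebra_simps)
  ultimately have E: "integral {pi/2..pi} (\<lambda>x. (w x - \<mu>)\<^sup>2) = integral {pi/2..pi} (\<lambda>x. (w x)\<^sup>2) - \<mu> * X"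
    by (auto dest: integral_unique)
  have "((\<lambda>x. F x * w x) has_integral 0) {0..pi}"
    unfolding has_integral_iff mean using int[OF continuous_on_mult[OF F cw]] by simp
  then have "((\<lambda>x. w x - F x * w x) has_integral integral {0..pi} w - 0) {0..pi}"
    by (intro has_integral_diff integrable_integral int cw)
  then have X: "X = integral {0..pi} (\<lambda>x. w x - F x * w x)"
    using split[OF cw] left by (simp add: X_def integral_unique)
  have "X\<^sup>2 \<le> pi * integral {0..pi} (\<lambda>x. (w x - F x * w x)\<^sup>2)"
    unfolding X using integral_squared_le[of "\<lambda>x. w x - F x * w x" 0 pi]
    by (simp add: continuous_on_diff continuous_on_mult cw F)
  also have "integral {0..pi} (\<lambda>x. (w x - F x * w x)\<^sup>2) \<le> integral {0..pi} (\<lambda>x. 1/25 * (w x)\<^sup>2)"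
  proof (rule integral_le)
    fix x :: real
    have "(F x - 1)\<^sup>2 \<le> (1/5)\<^sup>2" using F1[of x] by (simp add: abs_le_square_iff[symmetric])
    then have "(F x - 1)\<^sup>2 * (w x)\<^sup>2 \<le> 1/25 * (w x)\<^sup>2"
      by (intro mult_right_mono) (auto simp: power2_eq_square)
    then show "(w x - F x * w x)\<^sup>2 \<le> 1/25 * (w x)\<^sup>2" by (simp add: power2_eq_square algebra_simps)
  qed (intro int continuous_intros cw F)+
  finally have "X\<^sup>2 \<le> pi * (1/25 * integral {0..pi} (\<lambda>x. (w x)\<^sup>2))" by (simp add: mult_left_mono)
  then have "\<mu> * X \<le> 2/25 * integral {0..pi} (\<lambda>x. (w x)\<^sup>2)"
    using pi_gt_zero by (simp add: \<mu>_def field_simps power2_eq_square)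
  then show ?thesis
    using L R E split[of "\<lambda>x. (w x)\<^sup>2"] split[of "\<lambda>x. (w' x)\<^sup>2"]
      integral_nonneg[OF int[of "\<lambda>x. (w x)\<^sup>2" 0 pi]]
    by (simp add: continuous_on_power cw w')
qed

section \<open>The form on even functions and its second-order coefficient\<close>

lemma mult_le_if_cube_mult_le:
  fixes M \<kappa> :: real
  assumes "1 \<le> M" "0 < \<kappa>" "\<kappa> * (100 * M^3) \<le> 1"
  shows "M * \<kappa> \<le> 1/100"
proof -
  have "M * \<kappa> \<le> M^3 * \<kappa>"
    using assms power_increasing[of 1 3 M] by (intro mult_right_mono) auto
  also have "M^3 * \<kappa> \<le> 1/100" using assms by (simp add: algebra_simps)
  finally show ?thesis .
qed

text \<open>In the application \<open>x\<close> is \<open>cos \<phi>\<close>, \<open>P\<close>,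
  \<open>P'\<close>, \<open>F\<close> are the weights at \<open>x\<close>, and
  \<open>cos + \<epsilon> * K\<close> has weighted mean zero. The fourth bound compares the factor
  of \<open>\<alpha>^2\<close> in the form with its expansion to second order. The fifth concerns
  the factor of the cross term: it is itself of order \<open>\<epsilon>\<close>, but a multiple of
  \<open>F\<close> can be subtracted because the constraint annihilates it, and the rest has order
  \<open>\<kappa> * \<epsilon>\<close>.\<close>

lemma index_even_bounds:
  fixes M \<kappa> \<epsilon> l p2 f1 K x P P' F :: real
  assumes M: "1 \<le> M" "\<bar>l\<bar> \<le> M" "\<bar>p2\<bar> \<le> M" "\<bar>f1\<bar> \<le> M" and \<kappa>: "\<kappa> * (100 * M^3) \<le> 1"
    and \<epsilon>: "0 < \<epsilon>" "\<epsilon> \<le> \<kappa>" and K: "\<bar>K + f1/2\<bar> \<le> 4 * \<kappa>"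
    and x: "\<bar>x\<bar> \<le> 1" and P: "\<bar>P - 1\<bar> \<le> \<kappa>" and P': "\<bar>P' - \<epsilon> * l - \<epsilon>\<^sup>2 * p2 * x\<bar> \<le> \<kappa> * \<epsilon>\<^sup>2"
    and F: "\<bar>F - 1 - \<epsilon> * f1 * x\<bar> \<le> \<kappa> * \<epsilon>"
  shows "\<bar>K\<bar> \<le> M" "\<bar>P'\<bar> \<le> 2 * M * \<epsilon>" "M * \<kappa> \<le> 1/100"
    "\<bar>x * P' + 2 * (\<epsilon> * K) * P' + (\<epsilon> * K)\<^sup>2 * (P + x * P')
      - (\<epsilon> * l * x + \<epsilon>\<^sup>2 * p2 * x\<^sup>2 + 2 * \<epsilon>\<^sup>2 * K * l + 2 * \<epsilon>^3 * K * p2 * x + \<epsilon>\<^sup>2 * K\<^sup>2)\<bar>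
      \<le> 6 * M^3 * \<kappa> * \<epsilon>\<^sup>2"
    "\<bar>P' + (\<epsilon> * K) * P + (\<epsilon> * K) * x * P' - (\<epsilon> * l + \<epsilon> * K) * F\<bar> \<le> 9 * M\<^sup>2 * \<kappa> * \<epsilon>"
    "\<bar>F - 1\<bar> \<le> 1/5"
proof -
  have M2: "1 \<le> M\<^sup>2" "M \<le> M\<^sup>2" "M\<^sup>2 \<le> M^3" 
    using M(1) power_increasing[of 1 2 M] power_increasing[of 2 3 M] by (auto simp: one_le_power)
  have k0: "0 < \<kappa>" using \<epsilon> by simp
  show M\<kappa>: "M * \<kappa> \<le> 1/100" by (rule mult_le_if_cube_mult_le[OF M(1) k0 \<kappa>])
  have "1 * \<kappa> \<le> M * \<kappa>" using M k0 by (intro mult_right_mono) auto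
  with M\<kappa> have k1: "\<kappa> \<le> 1/100" by simp
  show K1: "\<bar>K\<bar> \<le> M" using K M k1 by linarith
  have eM: "M * \<epsilon> \<le> 1/100" using mult_left_mono[of \<epsilon> \<kappa> M] \<epsilon> M M\<kappa> by linarith
  define d where "d = P' - \<epsilon> * l - \<epsilon>\<^sup>2 * p2 * x"
  have d: "\<bar>d\<bar> \<le> \<kappa> * \<epsilon>\<^sup>2" using P' by (simp add: d_def)
  have Pd: "P' = d + \<epsilon> * l + \<epsilon>\<^sup>2 * p2 * x" by (simp add: d_def)
  have px: "\<bar>p2 * x\<bar> \<le> M" using mult_mono[of "\<bar>p2\<bar>" M "\<bar>x\<bar>" 1] M x by (simp add: abs_mult)
  have d1: "\<bar>P' - \<epsilon> * l\<bar> \<le> 2 * M * \<kappa> * \<epsilon>"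
  proof -
    have "\<bar>P' - \<epsilon> * l\<bar> \<le> \<bar>d\<bar> + \<bar>\<epsilon>\<^sup>2 * (p2 * x)\<bar>" unfolding Pd by (simp add: algebra_simps)
    also have "\<dots> \<le> \<kappa> * \<epsilon>\<^sup>2 + \<epsilon>\<^sup>2 * M" using d px by (intro add_mono) (auto simp: abs_mult mult_left_mono)
    also have "\<dots> = (\<kappa> * \<epsilon> + \<epsilon> * M) * \<epsilon>" by (simp add: power2_eq_square algebra_simps)
    also have "\<dots> \<le> (\<kappa> * M + \<kappa> * M) * \<epsilon>"
      using \<epsilon> M k0 k1 by (intro mult_right_mono add_mono mult_mono) auto
    finally show ?thesis by (simp add: algebra_simps)
  qed
  have l1: "\<bar>\<epsilon> * l\<bar> \<le> M * \<epsilon>" using \<epsilon> M by (simp add: abs_mult)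
  show P1: "\<bar>P'\<bar> \<le> 2 * M * \<epsilon>"
  proof -
    have "2 * (M * \<kappa>) \<le> M" using M M\<kappa> by linarith
    then have "2 * (M * \<kappa>) * \<epsilon> \<le> M * \<epsilon>" using \<epsilon> by (intro mult_right_mono) auto
    then have "2 * M * \<kappa> * \<epsilon> \<le> M * \<epsilon>" by (simp only: mult.assoc)
    then show ?thesis using d1 l1 by linarith
  qed
  have xP: "\<bar>x * P'\<bar> \<le> 2 * M * \<epsilon>" using mult_mono[OF x P1] by (simp add: abs_mult)
  have F1: "\<bar>F - 1\<bar> \<le> 2 * M * \<epsilon>"
  proof -
    have "\<bar>f1 * x\<bar> \<le> M" using mult_mono[of "\<bar>f1\<bar>" M "\<bar>x\<bar>" 1] M x by (simp add: abs_mult)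
    then have "\<bar>\<epsilon> * (f1 * x)\<bar> \<le> \<epsilon> * M" using \<epsilon> by (simp add: abs_mult)
    moreover have "\<kappa> * \<epsilon> \<le> M * \<epsilon>" using k1 M \<epsilon> by (intro mult_right_mono) auto
    moreover have "\<epsilon> * (f1 * x) = \<epsilon> * f1 * x" "\<epsilon> * M = M * \<epsilon>" by simp_all
    ultimately show ?thesis using F by linarith
  qed
  then show "\<bar>F - 1\<bar> \<le> 1/5" using eM by linarith
  have "\<bar>P - 1 + x * P'\<bar> \<le> \<kappa> + 2 * M * \<epsilon>" using P xP by linarith
  also have "\<dots> \<le> M * \<kappa> + 2 * M * \<kappa>" using k0 \<epsilon> M by (intro add_mono mult_left_mono) auto
  finally have PP: "\<bar>P - 1 + x * P'\<bar> \<le> 3 * M * \<kappa>" by simp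
  \<comment> \<open>These three terms are exactly the difference to be bounded. The
    \<open>\<epsilon>^3\<close> term of the expansion is kept for this reason; like the linear one
    it is odd in \<open>x\<close> and integrates to 0 for \<open>x = cos \<phi>\<close>.\<close>
  have "\<bar>x * d + 2 * (\<epsilon> * K) * d + (\<epsilon> * K)\<^sup>2 * (P - 1 + x * P')\<bar>
      \<le> \<bar>x * d\<bar> + \<bar>2 * (\<epsilon> * K) * d\<bar> + \<bar>(\<epsilon> * K)\<^sup>2 * (P - 1 + x * P')\<bar>" by linarith
  also have "\<dots> \<le> 1 * (\<kappa> * \<epsilon>\<^sup>2) + 1 * (\<kappa> * \<epsilon>\<^sup>2) + (\<epsilon>\<^sup>2 * M\<^sup>2) * (3 * M * \<kappa>)"
  proof (intro add_mono)
    show "\<bar>x * d\<bar> \<le> 1 * (\<kappa> * \<epsilon>\<^sup>2)" unfolding abs_mult by (intro mult_mono x d) auto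
    have "\<epsilon> * \<bar>K\<bar> \<le> 1/2" using mult_left_mono[OF K1 less_imp_le[OF \<epsilon>(1)]] eM mult.commute[of \<epsilon> M] by linarith
    then have "\<bar>2 * (\<epsilon> * K)\<bar> \<le> 1" using \<epsilon> by (simp add: abs_mult)
    then show "\<bar>2 * (\<epsilon> * K) * d\<bar> \<le> 1 * (\<kappa> * \<epsilon>\<^sup>2)"
      unfolding abs_mult[of "2 * (\<epsilon> * K)"] by (intro mult_mono d) auto
    have "K\<^sup>2 \<le> M\<^sup>2" using K1 M by (simp add: abs_le_square_iff[symmetric])
    then have "(\<epsilon> * K)\<^sup>2 \<le> \<epsilon>\<^sup>2 * M\<^sup>2" by (simp add: power_mult_distrib mult_left_mono)
    then show "\<bar>(\<epsilon> * K)\<^sup>2 * (P - 1 + x * P')\<bar> \<le> (\<epsilon>\<^sup>2 * M\<^sup>2) * (3 * M * \<kappa>)"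
      unfolding abs_mult[of "(\<epsilon> * K)\<^sup>2"] by (intro mult_mono PP) auto
  qed
  also have "\<dots> = (2 + 3 * M^3) * \<kappa> * \<epsilon>\<^sup>2" by (simp add: power2_eq_square power3_eq_cube algebra_simps)
  also have "\<dots> \<le> (6 * M^3) * \<kappa> * \<epsilon>\<^sup>2" using M2 k0 by (intro mult_right_mono) auto
  finally show "\<bar>x * P' + 2 * (\<epsilon> * K) * P' + (\<epsilon> * K)\<^sup>2 * (P + x * P')
      - (\<epsilon> * l * x + \<epsilon>\<^sup>2 * p2 * x\<^sup>2 + 2 * \<epsilon>\<^sup>2 * K * l + 2 * \<epsilon>^3 * K * p2 * x + \<epsilon>\<^sup>2 * K\<^sup>2)\<bar>
      \<le> 6 * M^3 * \<kappa> * \<epsilon>\<^sup>2"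
    unfolding d_def by (simp add: power2_eq_square power3_eq_cube algebra_simps)
  have "\<bar>(P' - \<epsilon> * l) + (\<epsilon> * K) * (P - 1 + x * P') - (\<epsilon> * (l + K)) * (F - 1)\<bar>
      \<le> \<bar>P' - \<epsilon> * l\<bar> + \<bar>(\<epsilon> * K) * (P - 1 + x * P')\<bar> + \<bar>(\<epsilon> * (l + K)) * (F - 1)\<bar>" by linarith
  also have "\<dots> \<le> 2 * M * \<kappa> * \<epsilon> + (\<epsilon> * M) * (3 * M * \<kappa>) + (\<epsilon> * (2 * M)) * (2 * M * \<kappa>)"
  proof (intro add_mono d1)
    show "\<bar>(\<epsilon> * K) * (P - 1 + x * P')\<bar> \<le> (\<epsilon> * M) * (3 * M * \<kappa>)"
      unfolding abs_mult[of "\<epsilon> * K"] using \<epsilon> K1 M by (intro mult_mono PP) (auto simp: abs_mult)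
    have "\<bar>F - 1\<bar> \<le> 2 * M * \<kappa>" using F1 \<epsilon> M mult_left_mono[of \<epsilon> \<kappa> "2 * M"] by linarith
    moreover have "\<bar>l + K\<bar> \<le> 2 * M" using M K1 by linarith
    ultimately show "\<bar>(\<epsilon> * (l + K)) * (F - 1)\<bar> \<le> (\<epsilon> * (2 * M)) * (2 * M * \<kappa>)"
      unfolding abs_mult[of "\<epsilon> * (l + K)"] using \<epsilon> M by (intro mult_mono) (auto simp: abs_mult)
  qed
  also have "\<dots> = (2 * M + 7 * M\<^sup>2) * \<kappa> * \<epsilon>" by (simp add: power2_eq_square algebra_simps)
  also have "\<dots> \<le> (9 * M\<^sup>2) * \<kappa> * \<epsilon>" using M2 k0 \<epsilon> by (intro mult_right_mono) auto
  finally show "\<bar>P' + (\<epsilon> * K) * P + (\<epsilon> * K) * x * P' - (\<epsilon> * l + \<epsilon> * K) * F\<bar> \<le> 9 * M\<^sup>2 * \<kappa> * \<epsilon>"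
    by (simp add: algebra_simps)
qed


text \<open>Split \<open>z = \<alpha> * (cos + k) + w\<close> with both parts admissible. Choosing
  \<open>\<alpha>\<close> so that \<open>w\<close> has mean zero over the left half, instead of
  making \<open>w\<close> orthogonal to \<open>cos\<close>, gives \<open>w\<close> a small mean on
  both halves, and the Poincare inequalities there leave a positive amount of \<open>w\<close>. The
  coefficient of \<open>\<alpha>^2\<close> integrates to
  \<open>pi * \<epsilon>^2 * (f1 * l - p2/2 - f1^2/4)\<close> up to an error of order
  \<open>\<kappa> * \<epsilon>^2\<close>, which the second condition on \<open>\<kappa>\<close>
  makes harmless.\<close>

lemma index_even_nonneg:
  fixes p p' f z z' :: "real \<Rightarrow> real"
  assumes M: "1 \<le> M" "\<bar>l\<bar> \<le> M" "\<bar>p2\<bar> \<le> M" "\<bar>f1\<bar> \<le> M"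
    and \<kappa>: "\<kappa> * (100 * M^3) \<le> 1" "\<kappa> * (40 * M^3) \<le> f1 * l - p2/2 - f1\<^sup>2/4"
    and \<epsilon>: "0 < \<epsilon>" "\<epsilon> \<le> \<kappa>"
    and p: "\<And>x. \<bar>x\<bar> \<le> 1 \<Longrightarrow> (p has_real_derivative p' x) (at x)"
    and p': "continuous_on {-1..1} p'" and f: "continuous_on {-1..1} f"
    and p_near: "\<And>x. \<bar>x\<bar> \<le> 1 \<Longrightarrow> \<bar>p x - 1\<bar> \<le> \<kappa>"
    and p'_near: "\<And>x. \<bar>x\<bar> \<le> 1 \<Longrightarrow> \<bar>p' x - \<epsilon> * l - \<epsilon>\<^sup>2 * p2 * x\<bar> \<le> \<kappa> * \<epsilon>\<^sup>2"
    and f_near: "\<And>x. \<bar>x\<bar> \<le> 1 \<Longrightarrow> \<bar>f x - 1 - \<epsilon> * f1 * x\<bar> \<le> \<kappa> * \<epsilon>"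
    and z: "\<And>x. (z has_real_derivative z' x) (at x)" and z': "continuous_on UNIV z'"
    and mean: "integral {0..pi} (\<lambda>x. f (cos x) * z x) = 0"
  shows "0 \<le> integral {0..pi} (\<lambda>x. p (cos x) * ((z' x)\<^sup>2 - (z x)\<^sup>2) - cos x * p' (cos x) * (z x)\<^sup>2)"
proof -
  note int = integrable_on_continuous_UNIV
  note cz = continuous_on_if_has_real_derivative[OF z]
  have cos1: "\<bar>cos x\<bar> \<le> 1" for x :: real by simp
  have compcos: "continuous_on UNIV (\<lambda>x. g (cos x))" if "continuous_on {-1..1} g"
    for g :: "real \<Rightarrow> real"
    by (rule continuous_on_compose2[OF that]) (auto intro!: continuous_intros)
  have "continuous_on {-1..1} p"
    by (rule continuous_at_imp_continuous_on) (use p DERIV_isCont in force)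
  note cp = compcos[OF this] and cp' = compcos[OF p'] and cf = compcos[OF f]
  have k0: "0 < \<kappa>" using \<epsilon> by simp
  define A where "A = integral {0..pi} (\<lambda>x. f (cos x))"
  define B where "B = integral {0..pi} (\<lambda>x. f (cos x) * cos x)"
  have cosint: "(cos has_integral 0) {0..pi}"
    using FTC_real[of 0 pi sin cos] by (auto intro!: DERIV_sin)
  have cos2int: "((\<lambda>x. (cos x)\<^sup>2) has_integral pi/2) {0..pi}"
  proof -
    have "((\<lambda>x. (cos x)\<^sup>2) has_integral (pi + sin pi * cos pi)/2 - (0 + sin 0 * cos 0)/2) {0..pi}"
    proof (rule FTC_real)
      fix x :: real
      have "((\<lambda>x. (x + sin x * cos x)/2) has_real_derivative (1 + (cos x * cos x - sin x * sin x))/2) (at x)"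
        by (auto intro!: derivative_eq_intros)
      moreover have "(1 + (cos x * cos x - sin x * sin x))/2 = (cos x)\<^sup>2"
        using sin_cos_squared_add[of x] by (simp add: power2_eq_square field_simps)
      ultimately show "((\<lambda>x. (x + sin x * cos x)/2) has_real_derivative (cos x)\<^sup>2) (at x)" by simp
    qed simp
    then show ?thesis by simp
  qed
  have const: "((\<lambda>x. c) has_integral pi * c) {0..pi}" for c :: real
    using has_integral_const_real[of c 0 pi] by simp
  have int_abs_le: "\<bar>I\<bar> \<le> pi * c" if "(g has_integral I) {0..pi}" "\<And>x. \<bar>g x\<bar> \<le> c" for g c and I :: real
  proof -
    have "I \<le> pi * c" by (rule has_integral_le[OF that(1) const]) (use that(2) abs_le_D1 in blast)
    moreover have "pi * - c \<le> I"
      by (rule has_integral_le[OF const that(1)]) (use that(2) in \<open>simp add: abs_le_iff minus_le_iff\<close>)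
    ultimately show ?thesis by (simp add: abs_le_iff)
  qed
  have "((\<lambda>x. f (cos x) - 1 - \<epsilon> * f1 * cos x) has_integral A - pi * 1 - \<epsilon> * f1 * 0) {0..pi}"
    unfolding A_def
    by (intro has_integral_diff has_integral_mult_right const cosint integrable_integral int cf)
  from int_abs_le[OF this f_near[OF cos1]] have A: "\<bar>A - pi\<bar> \<le> pi * (\<kappa> * \<epsilon>)" by simp
  have "((\<lambda>x. f (cos x) * cos x - cos x - \<epsilon> * f1 * (cos x)\<^sup>2) has_integral B - 0 - \<epsilon> * f1 * (pi/2)) {0..pi}"
    unfolding B_def
    by (intro has_integral_diff has_integral_mult_right const cosint cos2int integrable_integral int
        continuous_intros cf)
  then have B: "\<bar>B - \<epsilon> * f1 * (pi/2)\<bar> \<le> pi * (\<kappa> * \<epsilon>)"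
  proof -
    assume I: "((\<lambda>x. f (cos x) * cos x - cos x - \<epsilon> * f1 * (cos x)\<^sup>2) has_integral B - 0 - \<epsilon> * f1 * (pi/2)) {0..pi}"
    have "\<bar>f (cos x) * cos x - cos x - \<epsilon> * f1 * (cos x)\<^sup>2\<bar> \<le> \<kappa> * \<epsilon>" for x
    proof -
      have "f (cos x) * cos x - cos x - \<epsilon> * f1 * (cos x)\<^sup>2 = (f (cos x) - 1 - \<epsilon> * f1 * cos x) * cos x"
      by (simp add: power2_eq_square algebra_simps)
      then show ?thesis
        using mult_mono[OF f_near[OF cos1[of x]] cos1[of x]] k0 \<epsilon> by (simp add: abs_mult)
    qed
    from int_abs_le[OF I this] show ?thesis by simp
  qed
  have M\<kappa>: "M * \<kappa> \<le> 1/100" by (rule mult_le_if_cube_mult_le[OF M(1) k0 \<kappa>(1)])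
  have M\<epsilon>: "M * \<epsilon> \<le> 1/100" using mult_left_mono[of \<epsilon> \<kappa> M] \<epsilon> M M\<kappa> by linarith
  have k1: "\<kappa> \<le> 1/100" using mult_right_mono[OF M(1), of \<kappa>] k0 M\<kappa> by linarith
  have "\<kappa> * \<epsilon> \<le> 1/2 * 1" using k1 \<epsilon> by (intro mult_mono) auto
  then have "pi * (\<kappa> * \<epsilon>) \<le> pi * (1/2)" by (intro mult_left_mono) auto
  then have Apos: "pi/2 \<le> A" using A by linarith
  then have A0: "A > 0" using pi_gt_zero by linarith
  \<comment> \<open>This makes the weighted mean of \<open>cos + \<epsilon> * K\<close> vanish. As
    \<open>A\<close> is close to \<open>pi\<close> and \<open>B\<close> to
    \<open>\<epsilon> * f1 * (pi/2)\<close>, \<open>K\<close> is close to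
    \<open>- f1/2\<close>.\<close>
  define K where "K = - B / (\<epsilon> * A)"
  have K: "\<bar>K + f1/2\<bar> \<le> 4 * \<kappa>"
  proof -
    have "\<bar>\<epsilon> * f1 * (A - pi)\<bar> \<le> 1 * (pi * (\<kappa> * \<epsilon>))"
      unfolding abs_mult[of "\<epsilon> * f1"]
    proof (intro mult_mono A)
      have "\<epsilon> * \<bar>f1\<bar> \<le> M * \<epsilon>" using mult_left_mono[OF M(4), of \<epsilon>] \<epsilon> by (simp add: mult.commute)
      moreover have "\<bar>\<epsilon> * f1\<bar> = \<epsilon> * \<bar>f1\<bar>" using \<epsilon> by (simp add: abs_mult)
      ultimately show "\<bar>\<epsilon> * f1\<bar> \<le> 1" using M\<epsilon> by linarith
    qed auto
    moreover have "(K + f1/2) * (2 * \<epsilon> * A) = \<epsilon> * f1 * (A - pi) - 2 * (B - \<epsilon> * f1 * (pi/2))"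
      using A0 \<epsilon> by (simp add: K_def field_simps)
    moreover have "\<bar>u - 2 * v\<bar> \<le> 3 * q" if "\<bar>u\<bar> \<le> 1 * q" "\<bar>v\<bar> \<le> q" for u v q :: real
      using that by linarith
    ultimately have "\<bar>(K + f1/2) * (2 * \<epsilon> * A)\<bar> \<le> 3 * (pi * (\<kappa> * \<epsilon>))" using B by simp
    also have "\<dots> \<le> (4 * \<kappa>) * (2 * \<epsilon> * (pi/2))" using k0 \<epsilon> by simp
    also have "\<dots> \<le> (4 * \<kappa>) * (2 * \<epsilon> * A)" using Apos k0 \<epsilon> by (intro mult_left_mono) auto
    finally show ?thesis using A0 \<epsilon> by (simp add: abs_mult)
  qed
  note bounds = index_even_bounds[OF M \<kappa>(1) \<epsilon> K cos1 p_near[OF cos1] p'_near[OF cos1] f_near[OF cos1]]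
  define k where "k = \<epsilon> * K"
  have z0_left: "((\<lambda>x. cos x + k) has_integral 1 + pi/2 * k) {0..pi/2}"
  proof -
    have "((\<lambda>x. cos x + k) has_integral (sin (pi/2) + k * (pi/2)) - (sin 0 + k * 0)) {0..pi/2}"
      by (rule FTC_real) (auto intro!: derivative_eq_intros)
    then show ?thesis by (simp add: mult.commute)
  qed
  have "\<bar>k\<bar> \<le> 1/100"
  proof -
    have "\<bar>k\<bar> = \<bar>K\<bar> * \<epsilon>" using \<epsilon> by (simp add: k_def abs_mult)
    then show ?thesis using mult_right_mono[OF bounds(1) less_imp_le[OF \<epsilon>(1)]] M\<epsilon> by linarith
  qed
  then have "\<bar>pi/2 * k\<bar> \<le> 2 * (1/100)"
    unfolding abs_mult using pi_less_4 by (intro mult_mono) auto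
  then have "1 + pi/2 * k \<noteq> 0" by linarith
  define \<alpha> where "\<alpha> = integral {0..pi/2} z / (1 + pi/2 * k)"
  define w where "w x = z x - \<alpha> * (cos x + k)" for x
  define w' where "w' x = z' x + \<alpha> * sin x" for x
  have w: "(w has_real_derivative w' x) (at x)" for x
    unfolding w_def w'_def using z[of x] by (auto intro!: derivative_eq_intros)
  have cw': "continuous_on UNIV w'" unfolding w'_def by (intro continuous_intros z')
  note cw = continuous_on_if_has_real_derivative[OF w]
  have "(w has_integral integral {0..pi/2} z - \<alpha> * (1 + pi/2 * k)) {0..pi/2}"
    unfolding w_def by (intro has_integral_diff has_integral_mult_right z0_left integrable_integral int cz)
  then have left: "integral {0..pi/2} w = 0"
    using \<open>1 + pi/2 * k \<noteq> 0\<close> by (simp add: integral_unique \<alpha>_def)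
  have "((\<lambda>x. f (cos x) * z x - \<alpha> * (f (cos x) * cos x + k * f (cos x))) has_integral
      integral {0..pi} (\<lambda>x. f (cos x) * z x) - \<alpha> * (B + k * A)) {0..pi}"
    unfolding A_def B_def by (intro has_integral_diff has_integral_add has_integral_mult_right
        integrable_integral int continuous_intros cf cz)
  moreover have "B + k * A = 0" using A0 \<epsilon> by (simp add: k_def K_def)
  ultimately have "((\<lambda>x. f (cos x) * z x - \<alpha> * (f (cos x) * cos x + k * f (cos x))) has_integral 0) {0..pi}"
    by (simp only: mean mult_zero_right diff_0_right)
  then have fw: "((\<lambda>x. f (cos x) * w x) has_integral 0) {0..pi}"
    by (simp add: w_def algebra_simps)
  have poinc: "2 * integral {0..pi} (\<lambda>x. (w x)\<^sup>2) \<le> integral {0..pi} (\<lambda>x. (w' x)\<^sup>2)"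
    by (rule poincare_half_mean_zero[OF w cw' cf bounds(6) left]) (use fw in \<open>simp add: integral_unique\<close>)
  define J where "J x = p (cos x) * ((z' x)\<^sup>2 - (z x)\<^sup>2) - cos x * p' (cos x) * (z x)\<^sup>2" for x
  \<comment> \<open>Subtracting \<open>G'\<close> integrates by parts the terms with the derivative
    of \<open>\<alpha> * cos\<close>: the products \<open>\<alpha> * w'\<close> disappear, and the
    boundary terms vanish with \<open>sin\<close>.\<close>
  define G where "G x = - p (cos x) * sin x * (\<alpha>\<^sup>2 * (cos x + 2 * k) + 2 * \<alpha> * w x)" for x
  define G' where "G' x = (p' (cos x) * (sin x)\<^sup>2 - p (cos x) * cos x) * (\<alpha>\<^sup>2 * (cos x + 2 * k) + 2 * \<alpha> * w x)
    + - p (cos x) * sin x * (- \<alpha>\<^sup>2 * sin x + 2 * \<alpha> * w' x)" for x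
  have "(G has_real_derivative G' x) (at x)" for x
  proof -
    have "((\<lambda>x. p (cos x)) has_real_derivative p' (cos x) * - sin x) (at x)"
      using DERIV_chain2[OF p[OF cos1] DERIV_cos[of x]] by simp
    then show ?thesis
      unfolding G_def
      by (auto intro!: derivative_eq_intros w simp: G'_def power2_eq_square algebra_simps)
  qed
  then have "(G' has_integral G pi - G 0) {0..pi}" by (intro FTC_real) auto
  then have G': "(G' has_integral 0) {0..pi}" by (simp add: G_def)
  \<comment> \<open>The cross term has a factor of size at most \<open>\<eta> * \<epsilon>\<close>.
    It splits into \<open>\<eta> * \<epsilon>^2 * \<alpha>^2\<close>, which goes into
    \<open>E\<close>, and \<open>\<eta> * w^2\<close>, which the Poincare inequality
    absorbs.\<close>
  define \<eta> where "\<eta> = 9 * M\<^sup>2 * \<kappa>"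
  have M23: "M\<^sup>2 * \<kappa> \<le> M^3 * \<kappa>" using M k0 power_increasing[of 2 3 M] by (intro mult_right_mono) auto
  have M3: "\<kappa> * (c * M^3) = c * (M^3 * \<kappa>)" for c by simp
  have \<eta>_eq: "\<eta> = 9 * (M\<^sup>2 * \<kappa>)" by (simp add: \<eta>_def)
  have \<eta>: "0 \<le> \<eta>" "\<eta> \<le> 9/100" "\<eta> \<le> 9 * (M^3 * \<kappa>)"
    using M23 \<kappa>(1) k0 unfolding \<eta>_eq M3 by (simp, linarith, linarith)
  define E where "E = 6 * M^3 * \<kappa> * \<epsilon>\<^sup>2 + \<eta> * \<epsilon>\<^sup>2"
  define T where "T x = \<epsilon> * l * x + \<epsilon>\<^sup>2 * p2 * x\<^sup>2 + 2 * \<epsilon>\<^sup>2 * K * l + 2 * \<epsilon>^3 * K * p2 * x + \<epsilon>\<^sup>2 * K\<^sup>2" for x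
  \<comment> \<open>The last summand integrates to 0 by the constraint on \<open>w\<close>, so it
    may be added. Here 9/10 bounds \<open>p\<close> from below, and 6/5 is 11/10, a bound for
    \<open>p + cos * p'\<close>, plus 1/10 for \<open>\<eta>\<close>.\<close>
  have pointwise: "- (\<alpha>\<^sup>2 * (T (cos x) + E)) + (9/10 * (w' x)\<^sup>2 - 6/5 * (w x)\<^sup>2)
      \<le> J x - G' x + 2 * \<alpha> * (\<epsilon> * l + k) * (f (cos x) * w x)" for x
  proof -
    define P P' F where "P = p (cos x)" and "P' = p' (cos x)" and "F = f (cos x)"
    note b = index_even_bounds(2,4,5)[OF M \<kappa>(1) \<epsilon> K cos1[of x] p_near[OF cos1[of x]]
        p'_near[OF cos1[of x]] f_near[OF cos1[of x]], folded P_def P'_def F_def k_def, folded T_def[of "cos x"], folded \<eta>_def]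
    define g where "g = P' + k * P + k * cos x * P' - (\<epsilon> * l + k) * F"
    define S where "S = cos x * P' + 2 * k * P' + k\<^sup>2 * (P + cos x * P')"
    have zw: "z x = \<alpha> * (cos x + k) + w x" "z' x = w' x - \<alpha> * sin x"
      by (simp_all add: w_def w'_def)
    have ident: "P * ((v' - \<alpha> * s)\<^sup>2 - (\<alpha> * (c + k) + v)\<^sup>2) - c * P' * (\<alpha> * (c + k) + v)\<^sup>2
        - ((P' * s\<^sup>2 - P * c) * (\<alpha>\<^sup>2 * (c + 2 * k) + 2 * \<alpha> * v) + - P * s * (- \<alpha>\<^sup>2 * s + 2 * \<alpha> * v'))
        + 2 * \<alpha> * L * (F * v)
      = - (\<alpha>\<^sup>2 * (c * P' + 2 * k * P' + k\<^sup>2 * (P + c * P'))) - 2 * \<alpha> * (P' + k * P + k * c * P' - L * F) * v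
       + (P * (v'\<^sup>2 - v\<^sup>2) - c * P' * v\<^sup>2)" if "s\<^sup>2 + c\<^sup>2 = 1" for c s v v' L :: real
      using that by algebra
    have eq: "J x - G' x + 2 * \<alpha> * (\<epsilon> * l + k) * (F * w x) =
       - (\<alpha>\<^sup>2 * S) - 2 * \<alpha> * g * w x + (P * ((w' x)\<^sup>2 - (w x)\<^sup>2) - cos x * P' * (w x)\<^sup>2)"
      unfolding J_def G'_def g_def S_def zw P_def[symmetric] P'_def[symmetric]
      by (rule ident) simp
    have "\<alpha>\<^sup>2 * S \<le> \<alpha>\<^sup>2 * (T (cos x) + 6 * M^3 * \<kappa> * \<epsilon>\<^sup>2)"
      by (intro mult_left_mono) (use b(2) in \<open>auto simp: S_def abs_le_iff\<close>)
    moreover have "\<bar>2 * \<alpha> * g * w x\<bar> \<le> \<alpha>\<^sup>2 * (\<eta> * \<epsilon>\<^sup>2) + \<eta> * (w x)\<^sup>2"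
    proof -
      have "\<bar>2 * \<alpha> * g * w x\<bar> = (2 * \<bar>\<alpha>\<bar> * \<bar>w x\<bar>) * \<bar>g\<bar>" by (simp add: abs_mult)
      also have "\<dots> \<le> (2 * \<bar>\<alpha>\<bar> * \<bar>w x\<bar>) * (\<eta> * \<epsilon>)"
        using b(3) by (intro mult_left_mono) (auto simp: g_def)
      also have "\<dots> = \<eta> * (2 * (\<bar>\<alpha>\<bar> * \<epsilon>) * \<bar>w x\<bar>)" by simp
      also have "\<dots> \<le> \<eta> * ((\<bar>\<alpha>\<bar> * \<epsilon>)\<^sup>2 + \<bar>w x\<bar>\<^sup>2)"
        by (intro mult_left_mono sum_squares_bound \<eta>(1))
      finally show ?thesis by (simp add: power_mult_distrib algebra_simps)
    qed
    moreover have "9/10 * (w' x)\<^sup>2 - 11/10 * (w x)\<^sup>2 \<le> P * ((w' x)\<^sup>2 - (w x)\<^sup>2) - cos x * P' * (w x)\<^sup>2"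
    proof -
      have P: "9/10 \<le> P" "P \<le> 101/100" using p_near[OF cos1[of x]] k1 by (auto simp: P_def abs_le_iff)
      have "\<bar>cos x * P'\<bar> \<le> 1 * (2 * M * \<epsilon>)" unfolding abs_mult by (intro mult_mono b(1)) auto
      then have "P + cos x * P' \<le> 11/10" using P M\<epsilon> by linarith
      then have "(P + cos x * P') * (w x)\<^sup>2 \<le> 11/10 * (w x)\<^sup>2" by (intro mult_right_mono) auto
      moreover have "9/10 * (w' x)\<^sup>2 \<le> P * (w' x)\<^sup>2" by (intro mult_right_mono P) auto
      ultimately show ?thesis by (simp add: algebra_simps)
    qed
    moreover have "\<eta> * (w x)\<^sup>2 \<le> 1/10 * (w x)\<^sup>2" using \<eta> by (intro mult_right_mono) auto
    ultimately show ?thesis unfolding F_def[symmetric] eq E_def by (simp add: algebra_simps)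
  qed
  have J: "continuous_on UNIV J" unfolding J_def by (intro continuous_intros cp cp' cz z')
  have Tint: "((\<lambda>x. T (cos x)) has_integral
      \<epsilon> * l * 0 + \<epsilon>\<^sup>2 * p2 * (pi/2) + pi * (2 * \<epsilon>\<^sup>2 * K * l) + 2 * \<epsilon>^3 * K * p2 * 0 + pi * (\<epsilon>\<^sup>2 * K\<^sup>2)) {0..pi}"
    unfolding T_def by (intro has_integral_add has_integral_mult_right cosint cos2int const)
  have "- (\<alpha>\<^sup>2 * ((\<epsilon> * l * 0 + \<epsilon>\<^sup>2 * p2 * (pi/2) + pi * (2 * \<epsilon>\<^sup>2 * K * l) + 2 * \<epsilon>^3 * K * p2 * 0 + pi * (\<epsilon>\<^sup>2 * K\<^sup>2)) + pi * E))
      + (9/10 * integral {0..pi} (\<lambda>x. (w' x)\<^sup>2) - 6/5 * integral {0..pi} (\<lambda>x. (w x)\<^sup>2))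
      \<le> integral {0..pi} J - 0 + 2 * \<alpha> * (\<epsilon> * l + k) * 0"
  proof (rule has_integral_le[rotated 2])
    show "((\<lambda>x. - (\<alpha>\<^sup>2 * (T (cos x) + E)) + (9/10 * (w' x)\<^sup>2 - 6/5 * (w x)\<^sup>2)) has_integral
      - (\<alpha>\<^sup>2 * ((\<epsilon> * l * 0 + \<epsilon>\<^sup>2 * p2 * (pi/2) + pi * (2 * \<epsilon>\<^sup>2 * K * l) + 2 * \<epsilon>^3 * K * p2 * 0 + pi * (\<epsilon>\<^sup>2 * K\<^sup>2)) + pi * E))
      + (9/10 * integral {0..pi} (\<lambda>x. (w' x)\<^sup>2) - 6/5 * integral {0..pi} (\<lambda>x. (w x)\<^sup>2))) {0..pi}"
      by (intro has_integral_add has_integral_diff has_integral_neg has_integral_mult_right Tint const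
          integrable_integral int continuous_intros cw cw')
    show "((\<lambda>x. J x - G' x + 2 * \<alpha> * (\<epsilon> * l + k) * (f (cos x) * w x)) has_integral
        integral {0..pi} J - 0 + 2 * \<alpha> * (\<epsilon> * l + k) * 0) {0..pi}"
      by (intro has_integral_add has_integral_diff has_integral_mult_right fw G' integrable_integral int J)
  qed (rule pointwise)
  moreover have "0 \<le> 9/10 * integral {0..pi} (\<lambda>x. (w' x)\<^sup>2) - 6/5 * integral {0..pi} (\<lambda>x. (w x)\<^sup>2)"
  proof -
    have "0 \<le> integral {0..pi} (\<lambda>x. (w x)\<^sup>2)" by (intro integral_nonneg int continuous_intros cw) auto
    then show ?thesis using poinc by linarith
  qed
  moreover have "(\<epsilon> * l * 0 + \<epsilon>\<^sup>2 * p2 * (pi/2) + pi * (2 * \<epsilon>\<^sup>2 * K * l) + 2 * \<epsilon>^3 * K * p2 * 0 + pi * (\<epsilon>\<^sup>2 * K\<^sup>2)) + pi * E \<le> 0"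
  proof -
    \<comment> \<open>The errors in units of \<open>M^3 * \<kappa>\<close> are 16 from putting
      \<open>- f1/2\<close> for \<open>K\<close>, and 6 and 9 from \<open>E\<close>; their sum is
      below the 40 granted by the hypothesis.\<close>
    define \<delta> where "\<delta> = K + f1/2"
    have \<delta>: "\<bar>\<delta>\<bar> \<le> 4 * \<kappa>" using K by (simp add: \<delta>_def)
    have "\<bar>\<delta> * (2 * l - f1 + \<delta>)\<bar> \<le> (4 * \<kappa>) * (4 * M)"
      unfolding abs_mult
    proof (intro mult_mono \<delta>)
      show "\<bar>2 * l - f1 + \<delta>\<bar> \<le> 4 * M" using M \<delta> k1 by linarith
    qed (use k0 in auto)
    also have "\<dots> = 16 * (M * \<kappa>)" by simp
    also have "\<dots> \<le> 16 * (M^3 * \<kappa>)"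
      using M k0 power_increasing[of 1 3 M] by (intro mult_left_mono mult_right_mono) auto
    finally have "\<delta> * (2 * l - f1 + \<delta>) \<le> 16 * (M^3 * \<kappa>)" by simp
    moreover have "p2/2 + 2 * K * l + K\<^sup>2 = p2/2 - f1 * l + f1\<^sup>2/4 + \<delta> * (2 * l - f1 + \<delta>)"
      by (simp add: \<delta>_def power2_eq_square field_simps)
    moreover have "0 \<le> M^3 * \<kappa>" using M k0 by simp
    ultimately have "p2/2 + 2 * K * l + K\<^sup>2 + (6 * M^3 * \<kappa> + \<eta>) \<le> 0"
      using \<kappa>(2) \<eta>(3) unfolding M3 mult.assoc[of 6 "M^3" \<kappa>] by linarith
    then have "pi * \<epsilon>\<^sup>2 * (p2/2 + 2 * K * l + K\<^sup>2 + (6 * M^3 * \<kappa> + \<eta>)) \<le> 0"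
      using \<epsilon> by (intro mult_nonneg_nonpos) auto
    then show ?thesis by (simp add: E_def algebra_simps)
  qed
  then have "0 \<le> - (\<alpha>\<^sup>2 * ((\<epsilon> * l * 0 + \<epsilon>\<^sup>2 * p2 * (pi/2) + pi * (2 * \<epsilon>\<^sup>2 * K * l) + 2 * \<epsilon>^3 * K * p2 * 0 + pi * (\<epsilon>\<^sup>2 * K\<^sup>2)) + pi * E))"
    by (simp add: mult_nonneg_nonpos del: mult_zero_right)
  ultimately have "0 \<le> integral {0..pi} J" by linarith
  then show ?thesis by (simp add: J_def[abs_def])
qed


text \<open>The weights depend on \<open>cos\<close> only, so they are invariant under the
  reflection of \<open>x\<close> to \<open>2 * pi - x\<close>, and the products of the even and the
  odd part of \<open>z\<close> cancel when the circle is folded onto \<open>{0..pi}\<close>. The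
  constraint concerns the even part alone, and periodicity makes the odd part vanish at 0 and
  \<open>pi\<close>.\<close>

lemma index_periodic_nonneg:
  fixes p p' f z z' :: "real \<Rightarrow> real"
  assumes M: "1 \<le> M" "\<bar>l\<bar> \<le> M" "\<bar>p2\<bar> \<le> M" "\<bar>f1\<bar> \<le> M"
    and \<kappa>: "\<kappa> * (100 * M^3) \<le> 1" "\<kappa> * (40 * M^3) \<le> f1 * l - p2/2 - f1\<^sup>2/4"
    and \<epsilon>: "0 < \<epsilon>" "\<epsilon> \<le> \<kappa>"
    and p: "\<And>x. \<bar>x\<bar> \<le> 1 \<Longrightarrow> (p has_real_derivative p' x) (at x)"
    and p': "continuous_on {-1..1} p'" and f: "continuous_on {-1..1} f"
    and pos: "\<And>x. \<bar>x\<bar> \<le> 1 \<Longrightarrow> 0 \<le> p x"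
    and p_near: "\<And>x. \<bar>x\<bar> \<le> 1 \<Longrightarrow> \<bar>p x - 1\<bar> \<le> \<kappa>"
    and p'_near: "\<And>x. \<bar>x\<bar> \<le> 1 \<Longrightarrow> \<bar>p' x - \<epsilon> * l - \<epsilon>\<^sup>2 * p2 * x\<bar> \<le> \<kappa> * \<epsilon>\<^sup>2"
    and f_near: "\<And>x. \<bar>x\<bar> \<le> 1 \<Longrightarrow> \<bar>f x - 1 - \<epsilon> * f1 * x\<bar> \<le> \<kappa> * \<epsilon>"
    and z: "\<And>x. (z has_real_derivative z' x) (at x)" and z': "continuous_on UNIV z'"
    and periodic: "z (2 * pi) = z 0"
    and mean: "integral {0..2 * pi} (\<lambda>x. f (cos x) * z x) = 0"
  shows "0 \<le> integral {0..2 * pi} (\<lambda>x. p (cos x) * ((z' x)\<^sup>2 - (z x)\<^sup>2) - cos x * p' (cos x) * (z x)\<^sup>2)"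
proof -
  note int = integrable_on_continuous_UNIV
  note cz = continuous_on_if_has_real_derivative[OF z]
  have compcos: "continuous_on UNIV (\<lambda>x. g (cos x))" if "continuous_on {-1..1} g"
    for g :: "real \<Rightarrow> real"
    by (rule continuous_on_compose2[OF that]) (auto intro!: continuous_intros)
  have "continuous_on {-1..1} p"
    by (rule continuous_at_imp_continuous_on) (use p DERIV_isCont in force)
  note cp = compcos[OF this] and cp' = compcos[OF p'] and cf = compcos[OF f]
  have L: "((\<lambda>x. 2 * pi - x) has_real_derivative - 1) (at x)" for x
    by (auto intro!: derivative_eq_intros)
  have fold: "integral {0..2 * pi} h = integral {0..pi} (\<lambda>x. h x + h (2 * pi - x))"
    if h: "continuous_on UNIV h" for h :: "real \<Rightarrow> real"
  proof -
    from exists_antiderivative[OF h] obtain H where H: "\<And>x. (H has_real_derivative h x) (at x)" by blast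
    have "((\<lambda>x. H x - H (2 * pi - x)) has_real_derivative h x + h (2 * pi - x)) (at x)" for x
      using DERIV_diff[OF H[of x] DERIV_chain2[OF H L[of x]]] by simp
    then have "((\<lambda>x. h x + h (2 * pi - x)) has_integral (H pi - H (2 * pi - pi)) - (H 0 - H (2 * pi - 0))) {0..pi}"
      by (intro FTC_real) auto
    moreover have "(h has_integral H (2 * pi) - H 0) {0..2 * pi}" by (intro FTC_real H) auto
    ultimately show ?thesis by (simp add: integral_unique)
  qed
  have D: "((\<lambda>x. z (2 * pi - x)) has_real_derivative - z' (2 * pi - x)) (at x)" for x
    using DERIV_chain2[OF z L[of x]] by simp
  have c': "continuous_on UNIV (\<lambda>x. z' (2 * pi - x))"
    by (rule continuous_on_compose2[OF z']) (auto intro!: continuous_intros)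
  define e e' where "e x = (z x + z (2 * pi - x)) / 2" and "e' x = (z' x - z' (2 * pi - x)) / 2" for x
  define d d' where "d x = (z x - z (2 * pi - x)) / 2" and "d' x = (z' x + z' (2 * pi - x)) / 2" for x
  have e: "(e has_real_derivative e' x) (at x)" and d: "(d has_real_derivative d' x) (at x)" for x
    unfolding e_def e'_def d_def d'_def using D[of x] z[of x]
    by (auto intro!: derivative_eq_intros)
  have ce: "continuous_on UNIV e'" "continuous_on UNIV d'"
    unfolding e'_def d'_def by (auto intro!: continuous_intros z' c')
  have cos: "cos (2 * pi - x) = cos x" for x by (simp add: cos_diff)
  define J where "J z z' x = p (cos x) * ((z' x)\<^sup>2 - (z x)\<^sup>2) - cos x * p' (cos x) * (z x)\<^sup>2"
    for z z' :: "real \<Rightarrow> real" and x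
  have cJ: "continuous_on UNIV (J v v')" if "continuous_on UNIV v" "continuous_on UNIV v'" for v v'
    unfolding J_def by (intro continuous_intros cp cp' that)
  note ceJ = cJ[OF continuous_on_if_has_real_derivative[OF e] ce(1)]
    and cdJ = cJ[OF continuous_on_if_has_real_derivative[OF d] ce(2)]
  have "integral {0..2 * pi} (J z z') = integral {0..pi} (\<lambda>x. 2 * J e e' x + 2 * J d d' x)"
    unfolding fold[OF cJ[OF cz z']]
    by (rule integral_cong, unfold J_def cos e_def e'_def d_def d'_def)
      (simp add: power2_eq_square field_simps)
  also have "\<dots> = 2 * integral {0..pi} (J e e') + 2 * integral {0..pi} (J d d')"
    by (rule integral_unique)
      (intro has_integral_add has_integral_mult_right integrable_integral int ceJ cdJ)
  also have "\<dots> \<ge> 0"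
  proof (intro add_nonneg_nonneg mult_nonneg_nonneg)
    have "integral {0..2 * pi} (\<lambda>x. f (cos x) * z x) = integral {0..pi} (\<lambda>x. 2 * (f (cos x) * e x))"
      unfolding fold[OF continuous_on_mult[OF cf cz]]
      by (rule integral_cong, unfold cos e_def) (simp add: field_simps)
    then have "integral {0..pi} (\<lambda>x. f (cos x) * e x) = 0" using mean by simp
    from index_even_nonneg[OF M \<kappa> \<epsilon> p p' f p_near p'_near f_near e ce(1) this]
    show "0 \<le> integral {0..pi} (J e e')" unfolding J_def .
    have "d 0 = 0" "d pi = 0" using periodic by (auto simp: d_def)
    from index_odd_nonneg[OF p p' pos d ce(2) this]
    show "0 \<le> integral {0..pi} (J d d')" unfolding J_def .
  qed auto
  finally show ?thesis by (simp add: J_def[abs_def])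
qed

section \<open>Curves given by a first integral\<close>

lemma add_int_multiple_period:
  fixes g :: "real \<Rightarrow> real"
  assumes "\<And>x. g (x + p) = g x + q"
  shows "g (x + of_int k * p) = g x + of_int k * q"
proof (induction k rule: int_induct[where k = 0])
  case (step1 i)
  then show ?case using assms[of "x + of_int i * p"] by (simp add: algebra_simps)
next
  case (step2 i)
  then show ?case using assms[of "x + of_int (i - 1) * p"] by (simp add: algebra_simps)
qed simp

lemma surj_if_add_period:
  fixes g :: "real \<Rightarrow> real"
  assumes cont: "continuous_on UNIV g" and per: "\<And>x. g (x + p) = g x + q" and "0 < p" "0 < q"
  shows "surj g"
proof -
  have "\<exists>x. g x = s" for s
  proof -
    define k where "k = \<lfloor>(s - g 0) / q\<rfloor>"
    have "of_int k \<le> (s - g 0) / q" "(s - g 0) / q < of_int k + 1" by (auto simp: k_def)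
    then have *: "of_int k * q \<le> s - g 0" "s - g 0 < (of_int k + 1) * q"
      using \<open>0 < q\<close> by (simp_all add: pos_le_divide_eq pos_divide_less_eq)
    have "g (of_int k * p) = g 0 + of_int k * q" "g (of_int (k + 1) * p) = g 0 + of_int (k + 1) * q"
      using add_int_multiple_period[of g, OF per, of 0 k] add_int_multiple_period[of g, OF per, of 0 "k + 1"]
      by (simp_all only: add_0)
    then have "g (of_int k * p) \<le> s" "s \<le> g (of_int (k + 1) * p)" using * by auto
    moreover have "of_int k * p \<le> of_int (k + 1) * p" using \<open>0 < p\<close> by simp
    ultimately show ?thesis
      using IVT'[of g "of_int k * p" s "of_int (k + 1) * p"] continuous_on_subset[OF cont] by blast
  qed
  then show ?thesis by (metis surjI)
qed

text \<open>Smoothness of a solution of a differential equation is thereby reduced to exhibiting a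
  class that differentiation preserves, instead of formulas for all higher derivatives.\<close>

lemma smooth_if_deriv_closed:
  assumes A: "\<And>g. g \<in> A \<Longrightarrow> \<exists>g'\<in>A. \<forall>s. (g has_real_derivative g' s) (at s)" and "g \<in> A"
  shows "smooth g"
proof -
  have "(deriv ^^ n) g \<in> A" for n
  proof (induction n)
    case (Suc n)
    from A[OF Suc] obtain g' where "g' \<in> A" "\<And>s. ((deriv ^^ n) g has_real_derivative g' s) (at s)" by blast
    moreover from this(2) have "deriv ((deriv ^^ n) g) = g'" by (intro ext DERIV_imp_deriv)
    ultimately show ?case by simp
  qed (use \<open>g \<in> A\<close> in simp)
  then show ?thesis unfolding smooth_def using A real_differentiable_def by blast
qed

lemma smooth_if_smooth_deriv:
  assumes "\<And>s. (g has_real_derivative g' s) (at s)" "smooth g'"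
  shows "smooth g"
  unfolding smooth_def
proof (intro allI)
  fix n s
  have "deriv g = g'" by (intro ext DERIV_imp_deriv assms(1))
  then show "(deriv ^^ n) g differentiable at s"
    using assms by (cases n) (auto simp: smooth_def funpow_Suc_right real_differentiable_def simp del: funpow.simps(2))
qed

lemma DERIV_warp: "r \<noteq> 0 \<Longrightarrow> (warp a r has_real_derivative - sin (t / r)) (at t)"
  unfolding warp_def[abs_def] by (auto intro!: derivative_eq_intros)

lemma deriv_warp: "r \<noteq> 0 \<Longrightarrow> deriv (warp a r) = (\<lambda>t. - sin (t / r))"
  by (intro ext DERIV_imp_deriv DERIV_warp)

text \<open>The algebra generated by the functions on the right-hand sides of the equations for
  \<open>t\<close>, \<open>\<theta>\<close> and \<open>\<sigma>\<close>, evaluated along a solution.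
  Those equations show that it is closed under differentiation.\<close>

inductive_set orbit_functions ::
    "real \<Rightarrow> real \<Rightarrow> (real \<Rightarrow> real) \<Rightarrow> (real \<Rightarrow> real) \<Rightarrow> (real \<Rightarrow> real) set"
  for a r :: real and t \<sigma> :: "real \<Rightarrow> real" where
  "(\<lambda>s. k) \<in> orbit_functions a r t \<sigma>"
| "(\<lambda>s. sin (\<sigma> s)) \<in> orbit_functions a r t \<sigma>"
| "(\<lambda>s. cos (\<sigma> s)) \<in> orbit_functions a r t \<sigma>"
| "(\<lambda>s. sin (t s / r)) \<in> orbit_functions a r t \<sigma>"
| "(\<lambda>s. cos (t s / r)) \<in> orbit_functions a r t \<sigma>"
| "(\<lambda>s. inverse (warp a r (t s))) \<in> orbit_functions a r t \<sigma>"
| "g \<in> orbit_functions a r t \<sigma> \<Longrightarrow> g' \<in> orbit_functions a r t \<sigma> \<Longrightarrow>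
    (\<lambda>s. g s + g' s) \<in> orbit_functions a r t \<sigma>"
| "g \<in> orbit_functions a r t \<sigma> \<Longrightarrow> g' \<in> orbit_functions a r t \<sigma> \<Longrightarrow>
    (\<lambda>s. g s * g' s) \<in> orbit_functions a r t \<sigma>"

text \<open>For a unit speed curve with tangent angle \<open>\<sigma>\<close> the geodesic curvature
  is \<open>\<sigma>' + f' * sin \<sigma> / f\<close>; as \<open>f'\<close> is
  \<open>- sin (t / r)\<close>, the equation for \<open>\<sigma>\<close> says that it equals
  \<open>k\<close>.\<close>

lemma cgc_curve_if_ode:
  assumes r: "r \<noteq> 0" and pos: "\<And>s. warp a r (t s) > 0"
    and t: "\<And>s. (t has_real_derivative cos (\<sigma> s)) (at s)"
    and \<theta>: "\<And>s. (\<theta> has_real_derivative sin (\<sigma> s) / warp a r (t s)) (at s)"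
    and \<sigma>: "\<And>s. (\<sigma> has_real_derivative k + sin (\<sigma> s) * sin (t s / r) / warp a r (t s)) (at s)"
  shows "cgc_curve a r \<theta> t \<sigma> k"
proof -
  let ?A = "orbit_functions a r t \<sigma>"
  note I = orbit_functions.intros
  note dt = DERIV_imp_deriv[OF t] and d\<theta> = DERIV_imp_deriv[OF \<theta>]
  have W: "((\<lambda>s. warp a r (t s)) has_real_derivative - sin (t s / r) * cos (\<sigma> s)) (at s)" for s
    by (rule DERIV_chain2[OF DERIV_warp[OF r] t])
  define \<sigma>' where "\<sigma>' s = k + sin (\<sigma> s) * sin (t s / r) * inverse (warp a r (t s))" for s
  have \<sigma>': "(\<sigma> has_real_derivative \<sigma>' s) (at s)" for s
    using \<sigma>[of s] by (simp add: \<sigma>'_def divide_inverse)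
  have \<sigma>'A: "\<sigma>' \<in> ?A"
    unfolding \<sigma>'_def[abs_def] by (intro I)
  have closed: "\<exists>g'\<in>?A. \<forall>s. (g has_real_derivative g' s) (at s)" if "g \<in> ?A" for g
    using that
  proof induction
    case (1 k)
    show ?case by (rule bexI[OF _ I(1)[of 0]]) simp
  next
    case 2
    show ?case
      by (rule bexI[OF _ I(8)[OF I(3) \<sigma>'A]]) (auto intro!: derivative_eq_intros \<sigma>')
  next
    case 3
    show ?case
      by (rule bexI[OF _ I(8)[OF I(8)[OF I(1)[of "-1"] I(2)] \<sigma>'A]]) (auto intro!: derivative_eq_intros \<sigma>')
  next
    case 4
    show ?case
      by (rule bexI[OF _ I(8)[OF I(8)[OF I(5) I(3)] I(1)[of "1/r"]]])
        (use r in \<open>auto intro!: derivative_eq_intros t simp: field_simps\<close>)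
  next
    case 5
    show ?case
      by (rule bexI[OF _ I(8)[OF I(8)[OF I(4) I(3)] I(1)[of "-1/r"]]])
        (use r in \<open>auto intro!: derivative_eq_intros t simp: field_simps\<close>)
  next
    case 6
    show ?case
    proof (rule bexI[OF _ I(8)[OF I(8)[OF I(4) I(3)] I(8)[OF I(6) I(6)]]], rule allI)
      fix s
      have "warp a r (t s) \<noteq> 0" using pos[of s] by simp
      then show "((\<lambda>s. inverse (warp a r (t s))) has_real_derivative sin (t s / r) * cos (\<sigma> s)
          * (inverse (warp a r (t s)) * inverse (warp a r (t s)))) (at s)"
        using DERIV_inverse'[OF W[of s]] by (simp add: mult.commute mult.left_commute)
    qed
  next
    case (7 g h)
    then obtain g' h' where "g' \<in> ?A" "h' \<in> ?A"
      and D: "\<And>s. (g has_real_derivative g' s) (at s)" "\<And>s. (h has_real_derivative h' s) (at s)" by blast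
    then show ?case by (intro bexI[OF _ I(7)[of g' _ _ _ _ h']]) (auto intro!: derivative_eq_intros D)
  next
    case (8 g h)
    then obtain g' h' where A: "g' \<in> ?A" "h' \<in> ?A"
      and D: "\<And>s. (g has_real_derivative g' s) (at s)" "\<And>s. (h has_real_derivative h' s) (at s)" by blast
    show ?case
      by (rule bexI[OF _ I(7)[OF I(8)[OF A(1) 8(2)] I(8)[OF A(2) 8(1)]]]) (use DERIV_mult[OF D] in auto)
  qed
  have "(\<lambda>s. sin (\<sigma> s) / warp a r (t s)) \<in> ?A"
    unfolding divide_inverse by (intro I)
  then have smooth: "smooth t" "smooth \<theta>"
    using smooth_if_smooth_deriv[OF t smooth_if_deriv_closed[OF closed]]
      smooth_if_smooth_deriv[OF \<theta> smooth_if_deriv_closed[OF closed]] I(3) by auto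
  have "deriv t = (\<lambda>s. cos (\<sigma> s))" by (intro ext dt)
  then have ddt: "deriv (deriv t) s = - sin (\<sigma> s) * \<sigma>' s" for s
    by (simp, intro DERIV_imp_deriv) (auto intro!: derivative_eq_intros \<sigma>')
  have "deriv \<theta> = (\<lambda>s. sin (\<sigma> s) / warp a r (t s))" by (intro ext d\<theta>)
  then have dd\<theta>: "deriv (deriv \<theta>) s = (cos (\<sigma> s) * \<sigma>' s * warp a r (t s) - sin (\<sigma> s) * (- sin (t s / r) * cos (\<sigma> s)))
      / (warp a r (t s) * warp a r (t s))" for s
    using pos[of s] DERIV_imp_deriv[OF DERIV_divide[OF DERIV_fun_sin[OF \<sigma>'[of s]] W[of s]]] by simp
  have "arc_length_curve a r \<theta> t"
    unfolding arc_length_curve_def metric_def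
  proof (intro conjI smooth allI)
    fix s
    show "(warp a r (snd (\<theta> s, t s)))\<^sup>2 * (fst (deriv \<theta> s, deriv t s) * fst (deriv \<theta> s, deriv t s)) +
         snd (deriv \<theta> s, deriv t s) * snd (deriv \<theta> s, deriv t s) = 1"
      using pos[of s] sin_cos_squared_add[of "\<sigma> s"] by (simp add: dt d\<theta> power2_eq_square field_simps)
  qed
  moreover have "tangent_angle a r \<theta> t \<sigma>"
    unfolding tangent_angle_def
  proof (intro conjI allI)
    show "continuous_on UNIV \<sigma>" by (rule continuous_on_if_has_real_derivative[OF \<sigma>])
    show "warp a r (t s) * deriv \<theta> s = sin (\<sigma> s)" for s using pos[of s] by (simp add: d\<theta>)
  qed (rule dt)
  moreover have "geodesic_curvature a r \<theta> t \<sigma> s = k" for s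
  proof -
    define w S C R where "w = warp a r (t s)" and "S = sin (\<sigma> s)" and "C = cos (\<sigma> s)" and "R = sin (t s / r)"
    have w: "w > 0" using pos by (simp add: w_def)
    have SC: "S\<^sup>2 + C\<^sup>2 = 1" by (simp add: S_def C_def)
    define D where "D = \<sigma>' s"
    have D: "D * w = k * w + S * R" using w by (simp add: D_def \<sigma>'_def w_def S_def R_def field_simps)
    have "geodesic_curvature a r \<theta> t \<sigma> s =
      w\<^sup>2 * (((C * D * w - S * (- R * C)) / (w * w) + 2 * (- R / w) * C * (S / w)) * (C / w))
      + (- S * D - w * - R * (S / w)\<^sup>2) * - S"
      unfolding geodesic_curvature_def metric_def acceleration_def normal_def ddt dd\<theta> dt d\<theta> deriv_warp[OF r]
        fst_conv snd_conv w_def[symmetric] S_def[symmetric] C_def[symmetric] R_def[symmetric] D_def[symmetric] ..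
    also have "\<dots> = ((S\<^sup>2 + C\<^sup>2) * (D * w) - (S\<^sup>2 + C\<^sup>2) * (S * R)) / w"
      using w by (simp add: field_simps power2_eq_square)
    also have "\<dots> = k" unfolding SC D using w by simp
    finally show ?thesis .
  qed
  ultimately show ?thesis by (simp add: cgc_curve_def)
qed

lemma add_2pi_if_deriv_periodic:
  fixes G g :: "real \<Rightarrow> real"
  assumes G: "\<And>x. (G has_real_derivative g x) (at x)" and "\<And>x. g (x + 2 * pi) = g x"
  shows "G (x + 2 * pi) = G x + (G (2 * pi) - G 0)"
proof -
  have "((\<lambda>x. x + 2 * pi) has_real_derivative 1) (at x)" for x
    by (auto intro!: derivative_eq_intros)
  from DERIV_chain2[OF G this] DERIV_diff[OF _ G]
  have "((\<lambda>x. G (x + 2 * pi) - G x) has_real_derivative 0) (at x)" for x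
    by (metis assms(2) diff_self mult.right_neutral)
  then have "G (x + 2 * pi) - G x = G (0 + 2 * pi) - G 0"
    by (rule DERIV_isconst_all[rule_format, of "\<lambda>x. G (x + 2 * pi) - G x"])
  then show ?thesis by simp
qed

text \<open>
  Here \<open>t = r (m + y)\<close> with \<open>y = e cos \<phi>\<close>, and all other quantities are scaled to \<open>r = 1\<close>. The
  first integral gives \<open>t'\<^sup>2 = (e\<^sup>2 - y\<^sup>2) V(y) / f(y)\<^sup>2\<close>, so that \<open>\<phi>' = sqrt (V(y)) / (r f(y))\<close> is smooth
  also at the turning points. The geodesic curvature is \<open>- h / r\<close>.
\<close>

locale oscillation =
  fixes b r m e h c :: real and V V1 V2 :: "real \<Rightarrow> real"
  assumes r: "0 < r" and b: "1 < b" and e: "0 < e"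
    and V: "\<And>y. (V has_real_derivative V1 y) (at y)"
    and V1: "\<And>y. (V1 has_real_derivative V2 y) (at y)"
    and V_pos: "\<And>y. \<bar>y\<bar> \<le> e \<Longrightarrow> 0 < V y"
    and V_eq: "\<And>y. (e\<^sup>2 - y\<^sup>2) * V y = (b + cos (m + y))\<^sup>2 - (c - h * (b * y + sin (m + y)))\<^sup>2"
    and S_pos: "\<And>y. \<bar>y\<bar> \<le> e \<Longrightarrow> 0 < c - h * (b * y + sin (m + y))"
    and period: "integral {0..2 * pi} (\<lambda>\<phi>. (c - h * (b * (e * cos \<phi>) + sin (m + e * cos \<phi>)))
      / (b + cos (m + e * cos \<phi>)) / sqrt (V (e * cos \<phi>))) = 2 * pi"
begin

text \<open>\<open>f\<close> is \<open>warp\<close> divided by \<open>r\<close>, \<open>S\<close> is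
  the value that the first integral prescribes for \<open>sin \<sigma>\<close>, and
  \<open>v / (r * f)\<close> becomes the speed of the phase.\<close>

definition "f y = b + cos (m + y)"
definition "S y = (c - h * (b * y + sin (m + y))) / f y"
definition "v \<phi> = sqrt (V (e * cos \<phi>))"

lemma f_pos: "0 < f y" 
  unfolding f_def using b cos_ge_minus_one[of "m + y"] by linarith

lemma f_deriv: "(f has_real_derivative - sin (m + y)) (at y)"
  unfolding f_def[abs_def] by (auto intro!: derivative_eq_intros)

lemma y_le: "\<bar>e * cos \<phi>\<bar> \<le> e"
  using e by (simp add: abs_mult)

lemma y_sq: "e\<^sup>2 - (e * cos \<phi>)\<^sup>2 = (e * sin \<phi>)\<^sup>2"
  unfolding power_mult_distrib sin_squared_eq by (simp add: algebra_simps)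

lemma v_pos: "0 < v \<phi>"
  using V_pos[OF y_le] by (simp add: v_def)

lemma v_sq: "v \<phi> * v \<phi> = V (e * cos \<phi>)"
  using V_pos[OF y_le, of \<phi>] by (simp add: v_def)

lemma y_deriv: "((\<lambda>\<phi>. e * cos \<phi>) has_real_derivative - (e * sin \<phi>)) (at \<phi>)"
  by (auto intro!: derivative_eq_intros)

lemma v_deriv: "(v has_real_derivative - (e * sin \<phi>) * V1 (e * cos \<phi>) / (2 * v \<phi>)) (at \<phi>)"
proof -
  have D: "((\<lambda>\<phi>. V (e * cos \<phi>)) has_real_derivative V1 (e * cos \<phi>) * - (e * sin \<phi>)) (at \<phi>)"
    by (rule DERIV_chain2[OF V y_deriv])
  show ?thesis
    unfolding v_def[abs_def]
    by (rule DERIV_cong[OF DERIV_chain2[OF DERIV_real_sqrt[OF V_pos[OF y_le]] D]]) (simp add: field_simps)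
qed

text \<open>The first integral is differentiated in its undivided form, so that the result also
  holds at the turning points, where \<open>e^2 - y^2\<close> vanishes. This derivative contains the
  equation for \<open>\<sigma>\<close>; combined with the next one it gives the Jacobi
  equation.\<close>

lemma V_eq': "- 2 * y * V y + (e\<^sup>2 - y\<^sup>2) * V1 y
    = 2 * f y * - sin (m + y) + 2 * h * (c - h * (b * y + sin (m + y))) * f y"
proof (rule DERIV_unique)
  show "((\<lambda>y. (e\<^sup>2 - y\<^sup>2) * V y) has_real_derivative - 2 * y * V y + (e\<^sup>2 - y\<^sup>2) * V1 y) (at y)"
    by (auto intro!: derivative_eq_intros V)
  show "((\<lambda>y. (e\<^sup>2 - y\<^sup>2) * V y) has_real_derivative
      2 * f y * - sin (m + y) + 2 * h * (c - h * (b * y + sin (m + y))) * f y) (at y)"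
    unfolding V_eq f_def by (auto intro!: derivative_eq_intros simp: algebra_simps)
qed

lemma V_eq'': "- 2 * V y - 4 * y * V1 y + (e\<^sup>2 - y\<^sup>2) * V2 y
    = 2 * (sin (m + y))\<^sup>2 - 2 * f y * cos (m + y) - 2 * h\<^sup>2 * (f y)\<^sup>2
      - 2 * h * (c - h * (b * y + sin (m + y))) * sin (m + y)"
proof (rule DERIV_unique)
  show "((\<lambda>y. - 2 * y * V y + (e\<^sup>2 - y\<^sup>2) * V1 y) has_real_derivative
      - 2 * V y - 4 * y * V1 y + (e\<^sup>2 - y\<^sup>2) * V2 y) (at y)"
    by (auto intro!: derivative_eq_intros V V1)
  show "((\<lambda>y. - 2 * y * V y + (e\<^sup>2 - y\<^sup>2) * V1 y) has_real_derivative
      2 * (sin (m + y))\<^sup>2 - 2 * f y * cos (m + y) - 2 * h\<^sup>2 * (f y)\<^sup>2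
      - 2 * h * (c - h * (b * y + sin (m + y))) * sin (m + y)) (at y)"
    unfolding V_eq' f_def
    by (auto intro!: derivative_eq_intros simp: algebra_simps power2_eq_square)
qed

lemma S_sq: "(e * sin \<phi>)\<^sup>2 * V (e * cos \<phi>) = (f (e * cos \<phi>))\<^sup>2 * (1 - (S (e * cos \<phi>))\<^sup>2)"
proof -
  have *: "(f y)\<^sup>2 * (S y)\<^sup>2 = (c - h * (b * y + sin (m + y)))\<^sup>2" for y
    using f_pos[of y] by (simp add: S_def power_divide)
  show ?thesis
    using V_eq[of "e * cos \<phi>"] unfolding y_sq *[symmetric] f_def[symmetric] by (simp add: right_diff_distrib)
qed

lemma S_pos': "\<bar>y\<bar> \<le> e \<Longrightarrow> 0 < S y"
  using S_pos[of y] f_pos[of y] by (simp add: S_def)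

section \<open>Arc length and rotation angle as functions of the phase\<close>

text \<open>The scalar equation \<open>\<phi>' = v / (r * f)\<close> is solved by quadrature: arc
  length is an antiderivative of \<open>r * f / v\<close> in the phase, and the phase is its
  inverse. Likewise \<open>ang\<close> is \<open>\<theta>\<close> as a function of the
  phase.\<close>

definition "arclen = (SOME G. G 0 = 0 \<and> (\<forall>\<phi>. (G has_real_derivative r * f (e * cos \<phi>) / v \<phi>) (at \<phi>)))"

definition "ang = (SOME G. G 0 = 0 \<and> (\<forall>\<phi>. (G has_real_derivative S (e * cos \<phi>) / v \<phi>) (at \<phi>)))"

lemma f_cont: "continuous_on UNIV (\<lambda>\<phi>. f (e * cos \<phi>))"
  unfolding f_def by (intro continuous_intros)

lemma v_cont: "continuous_on UNIV v"
  by (rule continuous_on_if_has_real_derivative[OF v_deriv])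

lemma v_neq: "v \<phi> \<noteq> 0"
  using v_pos[of \<phi>] by simp

lemma arclen_density_cont: "continuous_on UNIV (\<lambda>\<phi>. r * f (e * cos \<phi>) / v \<phi>)"
  by (intro continuous_intros f_cont v_cont) (use v_neq in auto)

lemma arclen: "arclen 0 = 0" "(arclen has_real_derivative r * f (e * cos \<phi>) / v \<phi>) (at \<phi>)"
  using someI_ex[OF exists_antiderivative[OF arclen_density_cont]] unfolding arclen_def by blast+

lemma ang_density_cont: "continuous_on UNIV (\<lambda>\<phi>. S (e * cos \<phi>) / v \<phi>)"
  unfolding S_def using f_pos[THEN less_imp_neq, THEN not_sym]
  by (intro continuous_intros f_cont v_cont) (use v_neq in auto)

lemma ang: "ang 0 = 0" "(ang has_real_derivative S (e * cos \<phi>) / v \<phi>) (at \<phi>)"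
  using someI_ex[OF exists_antiderivative[OF ang_density_cont]] unfolding ang_def by blast+

definition "L = arclen (2 * pi)"

lemma v_periodic: "v (\<phi> + 2 * pi) = v \<phi>"
  by (simp add: v_def)

lemma arclen_add_2pi: "arclen (\<phi> + 2 * pi) = arclen \<phi> + L"
  using add_2pi_if_deriv_periodic[OF arclen(2), of \<phi>] by (simp add: v_periodic L_def arclen(1))

text \<open>Here the hypothesis \<open>period\<close> closes the curve: one oscillation makes
  exactly one turn about the axis.\<close>

lemma ang_2pi: "ang (2 * pi) = 2 * pi"
proof -
  have "((\<lambda>\<phi>. S (e * cos \<phi>) / v \<phi>) has_integral ang (2 * pi) - ang 0) {0..2 * pi}"
    by (rule FTC_real) (use ang(2) in auto)
  then show ?thesis using period by (simp add: ang(1) S_def f_def v_def integral_unique)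
qed

lemma ang_add_2pi: "ang (\<phi> + 2 * pi) = ang \<phi> + 2 * pi"
  using add_2pi_if_deriv_periodic[OF ang(2), of \<phi>] by (simp add: v_periodic ang_2pi ang(1))

lemma arclen_strict_mono: "strict_mono arclen"
  by (rule strict_monoI, rule DERIV_pos_imp_increasing)
    (use arclen(2) r f_pos v_pos in \<open>auto intro!: exI divide_pos_pos mult_pos_pos\<close>)

lemma ang_strict_mono: "strict_mono ang"
  by (rule strict_monoI, rule DERIV_pos_imp_increasing)
    (use ang(2) S_pos'[OF y_le] v_pos in \<open>auto intro!: exI divide_pos_pos\<close>)

lemma L_pos: "0 < L"
  using strict_monoD[OF arclen_strict_mono, of 0 "2 * pi"] by (simp add: L_def arclen(1))

lemma arclen_bij: "bij arclen"
  unfolding bij_def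
proof
  show "inj arclen" by (rule strict_mono_imp_inj_on[OF arclen_strict_mono])
  show "surj arclen"
    by (rule surj_if_add_period[OF continuous_on_if_has_real_derivative[OF arclen(2)] arclen_add_2pi _ L_pos]) simp
qed

definition "phase = inv arclen"

lemma arclen_phase [simp]: "arclen (phase s) = s"
  unfolding phase_def by (rule surj_f_inv_f[OF bij_is_surj[OF arclen_bij]])

lemma phase_arclen [simp]: "phase (arclen \<phi>) = \<phi>"
  unfolding phase_def by (rule inv_f_f[OF bij_is_inj[OF arclen_bij]])

lemma phase_less_iff: "phase s < phase s' \<longleftrightarrow> s < s'"
  using strict_mono_less[OF arclen_strict_mono, of "phase s" "phase s'"] by simp

lemma phase_0: "phase 0 = 0"
  using phase_arclen[of 0] by (simp add: arclen(1))

lemma phase_add_L: "phase (s + L) = phase s + 2 * pi"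
  using phase_arclen[of "phase s + 2 * pi"] by (simp add: arclen_add_2pi)

lemma phase_deriv: "(phase has_real_derivative v (phase s) / (r * f (e * cos (phase s)))) (at s)"
proof -
  define D where "D = r * f (e * cos (phase s)) / v (phase s)"
  have D: "(arclen has_real_derivative D) (at (phase s))" unfolding D_def by (rule arclen(2))
  have "D \<noteq> 0"
    using r f_pos[of "e * cos (phase s)"] v_pos[of "phase s"] by (simp add: D_def)
  have "(phase has_derivative (*) (inverse D)) (at s)"
    by (rule has_derivative_inverse_strong_x[where f = arclen and S = UNIV and f' = "(*) D"])
      (use D \<open>D \<noteq> 0\<close> continuous_on_if_has_real_derivative[OF arclen(2)]
        in \<open>auto simp: has_field_derivative_def fun_eq_iff\<close>)
  then show ?thesis by (simp add: has_field_derivative_def D_def)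
qed

section \<open>The curve and its tangent angle\<close>

definition "t s = r * (m + e * cos (phase s))"
definition "\<theta> s = ang (phase s)"
text \<open>This is \<open>t'\<close> in terms of the phase, hence \<open>cos \<sigma>\<close>. As
  \<open>sin \<sigma> = S\<close> is positive, the angle stays strictly between 0 and
  \<open>pi\<close>, where \<open>arccos\<close> is differentiable and recovers it.\<close>

definition "\<tau> \<phi> = - (e * sin \<phi>) * v \<phi> / f (e * cos \<phi>)"
definition "\<sigma> s = arccos (\<tau> (phase s))"

lemma t_deriv: "(t has_real_derivative \<tau> (phase s)) (at s)"
proof -
  have "((\<lambda>s. e * cos (phase s)) has_real_derivative
      - (e * sin (phase s)) * (v (phase s) / (r * f (e * cos (phase s))))) (at s)"
    by (rule DERIV_chain2[OF y_deriv phase_deriv])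
  then have "(t has_real_derivative r * (0 + - (e * sin (phase s)) * (v (phase s) / (r * f (e * cos (phase s)))))) (at s)"
    unfolding t_def[abs_def] by (intro DERIV_cmult DERIV_add DERIV_const)
  then show ?thesis by (rule DERIV_cong) (use r f_pos[of "e * cos (phase s)"] in \<open>simp add: \<tau>_def\<close>)
qed

lemma tau_sq: "1 - (\<tau> \<phi>)\<^sup>2 = (S (e * cos \<phi>))\<^sup>2"
proof -
  have "(\<tau> \<phi>)\<^sup>2 = (e * sin \<phi>)\<^sup>2 * V (e * cos \<phi>) / (f (e * cos \<phi>))\<^sup>2"
    using v_sq[of \<phi>] by (simp add: \<tau>_def power2_eq_square)
  then show ?thesis unfolding S_sq using f_pos[of "e * cos \<phi>"] by simp
qed

lemma tau_bounds: "- 1 < \<tau> \<phi>" "\<tau> \<phi> < 1"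
proof -
  have "0 < (S (e * cos \<phi>))\<^sup>2" using S_pos'[OF y_le] by (intro zero_less_power)
  then have "(\<tau> \<phi>)\<^sup>2 < 1" using tau_sq[of \<phi>] by linarith
  then show "- 1 < \<tau> \<phi>" "\<tau> \<phi> < 1" by (simp_all add: power2_less_1_iff abs_less_iff flip: abs_square_less_1)
qed

lemma sqrt_tau: "sqrt (1 - (\<tau> \<phi>)\<^sup>2) = S (e * cos \<phi>)"
  unfolding tau_sq using S_pos'[OF y_le, of \<phi>] by simp

lemma cos_sigma: "cos (\<sigma> s) = \<tau> (phase s)"
  unfolding \<sigma>_def using tau_bounds[of "phase s"] by (intro cos_arccos) auto

lemma sin_sigma: "sin (\<sigma> s) = S (e * cos (phase s))"
  unfolding \<sigma>_def using tau_bounds[of "phase s"] sqrt_tau[of "phase s"] by (subst sin_arccos) auto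

text \<open>Once \<open>1 / v\<close> is factored out, \<open>v\<close> occurs only as
  \<open>v^2 = V\<close>, and \<open>V\<close>, \<open>V1\<close> occur only in the two combinations
  that \<open>V_eq\<close> and \<open>V_eq'\<close> evaluate. Since the derivative of
  \<open>\<tau>\<close> is \<open>- sin \<sigma>\<close> times that of \<open>\<sigma>\<close>, the
  factor in parentheses becomes the curvature equation.\<close>

lemma tau_deriv: "(\<tau> has_real_derivative S y * (h + S y * - sin (m + y) / f y) * f y / v \<phi>) (at \<phi>)"
  if y: "y = e * cos \<phi>" for y
proof -
  define s where "s = e * sin \<phi>"
  have ss: "e\<^sup>2 - y\<^sup>2 = s\<^sup>2"
    unfolding s_def y by (rule y_sq)
  have vv: "v \<phi> * v \<phi> = V y" unfolding y by (rule v_sq)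
  have fy: "0 < f y" by (rule f_pos)
  have v: "0 < v \<phi>" by (rule v_pos)
  have "((\<lambda>\<phi>. - (e * sin \<phi>)) has_real_derivative - y) (at \<phi>)"
    unfolding y by (auto intro!: derivative_eq_intros)
  from DERIV_divide[OF DERIV_mult[OF this v_deriv] DERIV_chain2[OF f_deriv y_deriv]]
  have "(\<tau> has_real_derivative ((- y * v \<phi> + - s * V1 y / (2 * v \<phi>) * - s) * f y - - s * v \<phi> * (- sin (m + y) * - s))
      / (f y * f y)) (at \<phi>)"
    unfolding \<tau>_def[abs_def] using fy by (simp add: y s_def)
  moreover have "((- y * v \<phi> + - s * V1 y / (2 * v \<phi>) * - s) * f y - - s * v \<phi> * (- sin (m + y) * - s)) / (f y * f y)
    = S y * (h + S y * - sin (m + y) / f y) * f y / v \<phi>"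
  proof -
    define n where "n = c - h * (b * y + sin (m + y))"
    have S: "S y = n / f y" by (simp add: S_def n_def)
    have E: "s\<^sup>2 * V y = (f y)\<^sup>2 - n\<^sup>2" using V_eq[of y] by (simp add: ss f_def n_def)
    have E': "- 2 * y * V y + s\<^sup>2 * V1 y = 2 * f y * - sin (m + y) + 2 * h * n * f y"
      using V_eq'[of y] by (simp add: ss n_def)
    have "((- y * v \<phi> + - s * V1 y / (2 * v \<phi>) * - s) * f y - - s * v \<phi> * (- sin (m + y) * - s))
      = ((- 2 * y * (v \<phi> * v \<phi>) + s\<^sup>2 * V1 y) * f y / 2 + sin (m + y) * (s\<^sup>2 * (v \<phi> * v \<phi>))) / v \<phi>"
      using v by (simp add: field_simps power2_eq_square)
    also have "\<dots> = ((2 * f y * - sin (m + y) + 2 * h * n * f y) * f y / 2 + sin (m + y) * ((f y)\<^sup>2 - n\<^sup>2)) / v \<phi>"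
      unfolding vv E E' ..
    finally have *: "(- y * v \<phi> + - s * V1 y / (2 * v \<phi>) * - s) * f y - - s * v \<phi> * (- sin (m + y) * - s)
      = ((2 * f y * - sin (m + y) + 2 * h * n * f y) * f y / 2 + sin (m + y) * ((f y)\<^sup>2 - n\<^sup>2)) / v \<phi>" .
    show ?thesis unfolding * S using fy v by (simp add: field_simps power2_eq_square)
  qed
  ultimately show ?thesis by simp
qed

lemma t_over_r: "t s / r = m + e * cos (phase s)"
  using r by (simp add: t_def)

lemma warp_t: "warp (r * b) r (t s) = r * f (e * cos (phase s))"
  unfolding warp_def t_over_r by (simp add: f_def algebra_simps)

lemma sigma_deriv: "(\<sigma> has_real_derivative - (h / r) + sin (\<sigma> s) * sin (t s / r) / warp (r * b) r (t s)) (at s)"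
proof -
  define y where "y = e * cos (phase s)"
  have S: "0 < S y" unfolding y_def by (rule S_pos'[OF y_le])
  have fy: "0 < f y" by (rule f_pos)
  have T: "((\<lambda>s. \<tau> (phase s)) has_real_derivative S y * (h + S y * - sin (m + y) / f y) * f y / v (phase s)
      * (v (phase s) / (r * f y))) (at s)"
    using DERIV_chain2[OF tau_deriv[OF refl] phase_deriv, of s] by (simp add: y_def)
  have "(arccos has_real_derivative inverse (- S y)) (at (\<tau> (phase s)))"
    using DERIV_arccos[OF tau_bounds[of "phase s"]] by (simp only: sqrt_tau y_def)
  from DERIV_chain2[OF this T]
  have "(\<sigma> has_real_derivative inverse (- S y) * (S y * (h + S y * - sin (m + y) / f y) * f y / v (phase s)
      * (v (phase s) / (r * f y)))) (at s)"
    by (simp add: \<sigma>_def[abs_def])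
  then show ?thesis
    using S fy r v_pos[of "phase s"] unfolding sin_sigma warp_t t_over_r y_def[symmetric]
    by (elim DERIV_cong) (simp add: field_simps)
qed

lemma theta_deriv: "(\<theta> has_real_derivative sin (\<sigma> s) / warp (r * b) r (t s)) (at s)"
proof -
  have "(\<theta> has_real_derivative S (e * cos (phase s)) / v (phase s) * (v (phase s) / (r * f (e * cos (phase s))))) (at s)"
    unfolding \<theta>_def[abs_def] by (rule DERIV_chain2[OF ang(2) phase_deriv])
  then show ?thesis
    using v_pos[of "phase s"] by (simp add: sin_sigma warp_t)
qed

lemma cgc: "cgc_curve (r * b) r \<theta> t \<sigma> (- (h / r))"
proof (rule cgc_curve_if_ode)
  show "0 < warp (r * b) r (t s)" for s using r f_pos by (simp add: warp_t)
  show "(t has_real_derivative cos (\<sigma> s)) (at s)" for s by (simp add: cos_sigma t_deriv)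
qed (use r in simp, rule theta_deriv, rule sigma_deriv)

lemma S_turning: "S (e * cos \<phi>) = 1" if "sin \<phi> = 0"
proof -
  have "(S (e * cos \<phi>))\<^sup>2 = 1" using tau_sq[of \<phi>] that by (simp add: \<tau>_def)
  then show ?thesis using S_pos'[OF y_le, of \<phi>] by (simp add: power2_eq_1_iff)
qed

text \<open>The witnesses are the arc lengths of the phases 0 and \<open>pi\<close>, consecutive
  zeros of \<open>sin\<close> and hence of \<open>t'\<close>. There \<open>S^2 = 1\<close>, and
  positivity of \<open>S\<close> selects the value 1 at the minimum as well as at the
  maximum.\<close>

lemma unduloid: "unduloid_type (r * b) r \<theta> t \<sigma> (- (h / r))"
  unfolding unduloid_type_def
proof (intro conjI cgc exI)
  show "\<forall>\<^sub>F s in at 0. t s < t 0"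
    unfolding eventually_at_topological
  proof (intro exI conjI ballI impI)
    show "open {arclen (- pi)<..<arclen pi}" by simp
    show "0 \<in> {arclen (- pi)<..<arclen pi}"
      using strict_monoD[OF arclen_strict_mono, of "-pi" 0] strict_monoD[OF arclen_strict_mono, of 0 pi]
      by (simp add: arclen(1))
    fix s assume "s \<in> {arclen (- pi)<..<arclen pi}" "s \<noteq> 0"
    then have "- pi < phase s" "phase s < pi" "phase s \<noteq> 0"
      using phase_less_iff[of "arclen (- pi)" s] phase_less_iff[of s "arclen pi"]
        phase_less_iff[of 0 s] phase_less_iff[of s 0] by (auto simp: phase_0)
    then have "cos \<bar>phase s\<bar> < cos 0" by (intro cos_monotone_0_pi) auto
    then have "cos (phase s) < 1" by simp
    then show "t s < t 0" using r e by (simp add: t_def phase_0)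
  qed
  show "sin (\<sigma> 0) = 1" unfolding sin_sigma by (rule S_turning) (simp add: phase_0)
  show "0 < arclen pi" using strict_monoD[OF arclen_strict_mono, of 0 pi] by (simp add: arclen(1))
  show "deriv t (arclen pi) = 0" using DERIV_imp_deriv[OF t_deriv, of "arclen pi"] by (simp add: \<tau>_def)
  show "sin (\<sigma> (arclen pi)) = 1" unfolding sin_sigma by (rule S_turning) simp
  show "\<forall>s\<in>{0<..<arclen pi}. deriv t s \<noteq> 0"
  proof
    fix s assume "s \<in> {0<..<arclen pi}"
    then have "0 < sin (phase s)"
      using phase_less_iff[of 0 s] phase_less_iff[of s "arclen pi"] by (intro sin_gt_zero) (auto simp: phase_0)
    then show "deriv t s \<noteq> 0"
      using DERIV_imp_deriv[OF t_deriv, of s] e v_pos[of "phase s"] f_pos[of "e * cos (phase s)"]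
      by (simp add: \<tau>_def)
  qed
qed

lemma theta_add_L: "\<theta> (s + L) = \<theta> s + 2 * pi"
  by (simp add: \<theta>_def phase_add_L ang_add_2pi)

lemma closed: "closed_curve r \<theta> t L"
  unfolding closed_curve_def same_point_def
proof (intro conjI allI L_pos)
  fix s
  show "\<exists>k n. fst (\<theta> (s + L), t (s + L)) = fst (\<theta> s, t s) + 2 * pi * of_int k
      \<and> snd (\<theta> (s + L), t (s + L)) = snd (\<theta> s, t s) + 2 * pi * r * of_int n"
    by (rule exI[of _ 1], rule exI[of _ 0]) (simp add: \<theta>_def t_def phase_add_L ang_add_2pi)
qed

text \<open>\<open>\<theta>\<close> is strictly increasing and gains \<open>2 * pi\<close> over each
  \<open>L\<close>, so its class modulo \<open>2 * pi\<close> alone determines the parameter modulo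
  \<open>L\<close>.\<close>

lemma embedded: "embedded_curve r \<theta> t L"
  unfolding embedded_curve_def
proof (intro allI impI)
  fix s s' assume "same_point r (\<theta> s, t s) (\<theta> s', t s')"
  then obtain k :: int where "\<theta> s' = \<theta> s + 2 * pi * of_int k" by (auto simp: same_point_def)
  also have "\<dots> = \<theta> (s + of_int k * L)"
    using add_int_multiple_period[of \<theta>, OF theta_add_L, of s k] by simp
  finally have "\<theta> s' = \<theta> (s + of_int k * L)" .
  then have "phase s' = phase (s + of_int k * L)"
    unfolding \<theta>_def using strict_mono_eq[OF ang_strict_mono] by blast
  then have "s' = s + of_int k * L" by (metis arclen_phase)
  then show "\<exists>k::int. s' = s + of_int k * L" ..
qed



section \<open>The second variation in the phase variable\<close>

text \<open>With \<open>\<omega> = v / f\<close> this is the weight \<open>f^2 * \<omega>^3\<close>;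
  \<open>P1\<close> is its derivative in \<open>y\<close>.\<close>

definition "P y = V y * sqrt (V y) / f y"
definition "P1 y = P y * (3/2 * V1 y / V y + sin (m + y) / f y)"

lemma P_deriv: "(P has_real_derivative P1 y) (at y)" if y: "\<bar>y\<bar> \<le> e"
proof -
  define q where "q = sqrt (V y)"
  have q: "q > 0" "V y = q * q" using V_pos[OF y] by (auto simp: q_def)
  have "(P has_real_derivative ((V1 y * q + inverse q / 2 * V1 y * V y) * f y - V y * q * - sin (m + y)) / (f y * f y)) (at y)"
    unfolding P_def[abs_def] q_def
    by (intro DERIV_divide DERIV_mult V f_deriv DERIV_chain2[OF DERIV_real_sqrt V])
      (use V_pos[OF y] f_pos[of y] in auto)
  then show ?thesis
    by (rule DERIV_cong) (use q f_pos[of y] in \<open>simp add: P1_def P_def q_def[symmetric] field_simps\<close>)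
qed

lemma integral_arclen:
  assumes g: "continuous_on UNIV g"
  shows "integral {0..L} g = integral {0..2 * pi} (\<lambda>\<phi>. g (arclen \<phi>) * (r * f (e * cos \<phi>) / v \<phi>))"
proof -
  from exists_antiderivative[OF g] obtain G where G: "\<And>x. (G has_real_derivative g x) (at x)" by blast
  have "(g has_integral G L - G 0) {0..L}" by (intro FTC_real G) (use L_pos in simp)
  moreover have "((\<lambda>\<phi>. g (arclen \<phi>) * (r * f (e * cos \<phi>) / v \<phi>)) has_integral
      G (arclen (2 * pi)) - G (arclen 0)) {0..2 * pi}"
    by (intro FTC_real DERIV_chain2[OF G arclen(2)]) simp
  ultimately show ?thesis by (simp add: integral_unique arclen(1) L_def)
qed

lemma gauss_curvature_t: "gauss_curvature (r * b) r (t s)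
    = cos (m + e * cos (phase s)) / (r\<^sup>2 * f (e * cos (phase s)))"
proof -
  have "((\<lambda>t. - sin (t / r)) has_real_derivative - (cos (x / r) / r)) (at x)" for x
    using r by (auto intro!: derivative_eq_intros)
  then have "deriv (deriv (warp (r * b) r)) x = - (cos (x / r) / r)" for x
    using r by (simp add: deriv_warp DERIV_imp_deriv)
  then show ?thesis by (simp add: gauss_curvature_def t_over_r warp_t power2_eq_square)
qed

text \<open>Putting \<open>u = v * z\<close> into the index form produces the three summands on the
  left: the derivative of \<open>v' / f\<close>, the square completed for \<open>z'\<close>, and the
  curvature potential. The right-hand side, times \<open>V\<close>, is the zero-order coefficient
  for which \<open>z = sin \<phi>\<close> is a Jacobi field. The proof eliminates the terms
  \<open>s^2 * V1\<close> and \<open>s^2 * V2\<close> by \<open>V_eq'\<close> and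
  \<open>V_eq''\<close>.\<close>

lemma jacobi_identity:
  assumes "y = e * cos \<phi>" "s = e * sin \<phi>" "v' = - s * V1 y / (2 * v \<phi>)"
  shows "((- y * V1 y + s\<^sup>2 * V2 y) * (2 * v \<phi> * f y) - - s * V1 y * (2 * (v' * f y + v \<phi> * (sin (m + y) * s))))
        / ((2 * v \<phi> * f y) * (2 * v \<phi> * f y)) + v'\<^sup>2 / (v \<phi> * f y) + (cos (m + y) + h\<^sup>2 * f y) / v \<phi>
      = (P y + y * P1 y) / V y"
proof -
  define n where "n = c - h * (b * y + sin (m + y))"
  define q F N A B where "q = v \<phi>" and "F = f y" and "N = sin (m + y)" and "A = V1 y" and "B = V2 y"
  have ss: "s\<^sup>2 = e\<^sup>2 - y\<^sup>2"
    by (simp add: assms y_sq)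
  have q: "q > 0" "F > 0" by (simp_all add: q_def F_def v_pos f_pos)
  have Vq: "V y = q * q" by (simp add: assms q_def v_sq)
  have E': "- 2 * y * (q * q) + s\<^sup>2 * A = - 2 * F * N + 2 * h * n * F"
    using V_eq'[of y] by (simp add: ss n_def Vq F_def N_def A_def)
  have E'': "- 2 * (q * q) - 4 * y * A + s\<^sup>2 * B = 2 * N\<^sup>2 - 2 * F * cos (m + y) - 2 * h\<^sup>2 * F\<^sup>2 - 2 * h * n * N"
    using V_eq''[of y] by (simp add: ss n_def Vq F_def N_def A_def B_def)
  have v': "v' = - s * A / (2 * q)" by (simp add: assms A_def q_def)
  have "((- y * A + s\<^sup>2 * B) * (2 * q * F) - - s * A * (2 * (v' * F + q * (N * s))))
        / ((2 * q * F) * (2 * q * F)) + v'\<^sup>2 / (q * F) + (cos (m + y) + h\<^sup>2 * F) / q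
      = (F * (- y * A + s\<^sup>2 * B) + N * (s\<^sup>2 * A) + 2 * F\<^sup>2 * (cos (m + y) + h\<^sup>2 * F)) / (2 * q * F\<^sup>2)"
    unfolding v' using q by (simp add: field_simps power2_eq_square)
  also have "F * (- y * A + s\<^sup>2 * B) + N * (s\<^sup>2 * A) + 2 * F\<^sup>2 * (cos (m + y) + h\<^sup>2 * F)
      = 2 * F * (q * q) + 3 * y * F * A + 2 * y * (q * q) * N"
    using E' E'' by algebra
  also have "\<dots> / (2 * q * F\<^sup>2) = (P y + y * P1 y) / V y"
    using q unfolding P1_def P_def F_def[symmetric] N_def[symmetric] A_def[symmetric] Vq
    by (simp add: field_simps power2_eq_square)
  finally show ?thesis by (simp add: q_def F_def N_def A_def B_def)
qed

text \<open>Substituting \<open>u = v * z\<close>, where \<open>v\<close> is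
  \<open>f * \<omega>\<close> in the scaling \<open>r = 1\<close>, and passing to the phase changes
  the index form into \<open>1 / r\<close> times the integral of \<open>J\<close>, up to the total
  derivative \<open>B'\<close>. Since \<open>ds = r * f / v d\<phi>\<close>, the area constraint
  turns into the vanishing of the integral of \<open>f * z\<close>.\<close>

lemma stable:
  assumes nonneg: "\<And>z z'. \<lbrakk>\<And>x. (z has_real_derivative z' x) (at x); continuous_on UNIV z';
      z (2 * pi) = z 0; integral {0..2 * pi} (\<lambda>\<phi>. f (e * cos \<phi>) * z \<phi>) = 0\<rbrakk> \<Longrightarrow>
    0 \<le> integral {0..2 * pi} (\<lambda>\<phi>. P (e * cos \<phi>) * ((z' \<phi>)\<^sup>2 - (z \<phi>)\<^sup>2)
      - e * cos \<phi> * P1 (e * cos \<phi>) * (z \<phi>)\<^sup>2)"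
  shows "stable_curve (r * b) r t (- (h / r)) L"
  unfolding stable_curve_def
proof (intro allI impI, elim conjE)
  fix u assume test: "test_function L u" and mean: "integral {0..L} u = 0"
  have u: "(u has_real_derivative deriv u s) (at s)" "(deriv u has_real_derivative deriv (deriv u) s) (at s)" for s
    using test by (auto simp: test_function_def DERIV_deriv_iff_real_differentiable)
  have u2: "continuous_on UNIV (deriv (deriv u))" using test by (simp add: test_function_def)
  have periodic: "u (s + L) = u s" for s using test by (simp add: test_function_def)
  have periodic': "deriv u L = deriv u 0"
  proof (rule DERIV_unique)
    have "((\<lambda>s. s + L) has_real_derivative 1) (at 0)" by (auto intro!: derivative_eq_intros)
    from DERIV_chain2[OF _ this, of u "deriv u L"] u(1)[of L]
    show "(u has_real_derivative deriv u L) (at 0)" by (simp add: periodic)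
  qed (rule u)
  have cu: "continuous_on UNIV u" "continuous_on UNIV (deriv u)"
    using continuous_on_if_has_real_derivative u by blast+
  define v' where "v' \<phi> = - (e * sin \<phi>) * V1 (e * cos \<phi>) / (2 * v \<phi>)" for \<phi>
  define U U1 U2 where "U \<phi> = u (arclen \<phi>)" and "U1 \<phi> = deriv u (arclen \<phi>)"
    and "U2 \<phi> = deriv (deriv u) (arclen \<phi>)" for \<phi>
  define D where "D \<phi> = r * f (e * cos \<phi>) / v \<phi>" for \<phi>
  have U: "(U has_real_derivative U1 \<phi> * D \<phi>) (at \<phi>)" and U1: "(U1 has_real_derivative U2 \<phi> * D \<phi>) (at \<phi>)" for \<phi>
    unfolding U_def[abs_def] U1_def[abs_def] U2_def D_def by (rule DERIV_chain2[OF u(1) arclen(2)] DERIV_chain2[OF u(2) arclen(2)])+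
  have v: "(v has_real_derivative v' \<phi>) (at \<phi>)" for \<phi>
    unfolding v'_def by (rule v_deriv)
  have fd: "((\<lambda>\<phi>. f (e * cos \<phi>)) has_real_derivative sin (m + e * cos \<phi>) * (e * sin \<phi>)) (at \<phi>)" for \<phi>
    using DERIV_chain2[OF f_deriv y_deriv] by simp
  define X where "X \<phi> = - (e * sin \<phi>) * V1 (e * cos \<phi>) / (2 * v \<phi> * f (e * cos \<phi>))" for \<phi>
  define X' where "X' \<phi> = ((- (e * cos \<phi>) * V1 (e * cos \<phi>) + (e * sin \<phi>)\<^sup>2 * V2 (e * cos \<phi>)) * (2 * v \<phi> * f (e * cos \<phi>))
      - - (e * sin \<phi>) * V1 (e * cos \<phi>) * (2 * (v' \<phi> * f (e * cos \<phi>) + v \<phi> * (sin (m + e * cos \<phi>) * (e * sin \<phi>)))))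
      / ((2 * v \<phi> * f (e * cos \<phi>)) * (2 * v \<phi> * f (e * cos \<phi>)))" for \<phi>
  have X: "(X has_real_derivative X' \<phi>) (at \<phi>)" for \<phi>
  proof -
    have "((\<lambda>\<phi>. - (e * sin \<phi>)) has_real_derivative - (e * cos \<phi>)) (at \<phi>)"
      by (auto intro!: derivative_eq_intros)
    note 1 = DERIV_mult[OF this DERIV_chain2[OF V1 y_deriv, of \<phi>]]
    note 2 = DERIV_cmult[OF DERIV_mult[OF v fd], of 2 \<phi>]
    have ne: "2 * (v \<phi> * f (e * cos \<phi>)) \<noteq> 0" using v_pos[of \<phi>] f_pos[of "e * cos \<phi>"] by simp
    show ?thesis
      unfolding X_def[abs_def] mult.assoc[of 2 "v _"]
      by (rule DERIV_cong[OF DERIV_divide[OF 1 2 ne]])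
        (simp add: X'_def power2_eq_square algebra_simps)
  qed
  \<comment> \<open>The first term integrates \<open>u * u''\<close> by parts, the second completes
    the square for \<open>z'\<close>. Periodicity of \<open>u\<close> and of its derivative gives
    \<open>B\<close> equal values at both ends.\<close>
  define B where "B \<phi> = r * U \<phi> * U1 \<phi> - (U \<phi>)\<^sup>2 * X \<phi>" for \<phi>
  define B' where "B' \<phi> = r * (U1 \<phi> * D \<phi>) * U1 \<phi> + r * U \<phi> * (U2 \<phi> * D \<phi>)
      - (2 * U \<phi> * (U1 \<phi> * D \<phi>) * X \<phi> + (U \<phi>)\<^sup>2 * X' \<phi>)" for \<phi>
  have "(B has_real_derivative B' \<phi>) (at \<phi>)" for \<phi>
    unfolding B_def[abs_def] B'_def
    by (auto intro!: derivative_eq_intros U U1 X simp: algebra_simps)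
  then have "(B' has_integral B (2 * pi) - B 0) {0..2 * pi}" by (intro FTC_real) auto
  moreover have "B (2 * pi) = B 0"
    using periodic[of 0] periodic' by (simp add: B_def U_def U1_def X_def arclen(1) L_def[symmetric] v_def)
  ultimately have B': "(B' has_integral 0) {0..2 * pi}" by simp
  define z z' where "z \<phi> = U \<phi> / v \<phi>" and "z' \<phi> = (U1 \<phi> * D \<phi> * v \<phi> - U \<phi> * v' \<phi>) / (v \<phi> * v \<phi>)" for \<phi>
  have z: "(z has_real_derivative z' \<phi>) (at \<phi>)" for \<phi>
    unfolding z_def[abs_def] z'_def by (rule DERIV_divide[OF U v v_neq])
  have cV1: "continuous_on UNIV (\<lambda>\<phi>. V1 (e * cos \<phi>))"
    by (rule continuous_on_if_has_real_derivative[OF DERIV_chain2[OF V1 y_deriv]])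
  have cv': "continuous_on UNIV v'"
    unfolding v'_def[abs_def] by (intro continuous_intros cV1 v_cont) (use v_neq in auto)
  note cU = continuous_on_if_has_real_derivative[OF U] continuous_on_if_has_real_derivative[OF U1]
  have cz': "continuous_on UNIV z'"
    unfolding z'_def[abs_def] D_def
    by (intro continuous_intros cU v_cont cv' f_cont) (use v_neq in auto)
  have "integral {0..2 * pi} (\<lambda>\<phi>. f (e * cos \<phi>) * z \<phi>) = integral {0..2 * pi} (\<lambda>\<phi>. u (arclen \<phi>) * (r * f (e * cos \<phi>) / v \<phi>) / r)"
    using r by (intro integral_cong) (simp add: z_def U_def)
  also have "\<dots> = integral {0..L} u / r" unfolding integral_arclen[OF cu(1)] by (rule integral_divide)
  finally have mz: "integral {0..2 * pi} (\<lambda>\<phi>. f (e * cos \<phi>) * z \<phi>) = 0" using mean by simp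
  have "z (2 * pi) = z 0" using periodic[of 0] by (simp add: z_def U_def v_def arclen(1) L_def[symmetric])
  note J = nonneg[OF z cz' this mz]
  define J where "J \<phi> = P (e * cos \<phi>) * ((z' \<phi>)\<^sup>2 - (z \<phi>)\<^sup>2) - e * cos \<phi> * P1 (e * cos \<phi>) * (z \<phi>)\<^sup>2" for \<phi>
  define g where "g s = u s * (deriv (deriv u) s + (gauss_curvature (r * b) r (t s) + (- (h / r))\<^sup>2) * u s)" for s
  have pointwise: "g (arclen \<phi>) * D \<phi> = - (J \<phi> - B' \<phi>) / r" for \<phi>
  proof -
    define y s q F where "y = e * cos \<phi>" and "s = e * sin \<phi>" and "q = v \<phi>" and "F = f y"
    have q: "q > 0" "F > 0" by (simp_all add: q_def F_def v_pos f_pos)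
    have Vq: "V y = q * q" by (simp add: y_def q_def v_sq)
    define C where "C = cos (m + y) + h\<^sup>2 * F"
    have id: "X' \<phi> + (v' \<phi>)\<^sup>2 / (q * F) + C / q = (P y + y * P1 y) / (q * q)"
      unfolding X'_def C_def
      using jacobi_identity[OF y_def s_def, of "v' \<phi>"] by (simp add: v'_def y_def s_def q_def F_def v_sq)
    have X: "X \<phi> = v' \<phi> / F" using q by (simp add: X_def v'_def F_def y_def q_def)
    have D: "D \<phi> = r * F / q" by (simp add: D_def F_def y_def q_def)
    have Py: "P y = q * q * q / F" using q by (simp add: P_def Vq F_def)
    have "J \<phi> = P y * (z' \<phi>)\<^sup>2 - (U \<phi>)\<^sup>2 * ((P y + y * P1 y) / (q * q))"
      using q by (simp add: J_def y_def[symmetric] z_def q_def[symmetric] power_divide power2_eq_square field_simps)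
    also have "\<dots> = (U1 \<phi> * r * F - U \<phi> * v' \<phi>)\<^sup>2 / (q * F)
        - (U \<phi>)\<^sup>2 * (X' \<phi> + (v' \<phi>)\<^sup>2 / (q * F) + C / q)"
      unfolding id Py z'_def D q_def[symmetric] using q by (simp add: field_simps power2_eq_square)
    finally have J_eq: "J \<phi> = (U1 \<phi> * r * F - U \<phi> * v' \<phi>)\<^sup>2 / (q * F)
        - (U \<phi>)\<^sup>2 * (X' \<phi> + (v' \<phi>)\<^sup>2 / (q * F) + C / q)" .
    have "J \<phi> - B' \<phi> = - (r\<^sup>2 * U \<phi> * U2 \<phi> * F / q + (U \<phi>)\<^sup>2 * C / q)"
      unfolding J_eq B'_def X D using q by (simp add: field_simps power2_eq_square)
    moreover have "g (arclen \<phi>) * D \<phi> = (r\<^sup>2 * U \<phi> * U2 \<phi> * F / q + (U \<phi>)\<^sup>2 * C / q) / r"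
      unfolding g_def gauss_curvature_t phase_arclen y_def[symmetric] F_def[symmetric] D C_def
        U_def[symmetric] U2_def[symmetric]
      using q r by (simp add: field_simps power2_eq_square)
    ultimately show ?thesis by simp
  qed
  have cP: "continuous_on UNIV (\<lambda>\<phi>. P (e * cos \<phi>))"
    unfolding P_def by (intro continuous_intros f_cont continuous_on_if_has_real_derivative[OF DERIV_chain2[OF V y_deriv]])
      (use f_pos less_irrefl in \<open>metis\<close>)
  have cP1: "continuous_on UNIV (\<lambda>\<phi>. P1 (e * cos \<phi>))"
    unfolding P1_def
    by (intro continuous_intros cP f_cont cV1 continuous_on_if_has_real_derivative[OF DERIV_chain2[OF V y_deriv]])
      (use f_pos V_pos[OF y_le] less_irrefl in \<open>metis\<close>)+
  have "continuous_on UNIV J"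
    unfolding J_def[abs_def]
    by (intro continuous_intros cP cP1 cz' continuous_on_if_has_real_derivative[OF z])
  then have I: "((\<lambda>\<phi>. - (J \<phi> - B' \<phi>) / r) has_integral - (integral {0..2 * pi} J - 0) / r) {0..2 * pi}"
    by (intro has_integral_divide has_integral_neg has_integral_diff B' integrable_integral
        integrable_on_continuous_UNIV)
  have "continuous_on UNIV g"
    unfolding g_def[abs_def] gauss_curvature_t
  proof (intro continuous_intros cu u2)
    show ph: "continuous_on UNIV phase" by (rule continuous_on_if_has_real_derivative[OF phase_deriv])
    show "continuous_on UNIV (\<lambda>s. f (e * cos (phase s)))"
      using continuous_on_compose2[OF f_cont ph] by simp
    show "\<forall>s\<in>UNIV. r\<^sup>2 * f (e * cos (phase s)) \<noteq> 0" using r f_pos by (metis less_irrefl mult_pos_pos zero_less_power)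
  qed
  then have "integral {0..L} g = - (integral {0..2 * pi} J) / r"
    unfolding integral_arclen[OF \<open>continuous_on UNIV g\<close>] D_def[symmetric] pointwise integral_unique[OF I] by simp
  then show "0 \<le> index_form (r * b) r t (- (h / r)) L u"
    using J r by (simp add: index_form_def g_def[abs_def] J_def[abs_def])
qed

end

section \<open>The family near the bifurcating parallel\<close>

text \<open>Cosine is treated as a function of the square of its argument because the quotients
  below are by \<open>y^2 - e^2\<close>: they become ordinary divided differences of one smooth
  function.\<close>

definition cos_sqrt_coeff :: "nat \<Rightarrow> real" where
  "cos_sqrt_coeff n = (- 1) ^ n / fact (2 * n)"

text \<open>The \<^term>\<open>k\<close>-th derivative of the entire function whose value at \<open>x\<^sup>2\<close> is \<open>cos x\<close>.\<close>

definition cos_sqrt :: "nat \<Rightarrow> real \<Rightarrow> real" where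
  "cos_sqrt k u = (\<Sum>n. (diffs ^^ k) cos_sqrt_coeff n * u ^ n)"

lemma summable_cos_sqrt: "summable (\<lambda>n. (diffs ^^ k) cos_sqrt_coeff n * u ^ n)"
proof (induction k arbitrary: u)
  case 0
  have "norm (cos_sqrt_coeff n * u ^ n) \<le> inverse (fact n) * \<bar>u\<bar> ^ n" for n
  proof -
    have "inverse (fact (2 * n)) \<le> (inverse (fact n) :: real)"
      by (intro le_imp_inverse_le fact_mono) auto
    then show ?thesis
      by (simp add: cos_sqrt_coeff_def abs_mult power_abs divide_inverse mult_right_mono)
  qed
  then show ?case
    using summable_comparison_test'[OF summable_exp[of "\<bar>u\<bar>"], of 0 "\<lambda>n. cos_sqrt_coeff n * u ^ n"] by simp
next
  case (Suc k)
  show ?case using termdiff_converges_all[OF Suc] by simp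
qed

lemma DERIV_cos_sqrt: "(cos_sqrt k has_real_derivative cos_sqrt (Suc k) u) (at u)"
  unfolding cos_sqrt_def[abs_def]
  using termdiffs_strong_converges_everywhere[OF summable_cos_sqrt, of k u] by simp

lemma continuous_on_cos_sqrt [continuous_intros]:
  "continuous_on A g \<Longrightarrow> continuous_on A (\<lambda>x. cos_sqrt k (g x))"
  by (rule continuous_on_compose2[OF continuous_on_if_has_real_derivative[OF DERIV_cos_sqrt]]) auto

lemma cos_sqrt_0_sq: "cos_sqrt 0 (x\<^sup>2) = cos x"
  using cos_paired[of x] by (simp add: cos_sqrt_def cos_sqrt_coeff_def sums_iff power_mult)

text \<open>Differentiating \<open>cos_sqrt 0 (x^2) = cos x\<close> identifies
  \<open>- 2 * cos_sqrt 1 (x^2)\<close> as \<open>sin x / x\<close>, continued smoothly through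
  0.\<close>

lemma cos_sqrt_1_sq: "x * (-2 * cos_sqrt 1 (x\<^sup>2)) = sin x"
proof -
  have "((\<lambda>x. x\<^sup>2) has_real_derivative 2 * x) (at x)" by (auto intro!: derivative_eq_intros)
  from DERIV_chain2[OF DERIV_cos_sqrt this, of 0]
  have "(cos has_real_derivative cos_sqrt 1 (x\<^sup>2) * (2 * x)) (at x)" by (simp add: cos_sqrt_0_sq)
  from DERIV_unique[OF this DERIV_cos] show ?thesis by (simp add: mult.commute mult.left_commute)
qed

lemma cos_sqrt_at_0: "cos_sqrt k 0 = (diffs ^^ k) cos_sqrt_coeff 0"
  using powser_zero[of "(diffs ^^ k) cos_sqrt_coeff"] by (simp add: cos_sqrt_def)

lemma cos_sqrt_values_at_0: "cos_sqrt 1 0 = - 1/2" "cos_sqrt 2 0 = 1/12"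
  by (simp_all add: cos_sqrt_at_0 numeral_2_eq_2 diffs_def cos_sqrt_coeff_def fact_numeral)

lemma abs_sinc_le_1: "\<bar>2 * cos_sqrt 1 (x\<^sup>2)\<bar> \<le> 1"
proof (cases "x = 0")
  case True
  then show ?thesis by (simp add: cos_sqrt_values_at_0[simplified])
next
  case False
  have "\<bar>x\<bar> * \<bar>2 * cos_sqrt 1 (x\<^sup>2)\<bar> = \<bar>sin x\<bar>"
    unfolding cos_sqrt_1_sq[of x, symmetric] by (simp add: abs_mult)
  also have "\<dots> \<le> \<bar>x\<bar> * 1" using abs_sin_x_le_abs_x[of x] by simp
  finally show ?thesis using False by simp
qed

text \<open>Hadamard's integral form of a divided difference. For \<open>i = 0\<close> and positive
  \<open>k\<close> it is the increment of \<open>cos_sqrt (k - 1)\<close> from \<open>e^2\<close> to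
  \<open>y^2\<close> divided by \<open>y^2 - e^2\<close>; each derivative in \<open>y\<close> raises
  both indices. The integral is jointly continuous in \<open>(e, y)\<close>, also where
  \<open>y^2 = e^2\<close>.\<close>

definition moment :: "nat \<Rightarrow> nat \<Rightarrow> real \<Rightarrow> real \<Rightarrow> real" where
  "moment i k e y = integral {0..1} (\<lambda>\<tau>. \<tau> ^ i * cos_sqrt k (e\<^sup>2 + \<tau> * (y\<^sup>2 - e\<^sup>2)))"

lemma continuous_on_moment [continuous_intros]:
  fixes f g :: "'a::t2_space \<Rightarrow> real"
  assumes "continuous_on A f" "continuous_on A g"
  shows "continuous_on A (\<lambda>x. moment i k (f x) (g x))"
proof -
  have "continuous_on UNIV (\<lambda>p. integral (cbox 0 1) (\<lambda>\<tau>. \<tau> ^ i * cos_sqrt k ((fst p)\<^sup>2 + \<tau> * ((snd p)\<^sup>2 - (fst p)\<^sup>2))))"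
    by (rule integral_continuous_on_param) (auto simp: case_prod_beta intro!: continuous_intros)
  then have "continuous_on UNIV (\<lambda>p. moment i k (fst p) (snd p))" by (simp add: moment_def)
  from continuous_on_compose2[OF this continuous_on_Pair[OF assms]] show ?thesis by simp
qed

lemma DERIV_moment: "(moment i k e has_real_derivative 2 * y * moment (Suc i) (Suc k) e y) (at y)"
proof -
  have "((\<lambda>y. integral (cbox 0 1) (\<lambda>\<tau>. \<tau> ^ i * cos_sqrt k (e\<^sup>2 + \<tau> * (y\<^sup>2 - e\<^sup>2)))) has_real_derivative
      integral (cbox 0 1) (\<lambda>\<tau>. \<tau> ^ i * (cos_sqrt (Suc k) (e\<^sup>2 + \<tau> * (y\<^sup>2 - e\<^sup>2)) * (\<tau> * (2 * y))))) (at y within UNIV)"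
  proof (rule leibniz_rule_field_derivative)
    fix y \<tau> :: real
    have "((\<lambda>y. e\<^sup>2 + \<tau> * (y\<^sup>2 - e\<^sup>2)) has_real_derivative \<tau> * (2 * y)) (at y)"
      by (auto intro!: derivative_eq_intros)
    from DERIV_cmult[OF DERIV_chain2[OF DERIV_cos_sqrt this]]
    show "((\<lambda>y. \<tau> ^ i * cos_sqrt k (e\<^sup>2 + \<tau> * (y\<^sup>2 - e\<^sup>2))) has_real_derivative
        \<tau> ^ i * (cos_sqrt (Suc k) (e\<^sup>2 + \<tau> * (y\<^sup>2 - e\<^sup>2)) * (\<tau> * (2 * y)))) (at y within UNIV)" by simp
  next
    show "(\<lambda>\<tau>. \<tau> ^ i * cos_sqrt k (e\<^sup>2 + \<tau> * (y\<^sup>2 - e\<^sup>2))) integrable_on cbox 0 1" for y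
      by (intro integrable_continuous continuous_intros)
  qed (auto simp: case_prod_beta intro!: continuous_intros)
  moreover have "integral (cbox 0 1) (\<lambda>\<tau>. \<tau> ^ i * (cos_sqrt (Suc k) (e\<^sup>2 + \<tau> * (y\<^sup>2 - e\<^sup>2)) * (\<tau> * (2 * y))))
      = integral {0..1} (\<lambda>\<tau>. 2 * y * (\<tau> ^ Suc i * cos_sqrt (Suc k) (e\<^sup>2 + \<tau> * (y\<^sup>2 - e\<^sup>2))))"
    by (simp add: algebra_simps)
  ultimately show ?thesis by (simp add: moment_def[abs_def])
qed

lemma moment_divided_difference:
  "cos_sqrt k (y\<^sup>2) - cos_sqrt k (e\<^sup>2) = (y\<^sup>2 - e\<^sup>2) * moment 0 (Suc k) e y"
proof -
  have "((\<lambda>\<tau>. cos_sqrt (Suc k) (e\<^sup>2 + \<tau> * (y\<^sup>2 - e\<^sup>2)) * (y\<^sup>2 - e\<^sup>2)) has_integral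
      cos_sqrt k (e\<^sup>2 + 1 * (y\<^sup>2 - e\<^sup>2)) - cos_sqrt k (e\<^sup>2 + 0 * (y\<^sup>2 - e\<^sup>2))) {0..1}"
    by (intro FTC_real DERIV_chain2[OF DERIV_cos_sqrt]) (auto intro!: derivative_eq_intros)
  from integral_unique[OF this] show ?thesis by (simp add: moment_def mult.commute)
qed

lemma moment_at_0: "moment i k 0 0 = cos_sqrt k 0 / (real i + 1)"
proof -
  have "((\<lambda>\<tau>. \<tau> ^ i * cos_sqrt k 0) has_integral (1 ^ Suc i / (real i + 1) * cos_sqrt k 0) - (0 ^ Suc i / (real i + 1) * cos_sqrt k 0)) {0..1}"
  proof (rule FTC_real)
    show "((\<lambda>\<tau>. \<tau> ^ Suc i / (real i + 1) * cos_sqrt k 0) has_real_derivative \<tau> ^ i * cos_sqrt k 0) (at \<tau>)" for \<tau>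
    proof (rule DERIV_cong[OF DERIV_cmult_right[OF DERIV_cdivide[OF DERIV_pow]]])
      show "real (Suc i) * \<tau> ^ (Suc i - Suc 0) / (real i + 1) * cos_sqrt k 0 = \<tau> ^ i * cos_sqrt k 0"
        by (simp add: field_simps)
    qed
  qed simp
  from integral_unique[OF this] show ?thesis by (simp add: moment_def)
qed

section \<open>The first integral divided by \<open>e^2 - y^2\<close>\<close>

locale bifurcation =
  fixes b :: real
  assumes b: "1 < b"
begin

text \<open>
  The values of \<open>h\<close> and \<open>c\<close> make \<open>f + h F - c\<close> vanish at \<open>y = e\<close> and \<open>y = - e\<close>, where \<open>sin \<sigma> = 1\<close>;
  \<open>N\<close> is the quotient of \<open>f + h F - c\<close> by \<open>e\<^sup>2 - y\<^sup>2\<close>.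
\<close>

definition "sc e = - 2 * cos_sqrt 1 (e\<^sup>2)" for e :: real
definition "h m e = sin m * sc e / (b + cos m * sc e)"
definition "c m e = b + (cos m + h m e * sin m) * cos e"
definition "f m y = b + cos (m + y)" for m y :: real

definition "N m e y = - (cos m + h m e * sin m) * moment 0 1 e y
  + (h m e * cos m - sin m) * (2 * y * moment 0 2 e y)"
definition "N1 m e y = - (cos m + h m e * sin m) * (2 * y * moment 1 2 e y)
  + (h m e * cos m - sin m) * (2 * moment 0 2 e y + 4 * y\<^sup>2 * moment 1 3 e y)"
definition "N2 m e y = - (cos m + h m e * sin m) * (2 * moment 1 2 e y + 4 * y\<^sup>2 * moment 2 3 e y)
  + (h m e * cos m - sin m) * (12 * y * moment 1 3 e y + 8 * y^3 * moment 2 4 e y)"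

text \<open>The factors of \<open>f^2 - n^2 = (f - n) * (f + n)\<close>, with
  \<open>n = f * sin \<sigma>\<close>, are \<open>(e^2 - y^2) * N\<close> and
  \<open>2 * f - (e^2 - y^2) * N\<close>; dropping \<open>e^2 - y^2\<close> gives \<open>V\<close>.
  The derivatives \<open>V1\<close> and \<open>V2\<close> in \<open>y\<close> are written out so
  that their continuity in all three variables can be read off.\<close>

definition "V m e y = N m e y * (2 * f m y - (e\<^sup>2 - y\<^sup>2) * N m e y)"
definition "V1 m e y = N1 m e y * (2 * f m y - (e\<^sup>2 - y\<^sup>2) * N m e y)
  + N m e y * (- 2 * sin (m + y) + 2 * y * N m e y - (e\<^sup>2 - y\<^sup>2) * N1 m e y)"
definition "V2 m e y = N2 m e y * (2 * f m y - (e\<^sup>2 - y\<^sup>2) * N m e y)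
  + 2 * N1 m e y * (- 2 * sin (m + y) + 2 * y * N m e y - (e\<^sup>2 - y\<^sup>2) * N1 m e y)
  + N m e y * (- 2 * cos (m + y) + 2 * N m e y + 4 * y * N1 m e y - (e\<^sup>2 - y\<^sup>2) * N2 m e y)"

text \<open>\<open>sc e\<close> is \<open>sin e / e\<close>, of absolute value at most 1, so
  \<open>b > 1\<close> keeps the denominator positive for all \<open>m\<close> and
  \<open>e\<close>.\<close>

lemma h_denominator_pos: "0 < b + cos m * sc e"
proof -
  have "\<bar>cos m * sc e\<bar> \<le> 1 * 1"
    unfolding abs_mult sc_def using abs_sinc_le_1[of e] by (intro mult_mono) (auto simp: abs_mult)
  then show ?thesis using b by linarith
qed

lemma f_pos: "0 < f m y"
  unfolding f_def using b cos_ge_minus_one[of "m + y"] by linarith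

lemma continuous_on_h [continuous_intros]:
  fixes m e :: "'a::t2_space \<Rightarrow> real"
  assumes "continuous_on A m" "continuous_on A e"
  shows "continuous_on A (\<lambda>x. h (m x) (e x))"
proof -
  have "b + cos m * (- 2 * cos_sqrt 1 (e\<^sup>2)) \<noteq> 0" for m e
    using h_denominator_pos[of m e] by (simp add: sc_def)
  then show ?thesis
    unfolding h_def sc_def using assms by (auto intro!: continuous_intros)
qed

lemma continuous_on_V [continuous_intros]:
  fixes m e y :: "'a::t2_space \<Rightarrow> real"
  assumes "continuous_on A m" "continuous_on A e" "continuous_on A y"
  shows "continuous_on A (\<lambda>x. V (m x) (e x) (y x))"
    "continuous_on A (\<lambda>x. V1 (m x) (e x) (y x))" "continuous_on A (\<lambda>x. V2 (m x) (e x) (y x))"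
  unfolding V_def V1_def V2_def N_def N1_def N2_def f_def by (intro continuous_intros assms)+

lemma N_deriv: "(N m e has_real_derivative N1 m e y) (at y)" "(N1 m e has_real_derivative N2 m e y) (at y)"
proof -
  have "((\<lambda>y. - (cos m + h m e * sin m) * moment 0 1 e y + (h m e * cos m - sin m) * (2 * y * moment 0 2 e y))
      has_real_derivative - (cos m + h m e * sin m) * (2 * y * moment 1 2 e y)
      + (h m e * cos m - sin m) * (2 * 1 * moment 0 2 e y + 2 * y * moment 1 3 e y * (2 * y))) (at y)"
    using DERIV_moment[of 0 1 e y] DERIV_moment[of 0 2 e y]
    by (intro DERIV_add DERIV_cmult DERIV_mult DERIV_ident) (simp_all add: numeral_2_eq_2 numeral_3_eq_3)
  then show "(N m e has_real_derivative N1 m e y) (at y)"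
    unfolding N_def[abs_def] by (rule DERIV_cong) (simp add: N1_def power2_eq_square)
  have "((\<lambda>y. - (cos m + h m e * sin m) * (2 * y * moment 1 2 e y)
      + (h m e * cos m - sin m) * (2 * moment 0 2 e y + 4 * y\<^sup>2 * moment 1 3 e y))
      has_real_derivative - (cos m + h m e * sin m) * (2 * 1 * moment 1 2 e y + 2 * y * moment 2 3 e y * (2 * y))
      + (h m e * cos m - sin m) * (2 * (2 * y * moment 1 3 e y)
        + (4 * (real 2 * (1 * y ^ (2 - Suc 0))) * moment 1 3 e y + 2 * y * moment 2 4 e y * (4 * y\<^sup>2)))) (at y)"
    using DERIV_moment[of 1 2 e y] DERIV_moment[of 0 2 e y] DERIV_moment[of 1 3 e y]
    by (intro DERIV_add DERIV_cmult DERIV_mult DERIV_ident DERIV_power) (simp_all add: eval_nat_numeral)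
  then show "(N1 m e has_real_derivative N2 m e y) (at y)"
    unfolding N1_def[abs_def] by (rule DERIV_cong) (simp add: N2_def power2_eq_square power3_eq_cube mult_ac)
qed

lemma V_deriv: "(V m e has_real_derivative V1 m e y) (at y)" "(V1 m e has_real_derivative V2 m e y) (at y)"
proof -
  have f: "(f m has_real_derivative - sin (m + y)) (at y)" for y
    unfolding f_def[abs_def] by (auto intro!: derivative_eq_intros)
  show "(V m e has_real_derivative V1 m e y) (at y)"
    unfolding V_def[abs_def] V1_def
    by (auto intro!: derivative_eq_intros N_deriv f simp: algebra_simps)
  show "(V1 m e has_real_derivative V2 m e y) (at y)"
    unfolding V1_def[abs_def] V2_def
    by (auto intro!: derivative_eq_intros N_deriv f simp: algebra_simps)
qed

text \<open>\<open>f + h * F - c\<close> is a combination of \<open>cos y - cos e\<close> and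
  \<open>sin y - y * sc e\<close>: the constants cancel by the choice of \<open>c\<close>, and the
  equation for \<open>h\<close> turns \<open>h * b * y\<close> into a multiple of
  \<open>y * sc e\<close>. The moment formula divides both differences by
  \<open>e^2 - y^2\<close>.\<close>

lemma N_eq: "(e\<^sup>2 - y\<^sup>2) * N m e y = f m y + h m e * (b * y + sin (m + y)) - c m e"
proof -
  have A: "cos y - cos e = (y\<^sup>2 - e\<^sup>2) * moment 0 1 e y"
    using moment_divided_difference[of 0 y e] by (simp add: cos_sqrt_0_sq)
  have "y * (-2 * cos_sqrt 1 (y\<^sup>2)) - y * (-2 * cos_sqrt 1 (e\<^sup>2)) = - 2 * y * (cos_sqrt 1 (y\<^sup>2) - cos_sqrt 1 (e\<^sup>2))"
    by (simp add: algebra_simps)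
  also have "\<dots> = (e\<^sup>2 - y\<^sup>2) * (2 * y * moment 0 2 e y)"
    unfolding moment_divided_difference[of 1 y e, unfolded Suc_1] by (simp add: algebra_simps)
  finally have B: "sin y - y * sc e = (e\<^sup>2 - y\<^sup>2) * (2 * y * moment 0 2 e y)"
    unfolding cos_sqrt_1_sq by (simp add: sc_def)
  have "h m e * (b + cos m * sc e) = sin m * sc e"
    using h_denominator_pos[of m e] by (simp add: h_def)
  then have C: "h m e * b = - (h m e * cos m - sin m) * sc e" by (simp add: algebra_simps)
  have "(e\<^sup>2 - y\<^sup>2) * N m e y = (cos m + h m e * sin m) * ((y\<^sup>2 - e\<^sup>2) * moment 0 1 e y)
      + (h m e * cos m - sin m) * ((e\<^sup>2 - y\<^sup>2) * (2 * y * moment 0 2 e y))"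
    by (simp add: N_def algebra_simps)
  also have "\<dots> = (cos m + h m e * sin m) * (cos y - cos e) + (h m e * cos m - sin m) * sin y + y * (h m e * b)"
    unfolding A[symmetric] B[symmetric] C by (simp add: algebra_simps)
  also have "\<dots> = f m y + h m e * (b * y + sin (m + y)) - c m e"
    by (simp add: f_def c_def cos_add sin_add algebra_simps)
  finally show ?thesis .
qed

lemma V_eq: "(e\<^sup>2 - y\<^sup>2) * V m e y = (f m y)\<^sup>2 - (c m e - h m e * (b * y + sin (m + y)))\<^sup>2"
proof -
  have "(e\<^sup>2 - y\<^sup>2) * V m e y = ((e\<^sup>2 - y\<^sup>2) * N m e y) * (2 * f m y - (e\<^sup>2 - y\<^sup>2) * N m e y)"
    by (simp add: V_def)
  then show ?thesis unfolding N_eq by (simp add: power2_eq_square algebra_simps)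
qed

text \<open>Together with \<open>f'/f = - 1/b\<close>, these three numbers determine the sign of the
  second-order coefficient.\<close>

lemma V_at_bifurcation:
  "V (pi/2) 0 0 = 1" "V1 (pi/2) 0 0 = - b/3 - 1/b" "V2 (pi/2) 0 0 = 1/2 + 1/(2 * b\<^sup>2)"
proof -
  have sc: "sc 0 = 1" by (simp add: sc_def cos_sqrt_values_at_0[simplified])
  have h: "h (pi/2) 0 = 1/b" by (simp add: h_def sc)
  have N: "N (pi/2) 0 0 = 1/(2 * b)" "N1 (pi/2) 0 0 = - 1/6" "N2 (pi/2) 0 0 = - 1/(12 * b)"
    unfolding N_def N1_def N2_def moment_at_0 h
    by (simp_all add: cos_sqrt_values_at_0(1)[simplified] cos_sqrt_values_at_0(2))
  show "V (pi/2) 0 0 = 1" "V1 (pi/2) 0 0 = - b/3 - 1/b" "V2 (pi/2) 0 0 = 1/2 + 1/(2 * b\<^sup>2)"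
    unfolding V_def V1_def V2_def N f_def using b by (simp_all add: field_simps power2_eq_square)
qed

end

text \<open>Mean value inequality for \<open>G y - q * y\<close>; it turns closeness of derivatives,
  which continuity provides, into expansions whose error is relative to
  \<open>\<bar>y\<bar>\<close>.\<close>

lemma linear_approximation_bound:
  fixes G :: "real \<Rightarrow> real"
  assumes G: "\<And>y. \<bar>y\<bar> \<le> d \<Longrightarrow> (G has_real_derivative G' y) (at y)"
    and bound: "\<And>y. \<bar>y\<bar> \<le> d \<Longrightarrow> \<bar>G' y - q\<bar> \<le> B" and y: "\<bar>y\<bar> \<le> d"
  shows "\<bar>G y - G 0 - q * y\<bar> \<le> B * \<bar>y\<bar>"
proof -
  have "norm ((G y - q * y) - (G 0 - q * 0)) \<le> B * norm (y - 0)"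
  proof (rule field_differentiable_bound[where S = "{-d..d}"])
    show "((\<lambda>y. G y - q * y) has_real_derivative G' y - q) (at y within {-d..d})" if "y \<in> {-d..d}" for y
      using G[of y] that by (auto intro!: derivative_eq_intros intro: has_field_derivative_at_within)
    show "norm (G' y - q) \<le> B" if "y \<in> {-d..d}" for y using bound[of y] that by auto
  qed (use y in auto)
  then show ?thesis by simp
qed

context bifurcation
begin

section \<open>The closing condition\<close>

text \<open>The gain of \<open>\<theta>\<close> during one oscillation. At \<open>e = 0\<close> it
  is the limiting value for infinitesimal oscillations about the parallel.\<close>

definition "T m e = integral {0..2 * pi} (\<lambda>\<phi>. (c m e - h m e * (b * (e * cos \<phi>) + sin (m + e * cos \<phi>)))
    / (b + cos (m + e * cos \<phi>)) / sqrt (V m e (e * cos \<phi>)))"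

text \<open>With \<open>f = b + cos m\<close> the right-hand side is
  \<open>f * cos m + (sin m)^2\<close>, that is, \<open>f^2\<close> times the sum of the Gauss
  curvature and the squared geodesic curvature of the parallel (for \<open>r = 1\<close>): the
  squared frequency in \<open>\<theta>\<close> of its Jacobi fields.\<close>

lemma V_circle: "V m 0 0 = 1 + b * cos m"
proof -
  have sc: "sc 0 = 1" by (simp add: sc_def cos_sqrt_values_at_0(1)[simplified])
  have d: "b + cos m > 0" using h_denominator_pos[of m 0] by (simp add: sc)
  define q where "q = sin m / (b + cos m)"
  have "h m 0 = q" by (simp add: h_def sc q_def)
  then have "V m 0 0 = (cos m + q * sin m) * (b + cos m)"
    by (simp add: V_def N_def f_def moment_at_0 cos_sqrt_values_at_0(1)[simplified] algebra_simps)
  also have "\<dots> = cos m * b + ((cos m)\<^sup>2 + (sin m)\<^sup>2)"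
    unfolding q_def
    using d by (simp add: field_simps power2_eq_square)
  finally show ?thesis by (simp add: mult.commute)
qed

lemma T_circle: "T m 0 = 2 * pi / sqrt (1 + b * cos m)"
proof -
  have "b + cos m > 0" using f_pos[of m 0] by (simp add: f_def)
  then have "(c m 0 - h m 0 * (b * (0 * cos \<phi>) + sin (m + 0 * cos \<phi>))) / (b + cos (m + 0 * cos \<phi>)) = 1" for \<phi> :: real
    by (simp add: c_def)
  then show ?thesis unfolding T_def by (simp add: V_circle)
qed

text \<open>For \<open>e = 0\<close> the period is below \<open>2 * pi\<close> when
  \<open>m < pi/2\<close> and above it when \<open>m > pi/2\<close>. At two fixed values of
  \<open>m\<close> these strict inequalities survive for small \<open>e > 0\<close>, and the
  intermediate value theorem in \<open>m\<close> applies.\<close>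

lemma exists_period_2pi:
  assumes "0 < \<delta>" and V_pos: "\<And>m e y. \<bar>m - pi/2\<bar> < \<delta> \<Longrightarrow> \<bar>e\<bar> < \<delta> \<Longrightarrow> \<bar>y\<bar> < \<delta> \<Longrightarrow> 0 < V m e y"
  shows "\<exists>m e. \<bar>m - pi/2\<bar> < \<delta> \<and> 0 < e \<and> e < \<delta> \<and> T m e = 2 * pi"
proof -
  \<comment> \<open>Halving \<open>\<delta>\<close> fits a closed box into the open one; the bound 1
    is below \<open>pi\<close> and makes \<open>sin \<eta>\<close> positive.\<close>
  define \<eta> where "\<eta> = min (\<delta>/2) 1"
  have \<eta>: "0 < \<eta>" "\<eta> < \<delta>" "\<eta> \<le> 1" using \<open>0 < \<delta>\<close> by (auto simp: \<eta>_def min_def)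
  have s: "0 < sin \<eta>" using \<eta> pi_gt3 by (intro sin_gt_zero) auto
  \<comment> \<open>Negative \<open>e\<close> are included so that \<open>e = 0\<close> is an
    interior point.\<close>
  define U where "U = {pi/2 - \<eta>..pi/2 + \<eta>} \<times> {-\<eta>..\<eta>}"
  have "continuous_on U (\<lambda>p. integral (cbox 0 (2 * pi)) (\<lambda>\<phi>. (c (fst p) (snd p)
      - h (fst p) (snd p) * (b * (snd p * cos \<phi>) + sin (fst p + snd p * cos \<phi>)))
      / (b + cos (fst p + snd p * cos \<phi>)) / sqrt (V (fst p) (snd p) (snd p * cos \<phi>))))"
  proof (rule integral_continuous_on_param, unfold case_prod_beta c_def, intro continuous_intros ballI)
    fix q :: "(real \<times> real) \<times> real" assume "q \<in> U \<times> cbox 0 (2 * pi)"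
    then have q: "\<bar>fst (fst q) - pi/2\<bar> \<le> \<eta>" "\<bar>snd (fst q)\<bar> \<le> \<eta>"
      by (auto simp: U_def abs_le_iff)
    have "\<bar>snd (fst q) * cos (snd q)\<bar> \<le> \<bar>snd (fst q)\<bar> * 1"
      unfolding abs_mult by (intro mult_left_mono) auto
    then have "0 < V (fst (fst q)) (snd (fst q)) (snd (fst q) * cos (snd q))"
      using q \<eta> by (intro V_pos) auto
    then show "sqrt (V (fst (fst q)) (snd (fst q)) (snd (fst q) * cos (snd q))) \<noteq> 0" by simp
    show "b + cos (fst (fst q) + snd (fst q) * cos (snd q)) \<noteq> 0"
      using f_pos[of "fst (fst q)" "snd (fst q) * cos (snd q)"] by (simp add: f_def)
  qed
  then have T: "continuous_on U (\<lambda>p. T (fst p) (snd p))" by (simp add: T_def)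
  have Te: "continuous_on {-\<eta>..\<eta>} (T m)" if "m \<in> {pi/2 - \<eta>..pi/2 + \<eta>}" for m
  proof -
    have "continuous_on {-\<eta>..\<eta>} (\<lambda>e. T (fst (m, e)) (snd (m, e)))"
      by (rule continuous_on_compose2[OF T]) (use that in \<open>auto simp: U_def intro!: continuous_on_Pair continuous_on_const continuous_on_id\<close>)
    then show ?thesis by simp
  qed
  have Tm: "continuous_on {pi/2 - \<eta>..pi/2 + \<eta>} (\<lambda>m. T m e)" if "e \<in> {-\<eta>..\<eta>}" for e
  proof -
    have "continuous_on {pi/2 - \<eta>..pi/2 + \<eta>} (\<lambda>m. T (fst (m, e)) (snd (m, e)))"
      by (rule continuous_on_compose2[OF T]) (use that in \<open>auto simp: U_def intro!: continuous_on_Pair continuous_on_const continuous_on_id\<close>)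
    then show ?thesis by simp
  qed
  have lim: "(T m \<longlongrightarrow> T m 0) (at_right 0)" if "m \<in> {pi/2 - \<eta>..pi/2 + \<eta>}" for m
  proof -
    have "isCont (T m) 0" by (rule continuous_on_interior[OF Te[OF that]]) (use \<eta> in auto)
    then show ?thesis by (simp add: isCont_def filterlim_at_split)
  qed
  have "1 < sqrt (1 + b * cos (pi/2 - \<eta>))"
    using s b by (simp add: cos_sin_eq[symmetric] cos_diff)
  then have "T (pi/2 - \<eta>) 0 < 2 * pi" unfolding T_circle by (simp add: divide_less_eq)
  with lim[of "pi/2 - \<eta>"] \<eta> have A: "\<forall>\<^sub>F e in at_right 0. T (pi/2 - \<eta>) e < 2 * pi"
    by (intro order_tendstoD) auto
  have "0 < V (pi/2 + \<eta>) 0 0" using \<eta> by (intro V_pos) auto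
  then have "0 < sqrt (1 + b * cos (pi/2 + \<eta>))" "sqrt (1 + b * cos (pi/2 + \<eta>)) < 1"
    using s b by (simp_all add: V_circle cos_add)
  then have "2 * pi < T (pi/2 + \<eta>) 0" unfolding T_circle by (simp add: less_divide_eq)
  with lim[of "pi/2 + \<eta>"] \<eta> have B: "\<forall>\<^sub>F e in at_right 0. 2 * pi < T (pi/2 + \<eta>) e"
    by (intro order_tendstoD) auto
  have "\<forall>\<^sub>F e in at_right 0. e < \<eta>" "\<forall>\<^sub>F e in at_right 0. 0 < (e::real)"
    using \<eta> by (auto simp: eventually_at_right_field intro: exI[of _ \<eta>] eventually_at_right_less)
  with A B have "\<forall>\<^sub>F e in at_right 0. T (pi/2 - \<eta>) e < 2 * pi \<and> 2 * pi < T (pi/2 + \<eta>) e \<and> e < \<eta> \<and> 0 < e"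
    by eventually_elim auto
  then obtain e where e: "T (pi/2 - \<eta>) e < 2 * pi" "2 * pi < T (pi/2 + \<eta>) e" "e < \<eta>" "0 < e"
    using eventually_happens'[of "at_right (0::real)"] by auto
  then obtain m where "pi/2 - \<eta> \<le> m" "m \<le> pi/2 + \<eta>" "T m e = 2 * pi"
    using IVT'[of "\<lambda>m. T m e" "pi/2 - \<eta>" "2 * pi" "pi/2 + \<eta>"] Tm[of e] \<eta> by auto
  then show ?thesis using e \<eta> by (intro exI[of _ m] exI[of _ e]) auto
qed

section \<open>Limits at the bifurcation point\<close>

definition "P m e y = V m e y * sqrt (V m e y) / f m y"
text \<open>The logarithmic derivative of \<open>P\<close> in \<open>y\<close>:
  \<open>P' = P * lam\<close> and \<open>P'' = P * (lam' + lam^2)\<close>.\<close>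

definition "lam m e y = 3/2 * V1 m e y / V m e y + sin (m + y) / f m y"
definition "lam' m e y = 3/2 * (V2 m e y / V m e y - (V1 m e y / V m e y)\<^sup>2)
  + cos (m + y) / f m y + (sin (m + y) / f m y)\<^sup>2"

lemma lam_deriv: "(lam m e has_real_derivative lam' m e y) (at y)" if V: "0 < V m e y"
proof -
  have f: "(f m has_real_derivative - sin (m + y)) (at y)"
    unfolding f_def[abs_def] by (auto intro!: derivative_eq_intros)
  have sin: "((\<lambda>y. sin (m + y)) has_real_derivative cos (m + y)) (at y)"
    by (auto intro!: derivative_eq_intros)
  have "((\<lambda>y. 3/2 * V1 m e y / V m e y + sin (m + y) / f m y) has_real_derivative
      (3/2 * V2 m e y * V m e y - 3/2 * V1 m e y * V1 m e y) / (V m e y * V m e y)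
      + (cos (m + y) * f m y - sin (m + y) * - sin (m + y)) / (f m y * f m y)) (at y)"
    by (intro DERIV_add DERIV_divide DERIV_cmult V_deriv sin f) (use V f_pos[of m y] in auto)
  then show ?thesis
    unfolding lam_def[abs_def]
    by (rule DERIV_cong) (use V f_pos[of m y] in \<open>simp add: lam'_def field_simps power2_eq_square\<close>)
qed

text \<open>\<open>p1\<close>, \<open>p2\<close> and \<open>- 1/b\<close> are the limits of
  \<open>P'/P\<close>, \<open>P''/P\<close> and \<open>f'/f\<close> at \<open>(pi/2, 0, 0)\<close>.
  Continuity there gives every claim, since \<open>V\<close> and \<open>f\<close> have the positive
  limits 1 and \<open>b\<close>.\<close>

lemma near_bifurcation:
  assumes "0 < \<kappa>"
  defines "p1 \<equiv> - b/2 - 1/(2 * b)"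
  defines "p2 \<equiv> 1/(4 * b\<^sup>2) - 1/4 - b\<^sup>2/6 + p1\<^sup>2"
  obtains \<delta> where "0 < \<delta>" "\<delta> \<le> \<kappa>"
    and "\<And>m e y. \<lbrakk>\<bar>m - pi/2\<bar> < \<delta>; \<bar>e\<bar> < \<delta>; \<bar>y\<bar> < \<delta>\<rbrakk> \<Longrightarrow>
      0 < V m e y \<and> 0 < c m e - h m e * (b * y + sin (m + y)) \<and> \<bar>lam m e 0 - p1\<bar> < \<kappa> \<and>
      \<bar>P m e y / P m e 0 - 1\<bar> < \<kappa> \<and> \<bar>P m e y / P m e 0 * (lam' m e y + (lam m e y)\<^sup>2) - p2\<bar> < \<kappa> \<and>
      \<bar>- sin (m + y) / f m 0 - - 1/b\<bar> < \<kappa>"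
proof -
  define p0 :: "real \<times> real \<times> real" where "p0 = (pi/2, 0, 0)"
  let ?m = "\<lambda>p::real \<times> real \<times> real. fst p" and ?e = "\<lambda>p::real \<times> real \<times> real. fst (snd p)"
    and ?y = "\<lambda>p::real \<times> real \<times> real. snd (snd p)"
  let ?F = "nhds p0"
  have lim: "(g \<longlongrightarrow> g p0) ?F" if "continuous_on UNIV g" for g :: "real \<times> real \<times> real \<Rightarrow> real"
  proof -
    have "isCont g p0" using that by (simp add: continuous_on_eq_continuous_at del: split_paired_All)
    then show ?thesis by (simp add: isCont_def tendsto_at_iff_tendsto_nhds)
  qed
  note ci = continuous_intros
  have V: "((\<lambda>p. V (?m p) (?e p) (?y p)) \<longlongrightarrow> 1) ?F"
    using lim[of "\<lambda>p. V (?m p) (?e p) (?y p)"] by (simp add: V_at_bifurcation p0_def ci)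
  have V0: "((\<lambda>p. V (?m p) (?e p) 0) \<longlongrightarrow> 1) ?F"
    using lim[of "\<lambda>p. V (?m p) (?e p) 0"] by (simp add: V_at_bifurcation p0_def ci)
  have V1: "((\<lambda>p. V1 (?m p) (?e p) (?y p)) \<longlongrightarrow> - b/3 - 1/b) ?F"
    using lim[of "\<lambda>p. V1 (?m p) (?e p) (?y p)"] by (simp add: V_at_bifurcation p0_def ci)
  have V10: "((\<lambda>p. V1 (?m p) (?e p) 0) \<longlongrightarrow> - b/3 - 1/b) ?F"
    using lim[of "\<lambda>p. V1 (?m p) (?e p) 0"] by (simp add: V_at_bifurcation p0_def ci)
  have V2: "((\<lambda>p. V2 (?m p) (?e p) (?y p)) \<longlongrightarrow> 1/2 + 1/(2 * b\<^sup>2)) ?F"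
    using lim[of "\<lambda>p. V2 (?m p) (?e p) (?y p)"] by (simp add: V_at_bifurcation p0_def ci)
  have f: "((\<lambda>p. f (?m p) (?y p)) \<longlongrightarrow> b) ?F" "((\<lambda>p. f (?m p) 0) \<longlongrightarrow> b) ?F"
    using lim[of "\<lambda>p. f (?m p) (?y p)"] lim[of "\<lambda>p. f (?m p) 0"] by (simp_all add: f_def p0_def ci)
  have sin: "((\<lambda>p. sin (?m p + ?y p)) \<longlongrightarrow> 1) ?F" "((\<lambda>p. sin (?m p + 0)) \<longlongrightarrow> 1) ?F"
    using lim[of "\<lambda>p. sin (?m p + ?y p)"] lim[of "\<lambda>p. sin (?m p + 0)"] by (simp_all add: p0_def ci)
  have cos: "((\<lambda>p. cos (?m p + ?y p)) \<longlongrightarrow> 0) ?F"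
    using lim[of "\<lambda>p. cos (?m p + ?y p)"] by (simp add: p0_def ci)
  have S: "((\<lambda>p. c (?m p) (?e p) - h (?m p) (?e p) * (b * ?y p + sin (?m p + ?y p))) \<longlongrightarrow> b) ?F"
    using lim[of "\<lambda>p. c (?m p) (?e p) - h (?m p) (?e p) * (b * ?y p + sin (?m p + ?y p))"]
    by (simp add: c_def p0_def ci)
  have b0: "b \<noteq> 0" "b > 0" using b by auto
  have lam: "((\<lambda>p. lam (?m p) (?e p) (?y p)) \<longlongrightarrow> 3/2 * (- b/3 - 1/b) / 1 + 1 / b) ?F"
    "((\<lambda>p. lam (?m p) (?e p) 0) \<longlongrightarrow> 3/2 * (- b/3 - 1/b) / 1 + 1 / b) ?F"
    unfolding lam_def by (intro tendsto_intros V V0 V1 V10 f sin b0 zero_neq_one[symmetric])+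
  have p1: "3/2 * (- b/3 - 1/b) / 1 + 1 / b = p1" using b0 by (simp add: p1_def field_simps)
  have lam': "((\<lambda>p. lam' (?m p) (?e p) (?y p)) \<longlongrightarrow>
      3/2 * ((1/2 + 1/(2 * b\<^sup>2)) / 1 - ((- b/3 - 1/b) / 1)\<^sup>2) + 0 / b + (1 / b)\<^sup>2) ?F"
    unfolding lam'_def by (intro tendsto_intros V V1 V2 f sin cos b0 zero_neq_one[symmetric])
  have P: "((\<lambda>p. P (?m p) (?e p) (?y p)) \<longlongrightarrow> 1 * sqrt 1 / b) ?F"
    "((\<lambda>p. P (?m p) (?e p) 0) \<longlongrightarrow> 1 * sqrt 1 / b) ?F"
    unfolding P_def by (intro tendsto_intros V V0 f b0)+
  have ratio: "((\<lambda>p. P (?m p) (?e p) (?y p) / P (?m p) (?e p) 0) \<longlongrightarrow> (1 * sqrt 1 / b) / (1 * sqrt 1 / b)) ?F"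
    by (intro tendsto_intros P) (use b0 in simp)
  have second: "((\<lambda>p. P (?m p) (?e p) (?y p) / P (?m p) (?e p) 0 * (lam' (?m p) (?e p) (?y p) + (lam (?m p) (?e p) (?y p))\<^sup>2)) \<longlongrightarrow>
      (1 * sqrt 1 / b) / (1 * sqrt 1 / b) * ((3/2 * ((1/2 + 1/(2 * b\<^sup>2)) / 1 - ((- b/3 - 1/b) / 1)\<^sup>2) + 0 / b + (1 / b)\<^sup>2) + p1\<^sup>2)) ?F"
    unfolding p1[symmetric] by (intro tendsto_intros ratio lam lam')
  have p2: "(1 * sqrt 1 / b) / (1 * sqrt 1 / b) * ((3/2 * ((1/2 + 1/(2 * b\<^sup>2)) / 1 - ((- b/3 - 1/b) / 1)\<^sup>2) + 0 / b + (1 / b)\<^sup>2) + p1\<^sup>2) = p2"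
    using b0 by (simp add: p2_def field_simps power2_eq_square)
  have sinf: "((\<lambda>p. - sin (?m p + ?y p) / f (?m p) 0) \<longlongrightarrow> - 1 / b) ?F"
    by (intro tendsto_intros f sin b0)
  have near: "\<forall>\<^sub>F p in ?F. \<bar>g p - l\<bar> < \<kappa>" if "(g \<longlongrightarrow> l) ?F" for g :: "real \<times> real \<times> real \<Rightarrow> real" and l
    using tendstoD[OF that \<open>0 < \<kappa>\<close>] by (simp add: dist_real_def)
  have "\<forall>\<^sub>F p in ?F. 0 < V (?m p) (?e p) (?y p)" using V by (rule order_tendstoD) simp
  moreover have "\<forall>\<^sub>F p in ?F. 0 < c (?m p) (?e p) - h (?m p) (?e p) * (b * ?y p + sin (?m p + ?y p))"
    using S b0(2) by (rule order_tendstoD)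
  moreover note near[OF lam(2)[unfolded p1]] near[OF ratio] near[OF second[unfolded p2]] near[OF sinf]
  ultimately have "\<forall>\<^sub>F p in ?F. 0 < V (?m p) (?e p) (?y p) \<and>
      0 < c (?m p) (?e p) - h (?m p) (?e p) * (b * ?y p + sin (?m p + ?y p)) \<and> \<bar>lam (?m p) (?e p) 0 - p1\<bar> < \<kappa> \<and>
      \<bar>P (?m p) (?e p) (?y p) / P (?m p) (?e p) 0 - 1\<bar> < \<kappa> \<and>
      \<bar>P (?m p) (?e p) (?y p) / P (?m p) (?e p) 0 * (lam' (?m p) (?e p) (?y p) + (lam (?m p) (?e p) (?y p))\<^sup>2) - p2\<bar> < \<kappa> \<and>
      \<bar>- sin (?m p + ?y p) / f (?m p) 0 - - 1/b\<bar> < \<kappa>"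
    by eventually_elim (use b0 in simp)
  then obtain d where d: "d > 0" and D: "\<And>p. dist p p0 < d \<Longrightarrow> 0 < V (?m p) (?e p) (?y p) \<and>
      0 < c (?m p) (?e p) - h (?m p) (?e p) * (b * ?y p + sin (?m p + ?y p)) \<and> \<bar>lam (?m p) (?e p) 0 - p1\<bar> < \<kappa> \<and>
      \<bar>P (?m p) (?e p) (?y p) / P (?m p) (?e p) 0 - 1\<bar> < \<kappa> \<and>
      \<bar>P (?m p) (?e p) (?y p) / P (?m p) (?e p) 0 * (lam' (?m p) (?e p) (?y p) + (lam (?m p) (?e p) (?y p))\<^sup>2) - p2\<bar> < \<kappa> \<and>
      \<bar>- sin (?m p + ?y p) / f (?m p) 0 - - 1/b\<bar> < \<kappa>"
    unfolding eventually_nhds_metric by blast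
  show ?thesis
  \<comment> \<open>The distance in the product is at most the sum of the three coordinate
    differences, hence \<open>d/3\<close>.\<close>
  proof (rule that[of "min \<kappa> (d/3)"])
    fix m e y assume *: "\<bar>m - pi/2\<bar> < min \<kappa> (d/3)" "\<bar>e\<bar> < min \<kappa> (d/3)" "\<bar>y\<bar> < min \<kappa> (d/3)"
    have "dist (m, e, y) p0 \<le> \<bar>m - pi/2\<bar> + dist (e, y) (0, 0)"
      unfolding p0_def dist_Pair_Pair[of m "(e, y)"] dist_real_def
      by (rule order_trans[OF sqrt_sum_squares_le_sum_abs]) simp
    also have "dist (e, y) (0, 0) \<le> \<bar>e\<bar> + \<bar>y\<bar>"
      unfolding dist_Pair_Pair dist_real_def by (rule order_trans[OF sqrt_sum_squares_le_sum_abs]) simp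
    finally have "dist (m, e, y) p0 < d" using * by linarith
    from D[OF this] show "0 < V m e y \<and> 0 < c m e - h m e * (b * y + sin (m + y)) \<and> \<bar>lam m e 0 - p1\<bar> < \<kappa> \<and>
      \<bar>P m e y / P m e 0 - 1\<bar> < \<kappa> \<and> \<bar>P m e y / P m e 0 * (lam' m e y + (lam m e y)\<^sup>2) - p2\<bar> < \<kappa> \<and>
      \<bar>- sin (m + y) / f m 0 - - 1/b\<bar> < \<kappa>" by simp
  qed (use \<open>0 < \<kappa>\<close> d in auto)
qed

lemma exists_stable_unduloid:
  assumes "b < 3" "0 < r"
  shows "\<exists>\<theta> t \<sigma> h L. unduloid_type (r * b) r \<theta> t \<sigma> h \<and> closed_curve r \<theta> t L \<and>
           embedded_curve r \<theta> t L \<and> stable_curve (r * b) r t h L"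
proof -
  have b0: "b > 0" using b by simp
  define p1 p2 f1 where "p1 = - b/2 - 1/(2 * b)"
    and "p2 = 1/(4 * b\<^sup>2) - 1/4 - b\<^sup>2/6 + p1\<^sup>2" and "f1 = - 1/b"
  define C where "C = f1 * p1 - p2/2 - f1\<^sup>2/4"
  \<comment> \<open>\<open>C\<close> is the limit of the second-order coefficient; its sign is that
    of \<open>3 - b\<close>.\<close>
  have "C = (9 - b\<^sup>2)/24"
    using b0 by (simp add: C_def p1_def p2_def f1_def field_simps power2_eq_square)
  moreover have "b\<^sup>2 < 3\<^sup>2" using b \<open>b < 3\<close> by (intro power_strict_mono) auto
  ultimately have C: "0 < C" by simp
  define M where "M = 2 + \<bar>p1\<bar> + \<bar>p2\<bar> + \<bar>f1\<bar>"
  have M: "1 \<le> M" "\<bar>p1\<bar> + 1 \<le> M" "\<bar>p2\<bar> \<le> M" "\<bar>f1\<bar> \<le> M" by (auto simp: M_def)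
  have M3: "M \<le> M^3" "1 \<le> M^3" using M(1) power_increasing[of 1 3 M] by (auto simp: one_le_power)
  \<comment> \<open>The 41 is the 40 demanded by the estimate on even functions plus 1 for replacing
    \<open>p1\<close> by \<open>l\<close> in \<open>C\<close>.\<close>
  define \<kappa> where "\<kappa> = min (1 / (100 * M^3)) (C / (41 * M^3))"
  have \<kappa>0: "0 < \<kappa>"
    unfolding \<kappa>_def min_less_iff_conj using C M3 by (intro conjI divide_pos_pos mult_pos_pos) linarith+
  have \<kappa>1: "\<kappa> * (100 * M^3) \<le> 1"
  proof -
    have "\<kappa> \<le> 1 / (100 * M^3)" unfolding \<kappa>_def by (rule min.cobounded1)
    then show ?thesis by (rule pos_le_divide_eq[THEN iffD1, rotated]) (use M3 in linarith)
  qed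
  have "\<kappa> * (41 * M^3) \<le> C"
  proof -
    have "\<kappa> \<le> C / (41 * M^3)" unfolding \<kappa>_def by (rule min.cobounded2)
    then show ?thesis by (rule pos_le_divide_eq[THEN iffD1, rotated]) (use M3 in linarith)
  qed
  then have \<kappa>2: "\<kappa> * (40 * M^3) + \<kappa> * M^3 \<le> C" by simp
  have \<kappa>le1: "\<kappa> \<le> 1" using \<kappa>1 \<kappa>0 M3 mult_left_mono[of 1 "100 * M^3" \<kappa>] by linarith
  obtain \<delta> where \<delta>: "0 < \<delta>" "\<delta> \<le> \<kappa>" and near: "\<And>m e y. \<lbrakk>\<bar>m - pi/2\<bar> < \<delta>; \<bar>e\<bar> < \<delta>; \<bar>y\<bar> < \<delta>\<rbrakk> \<Longrightarrow>
      0 < V m e y \<and> 0 < c m e - h m e * (b * y + sin (m + y)) \<and> \<bar>lam m e 0 - p1\<bar> < \<kappa> \<and>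
      \<bar>P m e y / P m e 0 - 1\<bar> < \<kappa> \<and> \<bar>P m e y / P m e 0 * (lam' m e y + (lam m e y)\<^sup>2) - p2\<bar> < \<kappa> \<and>
      \<bar>- sin (m + y) / f m 0 - f1\<bar> < \<kappa>"
    using near_bifurcation[OF \<kappa>0] unfolding p1_def p2_def f1_def by metis
  obtain m e where m: "\<bar>m - pi/2\<bar> < \<delta>" and e: "0 < e" "e < \<delta>" and T: "T m e = 2 * pi"
    using exists_period_2pi[OF \<delta>(1)] near by metis
  have n: "0 < V m e y" "0 < c m e - h m e * (b * y + sin (m + y))" "\<bar>lam m e 0 - p1\<bar> < \<kappa>"
      "\<bar>P m e y / P m e 0 - 1\<bar> < \<kappa>" "\<bar>P m e y / P m e 0 * (lam' m e y + (lam m e y)\<^sup>2) - p2\<bar> < \<kappa>"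
      "\<bar>- sin (m + y) / f m 0 - f1\<bar> < \<kappa>" if "\<bar>y\<bar> \<le> e" for y
    using near[OF m, of e y] e that by auto
  interpret O: oscillation b r m e "h m e" "c m e" "V m e" "V1 m e" "V2 m e"
    by unfold_locales (use assms(2) b e(1) V_deriv n(1,2) V_eq T in \<open>auto simp: f_def T_def\<close>)
  have P_eq: "O.P = P m e" by (simp add: fun_eq_iff O.P_def P_def O.f_def f_def)
  have P1_eq: "O.P1 y = P m e y * lam m e y" for y
    by (simp add: O.P1_def P_eq lam_def O.f_def f_def)
  have P0: "0 < P m e 0" using n(1)[of 0] e f_pos[of m 0] by (simp add: P_def)
  have f0: "0 < f m 0" by (rule f_pos)
  \<comment> \<open>The value at the actual \<open>m\<close> and \<open>e\<close>, not its limit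
    \<open>p1\<close>: \<open>p'\<close> has to be known up to \<open>\<kappa> * e^2\<close>,
    whereas \<open>e * (l - p1)\<close> is only bounded by \<open>\<kappa> * e\<close>. The term
    \<open>e * l * cos \<phi>\<close> integrates to 0, so \<open>l\<close> is compared with
    \<open>p1\<close> only in the coefficient of \<open>e^2\<close>.\<close>
  define l where "l = lam m e 0"
  have l: "\<bar>l - p1\<bar> < \<kappa>" using n(3)[of 0] e by (simp add: l_def)
  have Ml: "\<bar>l\<bar> \<le> M" using l M(2) \<kappa>le1 by linarith
  have "f1 * p1 - f1 * l \<le> \<kappa> * M^3"
  proof -
    have "\<bar>f1 * (p1 - l)\<bar> \<le> M * \<kappa>" unfolding abs_mult using M l by (intro mult_mono) auto
    also have "\<dots> \<le> \<kappa> * M^3" using M3 \<kappa>0 by (simp add: mult.commute)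
    finally show ?thesis by (simp add: algebra_simps)
  qed
  then have \<kappa>3: "\<kappa> * (40 * M^3) \<le> f1 * l - p2/2 - f1\<^sup>2/4" using \<kappa>2 unfolding C_def by linarith
  have P_deriv: "(P m e has_real_derivative P m e y * lam m e y) (at y)" if "\<bar>y\<bar> \<le> e" for y
    using O.P_deriv[OF that] by (simp add: P_eq P1_eq)
  have P1_deriv: "((\<lambda>y. P m e y * lam m e y) has_real_derivative P m e y * (lam' m e y + (lam m e y)\<^sup>2)) (at y)"
    if "\<bar>y\<bar> \<le> e" for y
    by (rule DERIV_cong[OF DERIV_mult[OF P_deriv[OF that] lam_deriv[OF n(1)[OF that]]]])
      (simp add: power2_eq_square algebra_simps)
  have ex: "\<bar>e * x\<bar> \<le> e" if "\<bar>x\<bar> \<le> 1" for x using mult_left_mono[OF that, of e] e by (simp add: abs_mult)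
  have "stable_curve (r * b) r O.t (- (h m e / r)) O.L"
  proof (rule O.stable)
    fix z z' assume z: "\<And>x. (z has_real_derivative z' x) (at x)" "continuous_on UNIV z'" "z (2 * pi) = z 0"
      and mean: "integral {0..2 * pi} (\<lambda>\<phi>. O.f (e * cos \<phi>) * z \<phi>) = 0"
    \<comment> \<open>Rescaling by \<open>y = e * x\<close> and dividing by the values at
      \<open>y = 0\<close> gives weights close to 1, with \<open>e\<close> in the role of
      \<open>\<epsilon>\<close>.\<close>
    define p p' F where "p x = P m e (e * x) / P m e 0"
      and "p' x = e * (P m e (e * x) * lam m e (e * x)) / P m e 0" and "F x = f m (e * x) / f m 0" for x
    have "0 \<le> integral {0..2 * pi} (\<lambda>x. p (cos x) * ((z' x)\<^sup>2 - (z x)\<^sup>2) - cos x * p' (cos x) * (z x)\<^sup>2)"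
    proof (rule index_periodic_nonneg[OF M(1) Ml M(3,4) \<kappa>1 \<kappa>3 e(1)])
      show "e \<le> \<kappa>" using e \<delta> by simp
      have L: "((\<lambda>x. e * x) has_real_derivative e) (at x)" for x by (auto intro!: derivative_eq_intros)
      show p: "(p has_real_derivative p' x) (at x)" if "\<bar>x\<bar> \<le> 1" for x
        unfolding p_def[abs_def]
        by (rule DERIV_cong[OF DERIV_cdivide[OF DERIV_chain2[OF P_deriv[OF ex[OF that]] L]]]) (simp add: p'_def)
      have "continuous_on {-1..1} (\<lambda>x. P m e (e * x) * lam m e (e * x))"
        by (intro continuous_at_imp_continuous_on ballI DERIV_isCont[OF DERIV_chain2[OF P1_deriv L]] ex) auto
      from continuous_on_divide[OF continuous_on_mult_left[OF this, of e] continuous_on_const, of "P m e 0"]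
      show "continuous_on {-1..1} p'" using P0 by (simp add: p'_def)
      show "continuous_on {-1..1} F"
        unfolding F_def f_def by (intro continuous_intros) (use f0 in \<open>auto simp: f_def\<close>)
      show "\<bar>p x - 1\<bar> \<le> \<kappa>" if "\<bar>x\<bar> \<le> 1" for x
        using n(4)[OF ex[OF that]] by (simp add: p_def)
      show "0 \<le> p x" if "\<bar>x\<bar> \<le> 1" for x
        unfolding p_def
        using P0 n(1)[OF ex[OF that]] f_pos[of m "e * x"] by (intro divide_nonneg_pos) (simp_all add: P_def)
      show "\<bar>p' x - e * l - e\<^sup>2 * p2 * x\<bar> \<le> \<kappa> * e\<^sup>2" if "\<bar>x\<bar> \<le> 1" for x
      proof -
        \<comment> \<open>\<open>P''\<close> divided by \<open>P m e 0\<close> is within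
          \<open>\<kappa>\<close> of \<open>p2\<close>, which bounds the error of the linear
          approximation of \<open>P'\<close> by \<open>\<kappa> * e\<close>; the rescaling
          contributes the second factor \<open>e\<close>.\<close>
        have "\<bar>P m e (e * x) * lam m e (e * x) / P m e 0 - P m e 0 * lam m e 0 / P m e 0 - p2 * (e * x)\<bar> \<le> \<kappa> * \<bar>e * x\<bar>"
        proof (rule linear_approximation_bound[where d = e])
          show "((\<lambda>y. P m e y * lam m e y / P m e 0) has_real_derivative
              P m e y * (lam' m e y + (lam m e y)\<^sup>2) / P m e 0) (at y)" if "\<bar>y\<bar> \<le> e" for y
            by (rule DERIV_cdivide[OF P1_deriv[OF that]])
          show "\<bar>P m e y * (lam' m e y + (lam m e y)\<^sup>2) / P m e 0 - p2\<bar> \<le> \<kappa>" if "\<bar>y\<bar> \<le> e" for y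
            using n(5)[OF that] by simp
        qed (rule ex[OF that])
        also have "\<dots> \<le> \<kappa> * e" using ex[OF that] \<kappa>0 by (intro mult_left_mono) auto
        finally have "e * \<bar>P m e (e * x) * lam m e (e * x) / P m e 0 - P m e 0 * lam m e 0 / P m e 0 - p2 * (e * x)\<bar>
            \<le> e * (\<kappa> * e)" using e by (intro mult_left_mono) auto
        also have "e * \<bar>P m e (e * x) * lam m e (e * x) / P m e 0 - P m e 0 * lam m e 0 / P m e 0 - p2 * (e * x)\<bar>
            = \<bar>e * (P m e (e * x) * lam m e (e * x) / P m e 0 - P m e 0 * lam m e 0 / P m e 0 - p2 * (e * x))\<bar>"
          using e by (simp add: abs_mult)
        also have "e * (P m e (e * x) * lam m e (e * x) / P m e 0 - P m e 0 * lam m e 0 / P m e 0 - p2 * (e * x))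
            = p' x - e * l - e\<^sup>2 * p2 * x"
          using P0 by (simp add: p'_def l_def power2_eq_square algebra_simps)
        finally show ?thesis by (simp add: power2_eq_square mult_ac)
      qed
      show "\<bar>F x - 1 - e * f1 * x\<bar> \<le> \<kappa> * e" if "\<bar>x\<bar> \<le> 1" for x
      proof -
        have "\<bar>f m (e * x) / f m 0 - f m 0 / f m 0 - f1 * (e * x)\<bar> \<le> \<kappa> * \<bar>e * x\<bar>"
        proof (rule linear_approximation_bound[where d = e])
          have "(f m has_real_derivative - sin (m + y)) (at y)" for y
            unfolding f_def[abs_def] by (auto intro!: derivative_eq_intros)
          then show "((\<lambda>y. f m y / f m 0) has_real_derivative - sin (m + y) / f m 0) (at y)" for y
            by (rule DERIV_cdivide)
          show "\<bar>- sin (m + y) / f m 0 - f1\<bar> \<le> \<kappa>" if "\<bar>y\<bar> \<le> e" for y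
            using n(6)[OF that] by simp
        qed (rule ex[OF that])
        also have "\<dots> \<le> \<kappa> * e" using ex[OF that] \<kappa>0 by (intro mult_left_mono) auto
        finally show ?thesis using f0 by (simp add: F_def mult_ac)
      qed
      have "integral {0..2 * pi} (\<lambda>x. F (cos x) * z x) = integral {0..2 * pi} (\<lambda>x. O.f (e * cos x) * z x / f m 0)"
        by (simp add: F_def O.f_def f_def)
      also have "\<dots> = integral {0..2 * pi} (\<lambda>\<phi>. O.f (e * cos \<phi>) * z \<phi>) / f m 0" by (rule integral_divide)
      finally show "integral {0..2 * pi} (\<lambda>x. F (cos x) * z x) = 0" by (simp add: mean)
    qed (use z in auto)
    also have "integral {0..2 * pi} (\<lambda>x. p (cos x) * ((z' x)\<^sup>2 - (z x)\<^sup>2) - cos x * p' (cos x) * (z x)\<^sup>2)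
      = integral {0..2 * pi} (\<lambda>x. (O.P (e * cos x) * ((z' x)\<^sup>2 - (z x)\<^sup>2)
        - e * cos x * O.P1 (e * cos x) * (z x)\<^sup>2) / P m e 0)"
      using P0 by (intro integral_cong) (simp add: P_eq P1_eq p_def p'_def field_simps)
    also have "\<dots> = integral {0..2 * pi} (\<lambda>x. O.P (e * cos x) * ((z' x)\<^sup>2 - (z x)\<^sup>2)
        - e * cos x * O.P1 (e * cos x) * (z x)\<^sup>2) / P m e 0" by (rule integral_divide)
    finally show "0 \<le> integral {0..2 * pi} (\<lambda>x. O.P (e * cos x) * ((z' x)\<^sup>2 - (z x)\<^sup>2)
        - e * cos x * O.P1 (e * cos x) * (z x)\<^sup>2)" using P0 by (simp add: zero_le_divide_iff)
  qed
  then show ?thesis using O.unduloid O.closed O.embedded by blast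
qed

end

theorem lemma2p11:
  fixes a r :: real
  assumes "0 < r" and "r < a" and "a < 3 * r"
  shows "\<exists>\<theta> t \<sigma> h L. unduloid_type a r \<theta> t \<sigma> h \<and> closed_curve r \<theta> t L \<and>
           embedded_curve r \<theta> t L \<and> stable_curve a r t h L"
proof -
  interpret bifurcation "a / r" by unfold_locales (use assms in simp)
  have "a / r < 3" using assms by (simp add: divide_less_eq)
  from exists_stable_unduloid[OF this assms(1)] show ?thesis using assms by simp
qed

end
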